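(* If $G$ is a non-commutative free group, then $(G,\mathfrak{P}_G)$ contains a countably infinite compact Hausdorff subspace with a single non-isolated point.
   Context: A topological group is precompact if it is a (topological) subgroup of some compact group. The precompact Markov topology $\mathfrak{P}_G$ of a group $G$ is the topology on $G$ whose closed sets are exactly the subsets of $G$ that are closed in every precompact Hausdorff group topology on $G$. *)

theory Defs
  imports "HOL-Analysis.Analysis" "HOL-Algebra.Coset"
begin

section \<open>Topological groups\<close>

definition group_topology :: "('a, 'm) monoid_scheme \<Rightarrow> 'a topology \<Rightarrow> bool" where
  "group_topology G T \<longleftrightarrow>
     group G \<and> topspace T = carrier G \<and>
     continuous_map (prod_topology T T) T (\<lambda>(x, y). x \<otimes>\<^bsub>G\<^esub> y) \<and>
     continuous_map T T (\<lambda>x. inv\<^bsub>G\<^esub> x)"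

definition embeds_topologically_in ::
  "('a, 'm) monoid_scheme \<Rightarrow> 'a topology \<Rightarrow> ('k, 'n) monoid_scheme \<Rightarrow> 'k topology \<Rightarrow> bool" where
  "embeds_topologically_in G T K S \<longleftrightarrow> (\<exists>h \<in> hom G K. embedding_map T S h)"

text \<open>
  HOL cannot quantify over the type of the ambient compact group, so its elements are taken from
  \<^typ>\<open>'a set set\<close>. This is large enough: lemma \<open>precompact_groupI\<close> below shows that a
  Hausdorff topological group which embeds in a compact group over an arbitrary type is
  precompact in the sense of this definition. The compact group is not required to be Hausdorff.
\<close>

definition precompact_group :: "('a, 'm) monoid_scheme \<Rightarrow> 'a topology \<Rightarrow> bool" where
  "precompact_group G T \<longleftrightarrow>
     group_topology G T \<and>
     (\<exists>(K :: 'a set set monoid) S.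
        group_topology K S \<and> compact_space S \<and> embeds_topologically_in G T K S)"

definition precompact_Hausdorff_topology :: "('a, 'm) monoid_scheme \<Rightarrow> 'a topology \<Rightarrow> bool" where
  "precompact_Hausdorff_topology G T \<longleftrightarrow> precompact_group G T \<and> Hausdorff_space T"


subsection \<open>Independence of the type of the compact group\<close>

lemma precompact_groupI:
  fixes G :: "('a, 'm) monoid_scheme" and K :: "('k, 'n) monoid_scheme"
  assumes GT: "group_topology G T" and T2: "Hausdorff_space T"
    and KS: "group_topology K S" and cpt: "compact_space S"
    and emb: "embeds_topologically_in G T K S"
  shows "precompact_group G T"
proof -
  obtain h where h: "h \<in> hom G K" and eh: "embedding_map T S h"
    using emb by (auto simp: embeds_topologically_in_def)
  interpret G: group G using GT by (simp add: group_topology_def)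
  interpret K: group K using KS by (simp add: group_topology_def)
  have tT: "topspace T = carrier G" using GT by (simp add: group_topology_def)
  have tS: "topspace S = carrier K"
    and cm: "continuous_map (prod_topology S S) S (\<lambda>(x, y). x \<otimes>\<^bsub>K\<^esub> y)"
    and ci: "continuous_map S S (\<lambda>x. inv\<^bsub>K\<^esub> x)"
    using KS by (auto simp: group_topology_def)
  have ch: "continuous_map T S h"
    using eh[unfolded embedding_map_def, THEN homeomorphic_imp_continuous_map]
    by (rule continuous_map_into_fulltopology)
  have oph: "\<exists>W. openin S W \<and> h ` U = W \<inter> h ` carrier G" if "openin T U" for U
  proof -
    have "openin (subtopology S (h ` topspace T)) (h ` U)"
      using eh[unfolded embedding_map_def, THEN homeomorphic_imp_open_map] that
      by (simp add: open_map_def)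
    thus ?thesis by (simp add: openin_subtopology tT)
  qed
  have hc: "h g \<in> carrier K" if "g \<in> carrier G" for g
    using h that by (auto simp: hom_def)
  have hm: "h (a \<otimes>\<^bsub>G\<^esub> b) = h a \<otimes>\<^bsub>K\<^esub> h b" if "a \<in> carrier G" "b \<in> carrier G" for a b
    using h that by (auto simp: hom_def)
  interpret gh: group_hom G K h
    using h by unfold_locales
  define D where "D = h ` carrier G"
  define H where "H = S closure_of D"
  have DK: "D \<subseteq> carrier K" using hc by (auto simp: D_def)
  have HK: "H \<subseteq> carrier K"
    unfolding H_def using closure_of_subset_topspace[of S D] tS by simp
  have DH: "D \<subseteq> H" unfolding H_def using DK tS closure_of_subset[of D S] by simp
  have multH: "x \<otimes>\<^bsub>K\<^esub> y \<in> H" if "x \<in> H" "y \<in> H" for x y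
  proof -
    have "(\<lambda>(x, y). x \<otimes>\<^bsub>K\<^esub> y) ` (D \<times> D) \<subseteq> D"
    proof safe
      fix x y assume "x \<in> D" "y \<in> D"
      then obtain a b where "a \<in> carrier G" "b \<in> carrier G" "x = h a" "y = h b"
        unfolding D_def by blast
      thus "x \<otimes>\<^bsub>K\<^esub> y \<in> D"
        unfolding D_def using hm[of a b] by (metis G.m_closed image_eqI)
    qed
    hence "S closure_of ((\<lambda>(x, y). x \<otimes>\<^bsub>K\<^esub> y) ` (D \<times> D)) \<subseteq> H"
      unfolding H_def by (rule closure_of_mono)
    moreover have "(\<lambda>(x, y). x \<otimes>\<^bsub>K\<^esub> y) ` (H \<times> H) \<subseteq> S closure_of ((\<lambda>(x, y). x \<otimes>\<^bsub>K\<^esub> y) ` (D \<times> D))"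
      using continuous_map_image_closure_subset[OF cm, of "D \<times> D"]
      by (simp add: closure_of_Times H_def)
    ultimately show ?thesis using that by auto
  qed
  have invH: "inv\<^bsub>K\<^esub> x \<in> H" if "x \<in> H" for x
  proof -
    have "(\<lambda>x. inv\<^bsub>K\<^esub> x) ` D \<subseteq> D"
    proof safe
      fix x assume "x \<in> D"
      then obtain a where a: "a \<in> carrier G" "x = h a" unfolding D_def by blast
      hence "inv\<^bsub>K\<^esub> x = h (inv\<^bsub>G\<^esub> a)" using gh.hom_inv by simp
      thus "inv\<^bsub>K\<^esub> x \<in> D" unfolding D_def using G.inv_closed[OF a(1)] by (rule image_eqI)
    qed
    hence "S closure_of ((\<lambda>x. inv\<^bsub>K\<^esub> x) ` D) \<subseteq> H"
      unfolding H_def by (rule closure_of_mono)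
    thus ?thesis
      using continuous_map_image_closure_subset[OF ci, of D] that by (auto simp: H_def)
  qed
  have oneH: "\<one>\<^bsub>K\<^esub> \<in> H"
  proof -
    have "h \<one>\<^bsub>G\<^esub> \<in> D" unfolding D_def by (rule imageI) (rule G.one_closed)
    thus ?thesis using DH by (auto simp: gh.hom_one)
  qed

  define t where "t x = {A. \<exists>U. openin S U \<and> x \<in> U \<and> A = {g \<in> carrier G. h g \<in> U}}" for x
  have t_eq: "y \<in> U" if xy: "x \<in> H" "y \<in> H" "t x = t y" and U: "openin S U" "x \<in> U" for x y U
  proof -
    have xK: "x \<in> carrier K" and yK: "y \<in> carrier K" using xy HK by auto
    have "openin (prod_topology S S) {z \<in> topspace (prod_topology S S). (case z of (x, y) \<Rightarrow> x \<otimes>\<^bsub>K\<^esub> y) \<in> U}"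
      by (rule openin_continuous_map_preimage[OF cm U(1)])
    moreover have "(x, \<one>\<^bsub>K\<^esub>) \<in> {z \<in> topspace (prod_topology S S). (case z of (x, y) \<Rightarrow> x \<otimes>\<^bsub>K\<^esub> y) \<in> U}"
      using xK U(2) tS by simp
    ultimately obtain V N where V: "openin S V" "x \<in> V" and N: "openin S N" "\<one>\<^bsub>K\<^esub> \<in> N"
      and VN: "V \<times> N \<subseteq> {z \<in> topspace (prod_topology S S). (case z of (x, y) \<Rightarrow> x \<otimes>\<^bsub>K\<^esub> y) \<in> U}"
      unfolding openin_prod_topology_alt by meson
    have "{g \<in> carrier G. h g \<in> V} \<in> t x" using V by (auto simp: t_def)
    then obtain W where W: "openin S W" "y \<in> W" "{g \<in> carrier G. h g \<in> V} = {g \<in> carrier G. h g \<in> W}"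
      unfolding xy(3) by (auto simp: t_def)
    have "continuous_map S S (\<lambda>g. inv\<^bsub>K\<^esub> g \<otimes>\<^bsub>K\<^esub> y)"
    proof -
      have "continuous_map S (prod_topology S S) (\<lambda>g. (inv\<^bsub>K\<^esub> g, y))"
        using ci yK tS by (simp add: continuous_map_pairedI)
      from continuous_map_compose[OF this cm] show ?thesis by (simp add: o_def)
    qed
    hence "openin S {g \<in> topspace S. inv\<^bsub>K\<^esub> g \<otimes>\<^bsub>K\<^esub> y \<in> N}"
      using N openin_continuous_map_preimage by blast
    hence "openin S (W \<inter> {g \<in> topspace S. inv\<^bsub>K\<^esub> g \<otimes>\<^bsub>K\<^esub> y \<in> N})" using W by blast
    moreover have "y \<in> W \<inter> {g \<in> topspace S. inv\<^bsub>K\<^esub> g \<otimes>\<^bsub>K\<^esub> y \<in> N}"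
      using W N yK tS by simp
    ultimately have "\<exists>d. d \<in> D \<and> d \<in> W \<inter> {g \<in> topspace S. inv\<^bsub>K\<^esub> g \<otimes>\<^bsub>K\<^esub> y \<in> N}"
      using xy(2) unfolding H_def in_closure_of by (auto simp del: Int_iff mem_Collect_eq)
    then obtain d where d: "d \<in> D" "d \<in> W" "inv\<^bsub>K\<^esub> d \<otimes>\<^bsub>K\<^esub> y \<in> N"
      by auto
    have "d \<in> V" using W(3) d by (auto simp: D_def)
    hence "(d, inv\<^bsub>K\<^esub> d \<otimes>\<^bsub>K\<^esub> y) \<in> V \<times> N" using d by simp
    hence "d \<otimes>\<^bsub>K\<^esub> (inv\<^bsub>K\<^esub> d \<otimes>\<^bsub>K\<^esub> y) \<in> U" using VN by auto
    moreover have "d \<in> carrier K" using d DK by auto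
    ultimately show ?thesis using yK by (simp flip: K.m_assoc)
  qed
  have t_eqI: "t x = t y" if "\<And>U. openin S U \<Longrightarrow> x \<in> U \<longleftrightarrow> y \<in> U" for x y
    using that unfolding t_def by (intro Collect_cong) auto
  have t_iff: "t x = t y \<longleftrightarrow> (\<forall>U. openin S U \<longrightarrow> (x \<in> U \<longleftrightarrow> y \<in> U))" if "x \<in> H" "y \<in> H" for x y
    using t_eq[OF that] t_eq[OF that(2,1)] t_eqI by metis

  define r where "r = inv_into H t"
  have r: "r l \<in> H" "t (r l) = l" if "l \<in> t ` H" for l
    using that by (auto simp: r_def inv_into_into f_inv_into_f)
  have rK: "r l \<in> carrier K" if "l \<in> t ` H" for l
    using r(1)[OF that] HK by blast
  have rt: "r (t x) \<in> U \<longleftrightarrow> x \<in> U" if "x \<in> H" "openin S U" for x U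
    using r[of "t x"] t_iff[of "r (t x)" x] that by auto
  have t_mult: "t (r (t x) \<otimes>\<^bsub>K\<^esub> r (t y)) = t (x \<otimes>\<^bsub>K\<^esub> y)" if xy: "x \<in> H" "y \<in> H" for x y
  proof (rule t_eqI)
    fix U assume U: "openin S U"
    define P where "P = {z \<in> topspace (prod_topology S S). (case z of (x, y) \<Rightarrow> x \<otimes>\<^bsub>K\<^esub> y) \<in> U}"
    have oP: "openin (prod_topology S S) P"
      unfolding P_def by (rule openin_continuous_map_preimage[OF cm U])
    have inP: "(a, b) \<in> P \<longleftrightarrow> a \<otimes>\<^bsub>K\<^esub> b \<in> U" if "a \<in> H" "b \<in> H" for a b
      using that HK tS by (auto simp: P_def)
    have "(r (t x), r (t y)) \<in> P \<longleftrightarrow> (x, y) \<in> P"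
    proof
      assume "(r (t x), r (t y)) \<in> P"
      then obtain V W where VW: "openin S V" "openin S W" "r (t x) \<in> V" "r (t y) \<in> W" "V \<times> W \<subseteq> P"
        using oP unfolding openin_prod_topology_alt by meson
      hence "x \<in> V" "y \<in> W" using rt xy by auto
      thus "(x, y) \<in> P" using VW by auto
    next
      assume "(x, y) \<in> P"
      then obtain V W where VW: "openin S V" "openin S W" "x \<in> V" "y \<in> W" "V \<times> W \<subseteq> P"
        using oP unfolding openin_prod_topology_alt by meson
      hence "r (t x) \<in> V" "r (t y) \<in> W" using rt xy by auto
      thus "(r (t x), r (t y)) \<in> P" using VW by auto
    qed
    thus "(r (t x) \<otimes>\<^bsub>K\<^esub> r (t y) \<in> U) = (x \<otimes>\<^bsub>K\<^esub> y \<in> U)"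
      using inP xy r by simp
  qed

  define L :: "'a set set monoid" where
    "L = \<lparr>carrier = t ` H, mult = (\<lambda>l m. t (r l \<otimes>\<^bsub>K\<^esub> r m)), one = t \<one>\<^bsub>K\<^esub>\<rparr>"
  have Lc: "carrier L = t ` H" by (simp add: L_def)
  have Lm: "t x \<otimes>\<^bsub>L\<^esub> t y = t (x \<otimes>\<^bsub>K\<^esub> y)" if "x \<in> H" "y \<in> H" for x y
    using t_mult that by (simp add: L_def)
  have L1: "\<one>\<^bsub>L\<^esub> = t \<one>\<^bsub>K\<^esub>" by (simp add: L_def)
  have L: "group L"
  proof (rule groupI)
    fix x y assume "x \<in> carrier L" "y \<in> carrier L"
    then show "x \<otimes>\<^bsub>L\<^esub> y \<in> carrier L" using Lm multH by (auto simp: Lc)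
  next
    show "\<one>\<^bsub>L\<^esub> \<in> carrier L" using oneH by (auto simp: L1 Lc)
  next
    fix x y z assume "x \<in> carrier L" "y \<in> carrier L" "z \<in> carrier L"
    then obtain a b c where abc: "a \<in> H" "b \<in> H" "c \<in> H" "x = t a" "y = t b" "z = t c"
      by (auto simp: Lc)
    moreover have "a \<in> carrier K" "b \<in> carrier K" "c \<in> carrier K" using abc HK by auto
    ultimately show "x \<otimes>\<^bsub>L\<^esub> y \<otimes>\<^bsub>L\<^esub> z = x \<otimes>\<^bsub>L\<^esub> (y \<otimes>\<^bsub>L\<^esub> z)"
      by (simp add: Lm multH K.m_assoc)
  next
    fix x assume "x \<in> carrier L"
    then obtain a where a: "a \<in> H" "x = t a" by (auto simp: Lc)
    moreover have aK: "a \<in> carrier K" using a HK by auto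
    ultimately show "\<one>\<^bsub>L\<^esub> \<otimes>\<^bsub>L\<^esub> x = x" using oneH by (simp add: L1 Lm)
    show "\<exists>y\<in>carrier L. y \<otimes>\<^bsub>L\<^esub> x = \<one>\<^bsub>L\<^esub>"
      using a aK invH[OF a(1)] by (intro bexI[of _ "t (inv\<^bsub>K\<^esub> a)"]) (auto simp: L1 Lm Lc)
  qed
  interpret L: group L by fact
  have Li: "inv\<^bsub>L\<^esub> l = t (inv\<^bsub>K\<^esub> (r l))" if l: "l \<in> carrier L" for l
  proof (rule L.inv_equality)
    have rl: "r l \<in> H" "t (r l) = l" using r l by (auto simp: Lc)
    hence "r l \<in> carrier K" using HK by auto
    hence "t (inv\<^bsub>K\<^esub> r l) \<otimes>\<^bsub>L\<^esub> t (r l) = \<one>\<^bsub>L\<^esub>"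
      using Lm[OF invH[OF rl(1)] rl(1)] by (simp add: L1)
    thus "t (inv\<^bsub>K\<^esub> r l) \<otimes>\<^bsub>L\<^esub> l = \<one>\<^bsub>L\<^esub>" using rl by simp
    show "t (inv\<^bsub>K\<^esub> r l) \<in> carrier L" using rl invH by (auto simp: Lc)
  qed (fact l)

  define Q where "Q = pullback_topology (t ` H) r S"
  have tQ: "topspace Q = carrier L"
    using rK by (auto simp: Q_def topspace_pullback_topology Lc tS)
  have oQ: "openin Q A \<longleftrightarrow> (\<exists>U. openin S U \<and> A = r -` U \<inter> t ` H)" for A
    by (simp add: Q_def openin_pullback_topology)
  have cr: "continuous_map Q S r"
    unfolding continuous_map
  proof (intro conjI allI impI)
    show "r ` topspace Q \<subseteq> topspace S" using rK by (auto simp: tQ Lc tS)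
    fix U assume "openin S U"
    thus "openin Q {x \<in> topspace Q. r x \<in> U}"
      unfolding oQ tQ Lc by (intro exI[of _ U]) auto
  qed
  have ct: "continuous_map (subtopology S H) Q t"
    unfolding continuous_map
  proof (intro conjI allI impI)
    show "t ` topspace (subtopology S H) \<subseteq> topspace Q" by (auto simp: tQ Lc)
    fix A assume "openin Q A"
    then obtain U where U: "openin S U" "A = r -` U \<inter> t ` H" by (auto simp: oQ)
    have "{x \<in> topspace (subtopology S H). t x \<in> A} = U \<inter> H"
      using U rt HK tS by auto
    thus "openin (subtopology S H) {x \<in> topspace (subtopology S H). t x \<in> A}"
      using U by (simp add: openin_subtopology) blast
  qed
  have crH: "continuous_map Q (subtopology S H) r"
    using cr r by (auto simp: continuous_map_in_subtopology tQ Lc)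
  have LQ: "group_topology L Q"
    unfolding group_topology_def
  proof (intro conjI)
    show "group L" "topspace Q = carrier L" by fact+
    have "continuous_map (prod_topology Q Q) (prod_topology S S) (\<lambda>(l, m). (r l, r m))"
      by (intro continuous_map_prod_top[THEN iffD2]) (use cr in auto)
    from continuous_map_compose[OF this cm]
    have "continuous_map (prod_topology Q Q) S (\<lambda>(l, m). r l \<otimes>\<^bsub>K\<^esub> r m)"
      by (simp add: o_def case_prod_unfold)
    hence "continuous_map (prod_topology Q Q) (subtopology S H) (\<lambda>(l, m). r l \<otimes>\<^bsub>K\<^esub> r m)"
      using r multH by (auto simp: continuous_map_in_subtopology tQ Lc)
    from continuous_map_compose[OF this ct]
    show "continuous_map (prod_topology Q Q) Q (\<lambda>(l, m). l \<otimes>\<^bsub>L\<^esub> m)"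
      by (simp add: o_def case_prod_unfold L_def)
    from continuous_map_compose[OF cr ci]
    have "continuous_map Q S (\<lambda>l. inv\<^bsub>K\<^esub> (r l))" by (simp add: o_def)
    hence "continuous_map Q (subtopology S H) (\<lambda>l. inv\<^bsub>K\<^esub> (r l))"
      using r invH by (auto simp: continuous_map_in_subtopology tQ Lc)
    from continuous_map_compose[OF this ct]
    show "continuous_map Q Q (\<lambda>l. inv\<^bsub>L\<^esub> l)"
      by (rule continuous_map_eq) (simp add: tQ Li)
  qed
  have "compact_space (subtopology S H)"
    unfolding H_def by (intro compact_space_subtopology closedin_compact_space cpt) simp
  moreover have "topspace (subtopology S H) = H" using HK tS by auto
  ultimately have "compactin Q (t ` H)"
    using image_compactin[OF _ ct, of H] by (simp add: compact_space_def)
  hence cQ: "compact_space Q" by (simp add: compact_space_def tQ Lc)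

  have injt: "g = g'" if g: "g \<in> carrier G" "g' \<in> carrier G" and e: "t (h g) = t (h g')" for g g'
  proof (rule ccontr)
    assume "g \<noteq> g'"
    then obtain U where U: "openin T U" "g \<in> U" "g' \<notin> U"
      using T2 g unfolding Hausdorff_space_def disjnt_iff tT by metis
    obtain W where W: "openin S W" "h ` U = W \<inter> h ` carrier G"
      using oph[OF U(1)] by blast
    have gH: "h g \<in> H" "h g' \<in> H" using g DH by (auto simp: D_def)
    have "h g \<in> W" using W U by auto
    hence "h g' \<in> W" using t_iff[OF gH] e W by auto
    hence "h g' \<in> h ` U" using W g by auto
    moreover have "inj_on h (carrier G)"
      using eh unfolding embedding_map_def tT[symmetric] by (rule homeomorphic_imp_injective_map)
    moreover have "U \<subseteq> carrier G" using U openin_subset tT by metis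
    ultimately have "g' \<in> U" using g by (auto simp: inj_on_def)
    thus False using U by simp
  qed
  have embt: "embedding_map T Q (\<lambda>g. t (h g))"
    unfolding embedding_map_def
  proof (rule bijective_open_imp_homeomorphic_map)
    have "continuous_map T (subtopology S H) h"
      using ch DH by (auto simp: continuous_map_in_subtopology tT D_def)
    from continuous_map_compose[OF this ct]
    have c: "continuous_map T Q (\<lambda>g. t (h g))" by (simp add: o_def)
    thus "continuous_map T (subtopology Q ((\<lambda>g. t (h g)) ` topspace T)) (\<lambda>g. t (h g))"
      by (auto simp: continuous_map_in_subtopology)
    show "inj_on (\<lambda>g. t (h g)) (topspace T)"
      using injt by (auto simp: inj_on_def tT)
    have "(\<lambda>g. t (h g)) ` topspace T \<subseteq> topspace Q"
      using c by (rule continuous_map_image_subset_topspace)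
    thus "(\<lambda>g. t (h g)) ` topspace T = topspace (subtopology Q ((\<lambda>g. t (h g)) ` topspace T))"
      by auto
    show "open_map T (subtopology Q ((\<lambda>g. t (h g)) ` topspace T)) (\<lambda>g. t (h g))"
      unfolding open_map_def
    proof (intro allI impI)
      fix U assume U: "openin T U"
      obtain W where W: "openin S W" "h ` U = W \<inter> h ` carrier G"
        using oph[OF U] by blast
      have UG: "U \<subseteq> carrier G" using U openin_subset tT by metis
      have hH: "h g \<in> H" if "g \<in> carrier G" for g using that DH by (auto simp: D_def)
      have iff: "g \<in> U \<longleftrightarrow> h g \<in> W" if "g \<in> carrier G" for g
      proof
        assume "g \<in> U"
        hence "h g \<in> h ` U" by (rule imageI)
        thus "h g \<in> W" unfolding W(2) by (rule IntD1)
      next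
        assume "h g \<in> W"
        hence "h g \<in> h ` U" unfolding W(2) using that by (simp add: imageI)
        then obtain u where "u \<in> U" "h g = h u" by (rule imageE)
        moreover have "u \<in> carrier G" using \<open>u \<in> U\<close> UG by blast
        ultimately have "g = u" using injt[of g u] that by simp
        thus "g \<in> U" using \<open>u \<in> U\<close> by simp
      qed
      have "(\<lambda>g. t (h g)) ` U = (r -` W \<inter> t ` H) \<inter> (\<lambda>g. t (h g)) ` topspace T"
      proof (intro equalityI subsetI)
        fix l assume "l \<in> (\<lambda>g. t (h g)) ` U"
        then obtain g where g: "g \<in> U" "l = t (h g)" by blast
        hence gG: "g \<in> carrier G" using UG by blast
        have "r l \<in> W" using rt[OF hH[OF gG] W(1)] iff[OF gG] g by simp
        thus "l \<in> (r -` W \<inter> t ` H) \<inter> (\<lambda>g. t (h g)) ` topspace T"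
          using gG hH[OF gG] g(2) by (simp add: tT)
      next
        fix l assume l: "l \<in> (r -` W \<inter> t ` H) \<inter> (\<lambda>g. t (h g)) ` topspace T"
        then obtain g where gG: "g \<in> carrier G" "l = t (h g)" unfolding tT by blast
        hence "g \<in> U" using l rt[OF hH[OF gG(1)] W(1)] iff[OF gG(1)] by simp
        thus "l \<in> (\<lambda>g. t (h g)) ` U" using gG(2) by blast
      qed
      moreover have "openin Q (r -` W \<inter> t ` H)" using W(1) oQ by blast
      ultimately show "openin (subtopology Q ((\<lambda>g. t (h g)) ` topspace T)) ((\<lambda>g. t (h g)) ` U)"
        unfolding openin_subtopology by blast
    qed
  qed
  have "(\<lambda>g. t (h g)) \<in> hom G L"
  proof (rule homI)
    have hH: "h g \<in> H" if "g \<in> carrier G" for g using that DH by (auto simp: D_def)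
    fix x y assume "x \<in> carrier G" "y \<in> carrier G"
    thus "t (h x) \<in> carrier L" "t (h (x \<otimes>\<^bsub>G\<^esub> y)) = t (h x) \<otimes>\<^bsub>L\<^esub> t (h y)"
      using hH by (auto simp: Lc Lm hm)
  qed
  hence "embeds_topologically_in G T L Q"
    using embt unfolding embeds_topologically_in_def by blast
  thus ?thesis
    using GT LQ cQ unfolding precompact_group_def by blast
qed


section \<open>The precompact Markov topology\<close>

definition precompact_Markov_topology :: "('a, 'm) monoid_scheme \<Rightarrow> 'a topology" where
  "precompact_Markov_topology G =
     topology (\<lambda>U. U \<subseteq> carrier G \<and>
       (\<forall>T. precompact_Hausdorff_topology G T \<longrightarrow> closedin T (carrier G - U)))"

lemma openin_precompact_Markov_topology:
  "openin (precompact_Markov_topology G) U \<longleftrightarrow>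
     U \<subseteq> carrier G \<and>
     (\<forall>T. precompact_Hausdorff_topology G T \<longrightarrow> closedin T (carrier G - U))"
proof -
  have eq: "(\<lambda>U. U \<subseteq> carrier G \<and>
        (\<forall>T. precompact_Hausdorff_topology G T \<longrightarrow> closedin T (carrier G - U))) =
      (\<lambda>U. U \<subseteq> carrier G \<and> (\<forall>T. precompact_Hausdorff_topology G T \<longrightarrow> openin T U))"
    by (intro ext conj_cong all_cong imp_cong refl)
      (auto simp: precompact_Hausdorff_topology_def precompact_group_def group_topology_def
        openin_closedin_eq)
  have "istopology (\<lambda>U. U \<subseteq> carrier G \<and>
      (\<forall>T. precompact_Hausdorff_topology G T \<longrightarrow> openin T U))"
    unfolding istopology_def by (auto intro!: openin_Int openin_Union)
  thus ?thesis
    unfolding precompact_Markov_topology_def eq by (simp add: topology_inverse' fun_cong[OF eq])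
qed

lemma topspace_precompact_Markov_topology [simp]:
  "topspace (precompact_Markov_topology G) = carrier G"
proof -
  have "openin (precompact_Markov_topology G) (carrier G)"
    by (simp add: openin_precompact_Markov_topology)
  thus ?thesis
    using openin_subset openin_topspace openin_precompact_Markov_topology by (metis subset_antisym)
qed

lemma closedin_precompact_Markov_topology:
  "closedin (precompact_Markov_topology G) A \<longleftrightarrow>
     A \<subseteq> carrier G \<and> (\<forall>T. precompact_Hausdorff_topology G T \<longrightarrow> closedin T A)"
  by (auto simp: closedin_def[of "precompact_Markov_topology G"] openin_precompact_Markov_topology
      double_diff)


section \<open>Free groups\<close>

text \<open>
  A letter \<open>(True, s)\<close> stands for the generator \<open>s\<close>, and \<open>(False, s)\<close> for its inverse.
\<close>

primrec letter_value :: "('a, 'm) monoid_scheme \<Rightarrow> bool \<times> 'a \<Rightarrow> 'a" where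
  "letter_value G (b, s) = (if b then s else inv\<^bsub>G\<^esub> s)"

definition word_value :: "('a, 'm) monoid_scheme \<Rightarrow> (bool \<times> 'a) list \<Rightarrow> 'a" where
  "word_value G w = foldr (\<lambda>l x. letter_value G l \<otimes>\<^bsub>G\<^esub> x) w \<one>\<^bsub>G\<^esub>"

definition reduced_words :: "'a set \<Rightarrow> (bool \<times> 'a) list set" where
  "reduced_words S =
     {w. set w \<subseteq> UNIV \<times> S \<and>
         (\<forall>i. Suc i < length w \<longrightarrow> w ! Suc i \<noteq> (\<not> fst (w ! i), snd (w ! i)))}"

text \<open>
  \<open>G\<close> is free on \<open>S\<close> if every element is the value of exactly one reduced word over \<open>S\<close>.
\<close>

definition free_group_on :: "('a, 'm) monoid_scheme \<Rightarrow> 'a set \<Rightarrow> bool" where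
  "free_group_on G S \<longleftrightarrow>
     group G \<and> S \<subseteq> carrier G \<and> bij_betw (word_value G) (reduced_words S) (carrier G)"

definition free_group :: "('a, 'm) monoid_scheme \<Rightarrow> bool" where
  "free_group G \<longleftrightarrow> (\<exists>S. free_group_on G S)"

end

theory Submission
  imports Defs "HOL-Algebra.Sym_Groups" "HOL-Algebra.Product_Groups"
begin

text \<open>
The set sought consists of a sequence \<open>w\<^sub>N\<close> together with its limit \<open>1\<close>, where the \<open>w\<^sub>N\<close> are
nontrivial, infinitely many, and converge to \<open>1\<close> in \<^emph>\<open>every\<close> precompact Hausdorff group topology
simultaneously. Given such a sequence, every subset of \<open>X = {1} \<union> {w\<^sub>N}\<close> that is finite or
contains \<open>1\<close> is closed in all these topologies, so it is closed in the precompact Markov topology;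
this makes \<open>X\<close> Hausdorff and every \<open>w\<^sub>N\<close> isolated. The Markov topology is coarser than each
precompact Hausdorff topology, so a single one of them already forces \<open>w\<^sub>N\<close> to converge to \<open>1\<close>
in it, and \<open>X\<close> is compact with \<open>1\<close> not isolated. At least one such topology has to exist: it is
induced by the finite quotients of \<open>G\<close> (lemmas \<open>free_group_residually_finite\<close> and
\<open>free_group_precompact_topology\<close>).

The words \<open>w\<^sub>N\<close> follow an idea of A. Thom. In a unitary group the distance \<open>\<nu>(g) = \<parallel>g - 1\<parallel>\<close> is
invariant under conjugation and satisfies \<open>\<nu>([g, h]) \<le> 2 \<nu>(g) \<nu>(h)\<close>. By compactness some power
\<open>a\<^sup>k\<close> with \<open>k > 0\<close> has \<open>\<nu>(a\<^sup>k) \<le> 1/8\<close>, but \<open>k\<close> depends on the group and on \<open>a\<close>. So the word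
\<open>w\<^sub>N\<close> is a nested commutator of entries built from \<open>a, a\<^sup>2, \<dots>, a\<^sup>N\<close>, and each entry is
first replaced \<open>N\<close> times by a commutator of itself with a conjugate of itself. This squares the
length of the good entry \<open>N\<close> times, a doubly exponential gain; the other entries cost
at most a factor \<open>4\<close> each (lemma \<open>Thom_word_bound\<close>). Conjugating letters inserted between the
entries prevent cancellation, so the words are reduced and nontrivial (lemma
\<open>bracketed_Thom_word\<close>).

For an arbitrary compact group \<open>K\<close> one needs functions \<open>\<nu>\<close> of this kind that are continuous at \<open>1\<close>
and detect every point that can be separated from \<open>1\<close>. The Peter-Weyl theorem provides them; the
theorem \<open>separating_commutator_length\<close> obtains them without finite-dimensional representations,
measures or completions. Let \<open>K\<close> act by right translation on its continuous functions, with the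
inner product given by the invariant mean, and let \<open>T\<close> be convolution with a symmetric bump
function. \<open>T\<close> is self-adjoint, commutes with right translations, and maps bounded sets to
equicontinuous ones. On a space \<open>W\<close> of functions orthogonal to all functions fixed by the
conjugates of \<open>z\<close>, normalize \<open>T\<close> to norm \<open>1\<close> and let \<open>\<nu>(g)\<close> be the limit of
the norms of \<open>(g - 1) T\<^sup>m\<close> on \<open>W\<close>; morally this is the norm of \<open>g - 1\<close> on the top eigenspace of \<open>T\<close>.
If \<open>\<nu>(z)\<close> were \<open>0\<close>, then the normal subgroup generated by \<open>z\<close> would almost fix a vector of
\<open>W\<close> of norm at least \<open>1/2\<close>, contrary to the definition of \<open>W\<close>.
\<close>


section \<open>Compact groups\<close>

text \<open>
  Compactness of \<open>Y\<close> makes continuity at \<open>a\<close> uniform in the second variable.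
\<close>

lemma continuous_map_tube:
  fixes F :: "'x \<times> 'y \<Rightarrow> real"
  assumes F: "continuous_map (prod_topology X Y) euclideanreal F" and Y: "compact_space Y"
    and a: "a \<in> topspace X" and e: "\<epsilon> > 0"
  obtains V where "openin X V" "a \<in> V" "\<And>x y. x \<in> V \<Longrightarrow> y \<in> topspace Y \<Longrightarrow> \<bar>F (x, y) - F (a, y)\<bar> < \<epsilon>"
proof -
  define D where "D p = \<bar>F p - F (a, snd p)\<bar>" for p
  have "continuous_map (prod_topology X Y) (prod_topology X Y) (\<lambda>p. (a, snd p))"
    using a by (intro continuous_map_pairedI) (auto simp: continuous_map_snd)
  then have "continuous_map (prod_topology X Y) euclideanreal (\<lambda>p. F (a, snd p))"
    using F continuous_map_compose[of _ _ "\<lambda>p. (a, snd p)" _ F] by (simp add: o_def)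
  then have D: "continuous_map (prod_topology X Y) euclideanreal D"
    unfolding D_def using F by (intro continuous_map_real_abs continuous_map_diff)
  have "openin (prod_topology X Y) {p \<in> topspace (prod_topology X Y). D p \<in> {..<\<epsilon>}}"
    by (rule openin_continuous_map_preimage[OF D]) simp
  moreover have "{a} \<times> topspace Y \<subseteq> {p \<in> topspace (prod_topology X Y). D p \<in> {..<\<epsilon>}}"
    using a e by (auto simp: D_def)
  ultimately have "\<exists>U V. openin X U \<and> openin Y V \<and> a \<in> U \<and> topspace Y \<subseteq> V \<and>
      U \<times> V \<subseteq> {p \<in> topspace (prod_topology X Y). D p \<in> {..<\<epsilon>}}"
    using Y a by (intro tube_lemma_right) (simp_all add: compact_space_def)
  then obtain U V where UV: "openin X U" "a \<in> U" "topspace Y \<subseteq> V"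
      "U \<times> V \<subseteq> {p \<in> topspace (prod_topology X Y). D p \<in> {..<\<epsilon>}}"
    by blast
  show ?thesis
  proof (rule that[OF UV(1,2)])
    fix x y assume "x \<in> U" "y \<in> topspace Y"
    then have "(x, y) \<in> {p \<in> topspace (prod_topology X Y). D p \<in> {..<\<epsilon>}}"
      using UV(3,4) by blast
    then show "\<bar>F (x, y) - F (a, y)\<bar> < \<epsilon>" by (simp add: D_def)
  qed
qed

lemma continuous_map_realI:
  fixes f :: "'x \<Rightarrow> real"
  assumes "\<And>x \<epsilon>. x \<in> topspace X \<Longrightarrow> \<epsilon> > 0 \<Longrightarrow> \<exists>V. openin X V \<and> x \<in> V \<and> (\<forall>y\<in>V. \<bar>f y - f x\<bar> < \<epsilon>)"
  shows "continuous_map X euclideanreal f"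
  unfolding continuous_map
proof (intro conjI allI impI)
  fix U :: "real set" assume "openin euclidean U"
  then have U: "open U" by simp
  show "openin X {x \<in> topspace X. f x \<in> U}"
  proof (subst openin_subopen, intro ballI)
    fix x assume x: "x \<in> {x \<in> topspace X. f x \<in> U}"
    then obtain \<epsilon> where e: "\<epsilon> > 0" "\<And>t. \<bar>t - f x\<bar> < \<epsilon> \<Longrightarrow> t \<in> U"
      using U unfolding open_dist dist_real_def by blast
    obtain V where "openin X V" "x \<in> V" "\<forall>y\<in>V. \<bar>f y - f x\<bar> < \<epsilon>"
      using assms[of x] x e(1) by blast
    then show "\<exists>T. openin X T \<and> x \<in> T \<and> T \<subseteq> {x \<in> topspace X. f x \<in> U}"
      using e(2) openin_subset by (intro exI[of _ V]) blast
  qed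
qed auto

text \<open>
  The Hausdorff axiom is omitted because the compact group in the definition of precompactness may
  fail it. Points are therefore separated from \<open>1\<close> by open sets wherever this matters.
\<close>

locale compact_group = group K for K :: "('k, 'n) monoid_scheme" (structure) +
  fixes S :: "'k topology"
  assumes group_topology: "group_topology K S" and compact: "compact_space S"
begin

lemma topspace_carrier [simp]: "topspace S = carrier K"
  using group_topology by (simp add: group_topology_def)

lemma continuous_mult:
  assumes "continuous_map X S f" "continuous_map X S g"
  shows "continuous_map X S (\<lambda>x. f x \<otimes> g x)"
proof -
  have "continuous_map (prod_topology S S) S (\<lambda>(x, y). x \<otimes> y)"
    using group_topology by (simp add: group_topology_def)
  from continuous_map_compose[OF _ this, of X "\<lambda>x. (f x, g x)"] assms show ?thesis
    by (simp add: continuous_map_pairedI o_def)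
qed

lemma continuous_inv:
  assumes "continuous_map X S f"
  shows "continuous_map X S (\<lambda>x. inv (f x))"
  using group_topology continuous_map_compose[OF assms, of S "\<lambda>x. inv x"]
  by (simp add: group_topology_def o_def)

lemma continuous_const: "c \<in> carrier K \<Longrightarrow> continuous_map X S (\<lambda>x. c)"
  by simp

lemmas continuous_group = continuous_mult continuous_inv continuous_const
  continuous_map_fst continuous_map_snd
  continuous_map_compose[OF continuous_map_snd continuous_map_fst, unfolded o_def]
  continuous_map_compose[OF continuous_map_snd continuous_map_snd, unfolded o_def]

lemma continuous_at:
  assumes f: "continuous_map S euclideanreal f" and g: "continuous_map X S g"
  shows "continuous_map X euclideanreal (\<lambda>x. f (g x))"
  using continuous_map_compose[OF g f] by (simp add: o_def)

lemma openin_preimage: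
  assumes "openin S U" "continuous_map S S g"
  shows "openin S {x \<in> carrier K. g x \<in> U}"
  using openin_continuous_map_preimage[OF assms(2,1)] by simp

text \<open>
  The perturbation \<open>g\<close> may stand between \<open>u\<close> and \<open>v\<close> because \<open>K \<times> K\<close> is compact. This
  simultaneous left and right uniformity lets right translations be compared after a left
  convolution.
\<close>

lemma uniformly_continuous:
  assumes f: "continuous_map S euclideanreal f" and e: "\<epsilon> > 0"
  obtains V where "openin S V" "\<one> \<in> V"
    "\<And>g u v. g \<in> V \<Longrightarrow> u \<in> carrier K \<Longrightarrow> v \<in> carrier K \<Longrightarrow> \<bar>f (u \<otimes> g \<otimes> v) - f (u \<otimes> v)\<bar> < \<epsilon>"
proof -
  have "continuous_map (prod_topology S (prod_topology S S)) euclideanreal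
      (\<lambda>p. f (fst (snd p) \<otimes> fst p \<otimes> snd (snd p)))"
    by (intro continuous_at[OF f] continuous_group)
  moreover have "compact_space (prod_topology S S)"
    using compact by (simp add: compact_space_prod_topology)
  ultimately obtain V where V: "openin S V" "\<one> \<in> V"
    "\<And>x y. x \<in> V \<Longrightarrow> y \<in> topspace (prod_topology S S) \<Longrightarrow>
      \<bar>f (fst (snd (x, y)) \<otimes> fst (x, y) \<otimes> snd (snd (x, y))) -
        f (fst (snd (\<one>, y)) \<otimes> fst (\<one>, y) \<otimes> snd (snd (\<one>, y)))\<bar> < \<epsilon>"
    by (rule continuous_map_tube[where a=\<one> and \<epsilon>=\<epsilon>]) (use e in simp_all)
  show ?thesis
  proof (rule that[OF V(1,2)])
    fix g u v assume "g \<in> V" "u \<in> carrier K" "v \<in> carrier K"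
    then show "\<bar>f (u \<otimes> g \<otimes> v) - f (u \<otimes> v)\<bar> < \<epsilon>"
      using V(3)[of g "(u, v)"] by simp
  qed
qed

lemma difference_neighbourhood:
  assumes U: "openin S U" "\<one> \<in> U"
  obtains V where "openin S V" "\<one> \<in> V" "\<And>x y. x \<in> V \<Longrightarrow> y \<in> V \<Longrightarrow> x \<otimes> inv y \<in> U"
    "\<And>x y. x \<in> V \<Longrightarrow> y \<in> V \<Longrightarrow> inv x \<otimes> y \<in> U"
proof -
  have *: "\<exists>A B. openin S A \<and> openin S B \<and> \<one> \<in> A \<and> \<one> \<in> B \<and> (\<forall>x\<in>A. \<forall>y\<in>B. d x y \<in> U)"
    if d: "continuous_map (prod_topology S S) S (\<lambda>p. d (fst p) (snd p))" "d \<one> \<one> = \<one>" for d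
  proof -
    have "openin (prod_topology S S) {p \<in> topspace (prod_topology S S). d (fst p) (snd p) \<in> U}"
      using openin_continuous_map_preimage[OF d(1) U(1)] .
    moreover have "(\<one>, \<one>) \<in> {p \<in> topspace (prod_topology S S). d (fst p) (snd p) \<in> U}"
      using U d by simp
    ultimately obtain A B where "openin S A" "openin S B" "\<one> \<in> A" "\<one> \<in> B"
      "A \<times> B \<subseteq> {p \<in> topspace (prod_topology S S). d (fst p) (snd p) \<in> U}"
      unfolding openin_prod_topology_alt by meson
    then show ?thesis by (intro exI[of _ A] exI[of _ B]) auto
  qed
  obtain A B where AB: "openin S A" "openin S B" "\<one> \<in> A" "\<one> \<in> B" "\<forall>x\<in>A. \<forall>y\<in>B. x \<otimes> inv y \<in> U"
    using *[of "\<lambda>x y. x \<otimes> inv y", OF continuous_mult[OF continuous_map_fst continuous_inv[OF continuous_map_snd]]]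
    by auto
  obtain A' B' where AB': "openin S A'" "openin S B'" "\<one> \<in> A'" "\<one> \<in> B'" "\<forall>x\<in>A'. \<forall>y\<in>B'. inv x \<otimes> y \<in> U"
    using *[of "\<lambda>x y. inv x \<otimes> y", OF continuous_mult[OF continuous_inv[OF continuous_map_fst] continuous_map_snd]]
    by auto
  show ?thesis
    using AB AB' by (intro that[of "A \<inter> B \<inter> (A' \<inter> B')"]) auto
qed

lemma finite_translates_cover:
  assumes V: "openin S V" "\<one> \<in> V"
  obtains F where "finite F" "F \<subseteq> carrier K" "F \<noteq> {}"
    "\<And>x. x \<in> carrier K \<Longrightarrow> \<exists>k\<in>F. x \<otimes> inv k \<in> V"
proof -
  define O' where "O' k = {x \<in> carrier K. x \<otimes> inv k \<in> V}" for k
  have "openin S (O' k)" if "k \<in> carrier K" for k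
    unfolding O'_def using that V by (intro openin_preimage continuous_group) auto
  moreover have "carrier K \<subseteq> \<Union> (O' ` carrier K)"
    using V by (auto simp: O'_def)
  ultimately obtain \<F> where "finite \<F>" "\<F> \<subseteq> O' ` carrier K" "carrier K \<subseteq> \<Union> \<F>"
    using compact unfolding compact_space_alt by (metis (no_types, lifting) imageE topspace_carrier)
  then obtain F where F: "finite F" "F \<subseteq> carrier K" "carrier K \<subseteq> \<Union> (O' ` F)"
    by (metis finite_subset_image)
  moreover have "F \<noteq> {}" using F(3) one_closed by auto
  ultimately show ?thesis using that by (auto simp: O'_def subset_iff)
qed

lemma regular: "regular_space S"
  unfolding regular_space_def
proof (intro allI impI, elim conjE)
  fix C a assume C: "closedin S C" and "a \<in> topspace S - C"
  then have a: "a \<in> carrier K" "a \<notin> C" by auto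
  have CK: "C \<subseteq> carrier K" using closedin_subset[OF C] by simp
  have "openin S {x \<in> carrier K. a \<otimes> x \<in> carrier K - C}"
    using C a by (intro openin_preimage continuous_group) (auto simp: closedin_def)
  moreover have "\<one> \<in> {x \<in> carrier K. a \<otimes> x \<in> carrier K - C}" using a by simp
  ultimately obtain N where N: "openin S N" "\<one> \<in> N"
    "\<And>x y. x \<in> N \<Longrightarrow> y \<in> N \<Longrightarrow> x \<otimes> inv y \<in> {x \<in> carrier K. a \<otimes> x \<in> carrier K - C}"
    by (rule difference_neighbourhood) (rule that)
  define T where "T c = {x \<in> carrier K. inv c \<otimes> x \<in> N}" for c
  have T: "openin S (T c)" "c \<in> T c" if "c \<in> carrier K" for c
  proof -
    show "openin S (T c)"
      unfolding T_def using that by (intro openin_preimage[OF N(1)] continuous_mult continuous_inv) auto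
    show "c \<in> T c" unfolding T_def using that N by simp
  qed
  have "disjnt (T a) (\<Union> (T ` C))"
  proof -
    have False if x: "x \<in> T a" "x \<in> T c" and c: "c \<in> C" for x c
    proof -
      have xc: "x \<in> carrier K" "c \<in> carrier K" using x c CK by (auto simp: T_def)
      have "a \<otimes> ((inv a \<otimes> x) \<otimes> inv (inv c \<otimes> x)) = c"
        using xc a by (simp add: inv_mult_group m_assoc) (simp flip: m_assoc)
      then show False using N(3)[of "inv a \<otimes> x" "inv c \<otimes> x"] x c by (auto simp: T_def)
    qed
    then show ?thesis by (auto simp: disjnt_iff)
  qed
  moreover have "openin S (\<Union> (T ` C))" "C \<subseteq> \<Union> (T ` C)" using T CK by auto
  ultimately show "\<exists>U V. openin S U \<and> openin S V \<and> a \<in> U \<and> C \<subseteq> V \<and> disjnt U V"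
    using T[OF a(1)] by metis
qed

text \<open>
  Let the bump be supported in \<open>V\<close> with \<open>V\<inverse>V \<subseteq> U\<close>. If it were nonzero at both \<open>y\<close> and \<open>yz\<close>,
  then \<open>z = y\<inverse>(yz)\<close> would lie in \<open>U\<close>.
\<close>

lemma symmetric_bump:
  assumes U: "openin S U" "\<one> \<in> U" and z: "z \<in> carrier K" "z \<notin> U"
  obtains \<phi> :: "'k \<Rightarrow> real" where "continuous_map S euclideanreal \<phi>"
    "\<And>x. x \<in> carrier K \<Longrightarrow> \<phi> (inv x) = \<phi> x" "\<phi> \<one> \<noteq> 0"
    "\<And>y. y \<in> carrier K \<Longrightarrow> \<phi> y * \<phi> (y \<otimes> z) = 0"
proof -
  obtain V where V: "openin S V" "\<one> \<in> V" "\<And>x y. x \<in> V \<Longrightarrow> y \<in> V \<Longrightarrow> inv x \<otimes> y \<in> U"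
    by (rule difference_neighbourhood[OF U]) (rule that)
  have "completely_regular_space S"
    using regular compact compact_imp_locally_compact_space
      locally_compact_regular_imp_completely_regular_space by blast
  then have "\<exists>f. continuous_map S euclideanreal f \<and> f \<one> = 0 \<and> f ` (topspace S - V) \<subseteq> {1 :: real}"
    using V(1,2) unfolding completely_regular_space_alt' by blast
  then obtain f where fc: "continuous_map S euclideanreal f" and f: "f \<one> = (0::real)"
      "f ` (carrier K - V) \<subseteq> {1}"
    by auto
  define \<phi> where "\<phi> x = (1 - f x) * (1 - f (inv x))" for x
  have out: "\<phi> x = 0" if "x \<in> carrier K" "x \<notin> V" for x
    using f(2) that by (auto simp: \<phi>_def)
  show ?thesis
  proof (rule that)
    show "continuous_map S euclideanreal \<phi>"
      unfolding \<phi>_def using fc continuous_at[OF fc continuous_inv[OF continuous_map_id, unfolded id_def]]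
      by (intro continuous_map_real_mult continuous_map_diff) (auto simp: id_def)
    show "\<phi> (inv x) = \<phi> x" if "x \<in> carrier K" for x using that by (simp add: \<phi>_def mult.commute)
    show "\<phi> \<one> \<noteq> 0" by (simp add: \<phi>_def f)
    show "\<phi> y * \<phi> (y \<otimes> z) = 0" if y: "y \<in> carrier K" for y
    proof (rule ccontr)
      assume "\<phi> y * \<phi> (y \<otimes> z) \<noteq> 0"
      then have "y \<in> V" "y \<otimes> z \<in> V" using out y z by auto
      then have "inv y \<otimes> (y \<otimes> z) \<in> U" by (rule V(3))
      then show False using y z by (simp flip: m_assoc)
    qed
  qed
qed

lemma bounded_continuous:
  assumes f: "continuous_map S euclideanreal f"
  obtains B where "B > 0" "\<And>x. x \<in> carrier K \<Longrightarrow> \<bar>f x\<bar> \<le> B"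
proof -
  have "compactin euclideanreal (f ` topspace S)"
    using image_compactin[OF _ f] compact by (simp add: compact_space_def)
  then have "bounded (f ` carrier K)" by (simp add: compact_imp_bounded)
  then show ?thesis using that by (auto simp: bounded_pos)
qed

end


section \<open>The invariant mean\<close>

lemma sum_list_product:
  "(\<Sum>p\<leftarrow>List.product M L. g (fst p) (snd p)) = (\<Sum>m\<leftarrow>M. \<Sum>l\<leftarrow>L. g m l :: real)"
  by (induction M) (simp_all add: o_def)

lemma sum_list_swap: "(\<Sum>m\<leftarrow>M. \<Sum>l\<leftarrow>L. g m l :: real) = (\<Sum>l\<leftarrow>L. \<Sum>m\<leftarrow>M. g m l)"
  by (induction M) (simp_all add: sum_list_addf)

lemma sum_list_le_one_small:
  fixes g :: "'b \<Rightarrow> real" and M d :: real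
  assumes "\<And>l. l \<in> set L \<Longrightarrow> g l \<le> M" "l0 \<in> set L" "g l0 \<le> M - d"
  shows "(\<Sum>l\<leftarrow>L. g l) \<le> length L * M - d"
  using assms
proof (induction L)
  case (Cons a L)
  have 1: "(\<Sum>l\<leftarrow>L. g l) \<le> length L * M"
    using sum_list_mono[of L g "\<lambda>_. M"] Cons.prems by (simp add: sum_list_const_mult sum_list_triv)
  show ?case
  proof (cases "l0 = a")
    case True
    then show ?thesis using 1 Cons.prems by (simp add: algebra_simps)
  next
    case False
    then have "(\<Sum>l\<leftarrow>L. g l) \<le> length L * M - d" using Cons by auto
    then show ?thesis using Cons.prems(1)[of a] by (simp add: algebra_simps)
  qed
qed simp

lemma average_ge:
  fixes g :: "'b \<Rightarrow> real"
  assumes "L \<noteq> []" "\<And>l. l \<in> set L \<Longrightarrow> a \<le> g l"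
  shows "a \<le> (\<Sum>l\<leftarrow>L. g l) / length L"
proof -
  have "length L * a \<le> (\<Sum>l\<leftarrow>L. g l)"
    using sum_list_mono[of L "\<lambda>_. a" g] assms by (simp add: sum_list_triv)
  then show ?thesis using assms(1) by (simp add: field_simps)
qed

lemma average_le:
  fixes g :: "'b \<Rightarrow> real"
  assumes "L \<noteq> []" "\<And>l. l \<in> set L \<Longrightarrow> g l \<le> b"
  shows "(\<Sum>l\<leftarrow>L. g l) / length L \<le> b"
proof -
  have "(\<Sum>l\<leftarrow>L. g l) \<le> length L * b"
    using sum_list_mono[of L g "\<lambda>_. b"] assms by (simp add: sum_list_triv)
  then show ?thesis using assms(1) by (simp add: field_simps)
qed

lemma average_near:
  fixes g :: "'b \<Rightarrow> real"
  assumes "L \<noteq> []" "\<And>l. l \<in> set L \<Longrightarrow> \<bar>g l - c\<bar> \<le> \<epsilon>"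
  shows "\<bar>(\<Sum>l\<leftarrow>L. g l) / length L - c\<bar> \<le> \<epsilon>"
proof -
  have *: "c - \<epsilon> \<le> g l \<and> g l \<le> c + \<epsilon>" if "l \<in> set L" for l
    using assms(2)[OF that] by linarith
  show ?thesis
    using average_ge[OF assms(1), of "c - \<epsilon>" g] average_le[OF assms(1), of g "c + \<epsilon>"] *
    by (force simp: abs_le_iff)
qed

lemma real_eqI:
  assumes "\<And>\<epsilon>. \<epsilon> > 0 \<Longrightarrow> \<bar>a - b\<bar> \<le> B * \<epsilon>" "B \<ge> 0"
  shows "a = (b :: real)"
proof (rule ccontr)
  assume "a \<noteq> b"
  then have "\<bar>a - b\<bar> \<le> B * (\<bar>a - b\<bar> / (2 * (B + 1)))" using assms(2) by (intro assms(1)) simp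
  also have "\<dots> < \<bar>a - b\<bar>" using \<open>a \<noteq> b\<close> assms(2) by (simp add: field_simps) (simp add: add_nonneg_pos)
  finally show False by simp
qed

context compact_group
begin

definition translates :: "'k list \<Rightarrow> bool" where
  "translates L \<longleftrightarrow> L \<noteq> [] \<and> set L \<subseteq> carrier K"

definition ravg :: "'k list \<Rightarrow> ('k \<Rightarrow> real) \<Rightarrow> 'k \<Rightarrow> real" where
  "ravg L f x = (\<Sum>l\<leftarrow>L. f (x \<otimes> l)) / length L"

definition lavg :: "'k list \<Rightarrow> ('k \<Rightarrow> real) \<Rightarrow> 'k \<Rightarrow> real" where
  "lavg L f x = (\<Sum>l\<leftarrow>L. f (l \<otimes> x)) / length L"

abbreviation cont :: "('k \<Rightarrow> real) \<Rightarrow> bool" where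
  "cont f \<equiv> continuous_map S euclideanreal f"

lemma ravg_ravg:
  assumes "translates L" "translates M"
  obtains N where "translates N" "\<And>f x. x \<in> carrier K \<Longrightarrow> ravg M (ravg L f) x = ravg N f x"
proof -
  let ?N = "map (\<lambda>p. fst p \<otimes> snd p) (List.product M L)"
  have "length ?N > 0" using assms by (simp add: translates_def)
  then have N: "translates ?N"
    unfolding translates_def using assms by (fastforce simp: translates_def)
  have "ravg M (ravg L f) x = ravg ?N f x" if x: "x \<in> carrier K" for f x
  proof -
  have "(\<Sum>m\<leftarrow>M. \<Sum>l\<leftarrow>L. f (x \<otimes> m \<otimes> l)) = (\<Sum>m\<leftarrow>M. \<Sum>l\<leftarrow>L. f (x \<otimes> (m \<otimes> l)))"
    using assms x by (intro arg_cong[of _ _ sum_list] map_cong refl) (auto simp: translates_def m_assoc subset_iff)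
  then show ?thesis
    using sum_list_product[of "\<lambda>a b. f (x \<otimes> (a \<otimes> b))" M L]
    by (simp add: ravg_def o_def divide_inverse sum_list_mult_const)
  qed
  with N show ?thesis by (rule that)
qed

lemma lavg_ravg:
  assumes "translates L" "translates M" "x \<in> carrier K"
  shows "lavg M (ravg L f) x = ravg L (lavg M f) x"
proof -
  have "(\<Sum>m\<leftarrow>M. \<Sum>l\<leftarrow>L. f (m \<otimes> x \<otimes> l)) = (\<Sum>l\<leftarrow>L. \<Sum>m\<leftarrow>M. f (m \<otimes> x \<otimes> l))"
    by (rule sum_list_swap)
  also have "\<dots> = (\<Sum>l\<leftarrow>L. \<Sum>m\<leftarrow>M. f (m \<otimes> (x \<otimes> l)))"
    using assms by (intro arg_cong[of _ _ sum_list] map_cong refl) (auto simp: translates_def m_assoc subset_iff)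
  finally show ?thesis
    by (simp add: lavg_def ravg_def divide_inverse sum_list_mult_const)
qed

lemma ravg_near:
  assumes "translates L" "x \<in> carrier K" "\<And>y. y \<in> carrier K \<Longrightarrow> \<bar>f y - c\<bar> \<le> \<epsilon>"
  shows "\<bar>ravg L f x - c\<bar> \<le> \<epsilon>"
  unfolding ravg_def using assms by (intro average_near) (auto simp: translates_def)

lemma lavg_near:
  assumes "translates L" "x \<in> carrier K" "\<And>y. y \<in> carrier K \<Longrightarrow> \<bar>f y - c\<bar> \<le> \<epsilon>"
  shows "\<bar>lavg L f x - c\<bar> \<le> \<epsilon>"
  unfolding lavg_def using assms by (intro average_near) (auto simp: translates_def)

lemma cont_ravg:
  assumes "cont f" "translates L"
  shows "cont (ravg L f)"
proof -
  have "cont (\<lambda>x. \<Sum>l\<leftarrow>L. f (x \<otimes> l))"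
    using assms(2)
  proof (induction L)
    case (Cons a L)
    then have "cont (\<lambda>x. f (x \<otimes> a))"
      by (intro continuous_at[OF assms(1)] continuous_group) (auto simp: translates_def)
    moreover have "cont (\<lambda>x. \<Sum>l\<leftarrow>L. f (x \<otimes> l))"
      using Cons by (cases L) (auto simp: translates_def)
    ultimately show ?case by (simp add: continuous_map_add)
  qed simp
  then have "cont (\<lambda>x. (1 / length L) * (\<Sum>l\<leftarrow>L. f (x \<otimes> l)))"
    by (intro continuous_map_real_mult) auto
  then show ?thesis by (simp add: ravg_def[abs_def] )
qed

text \<open>
  Von Neumann's construction of the mean of an almost periodic function. All right averages of \<open>f\<close>
  share the modulus of continuity of \<open>f\<close>, so if one of them is small at a point, it is small on a
  translate of a fixed neighbourhood \<open>V\<close>. Averaging once more over the finitely many translates of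
  \<open>V\<close> that cover \<open>K\<close> brings a small value into every average and lowers the upper bound by an
  amount that depends only on \<open>f\<close> and \<open>\<delta>\<close>. If the average is small nowhere, its lower bound can be
  raised instead. After finitely many rounds the oscillation is at most \<open>\<delta>\<close>.
\<close>

lemma small_oscillation_right:
  assumes f: "cont f" and d: "\<delta> > 0"
  obtains L lo where "translates L"
    "\<And>x. x \<in> carrier K \<Longrightarrow> lo \<le> ravg L f x \<and> ravg L f x \<le> lo + \<delta>"
proof -
  define P where "P t \<longleftrightarrow> (\<exists>L lo. translates L \<and>
      (\<forall>x\<in>carrier K. lo \<le> ravg L f x \<and> ravg L f x \<le> lo + t))" for t
  have P_mono: "P t" if "P s" "s \<le> t" for s t
    using that unfolding P_def by (meson add_left_mono order_trans)
  obtain V where V: "openin S V" "\<one> \<in> V"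
    "\<And>g u v. g \<in> V \<Longrightarrow> u \<in> carrier K \<Longrightarrow> v \<in> carrier K \<Longrightarrow> \<bar>f (u \<otimes> g \<otimes> v) - f (u \<otimes> v)\<bar> < \<delta> / 4"
    by (rule uniformly_continuous[OF f, of "\<delta> / 4"]) (use d that in auto)
  have VK: "V \<subseteq> carrier K" using openin_subset[OF V(1)] by simp
  obtain F where F: "finite F" "F \<subseteq> carrier K" "F \<noteq> {}"
    "\<And>x. x \<in> carrier K \<Longrightarrow> \<exists>k\<in>F. x \<otimes> inv k \<in> V"
    by (rule finite_translates_cover[OF V(1,2)]) (rule that)
  obtain ks where ks: "set ks = F" using finite_list[OF F(1)] by metis
  define n where "n = length ks"
  have n: "n > 0" using F(3) ks by (auto simp: n_def)
  define c where "c = \<delta> / (4 * n)"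
  have c: "0 < c" "c \<le> \<delta> / 4" using n d by (auto simp: c_def field_simps)
  have step: "P (t - c)" if t: "P t" "\<delta> \<le> t" for t
  proof -
    obtain L lo where L: "translates L"
      "\<And>x. x \<in> carrier K \<Longrightarrow> lo \<le> ravg L f x \<and> ravg L f x \<le> lo + t"
      using t(1) unfolding P_def by blast
    show ?thesis
    proof (cases "\<exists>x0\<in>carrier K. ravg L f x0 \<le> lo + t / 2")
      case False
      then have "P (t / 2)" unfolding P_def using L
        by (intro exI[of _ L] exI[of _ "lo + t / 2"]) force
      then show ?thesis by (rule P_mono) (use c t in linarith)
    next
      case True
      then obtain x0 where x0: "x0 \<in> carrier K" "ravg L f x0 \<le> lo + t / 2" by blast
      have near: "ravg L f (v \<otimes> x0) \<le> lo + t - \<delta> / 4" if v: "v \<in> V" for v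
      proof -
        have vK: "v \<in> carrier K" using v VK by auto
        have "f (v \<otimes> x0 \<otimes> l) \<le> f (x0 \<otimes> l) + \<delta> / 4" if "l \<in> set L" for l
        proof -
          have l: "l \<in> carrier K" using that L by (auto simp: translates_def)
          then have "\<bar>f (\<one> \<otimes> v \<otimes> (x0 \<otimes> l)) - f (\<one> \<otimes> (x0 \<otimes> l))\<bar> < \<delta> / 4"
            using V(3)[OF v, of \<one> "x0 \<otimes> l"] x0 by simp
          then have "\<bar>f (v \<otimes> x0 \<otimes> l) - f (x0 \<otimes> l)\<bar> < \<delta> / 4" using l x0 vK by (simp add: m_assoc)
          then show ?thesis by linarith
        qed
        then have "(\<Sum>l\<leftarrow>L. f (v \<otimes> x0 \<otimes> l)) \<le> (\<Sum>l\<leftarrow>L. f (x0 \<otimes> l) + \<delta> / 4)"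
          by (rule sum_list_mono)
        also have "\<dots> = (\<Sum>l\<leftarrow>L. f (x0 \<otimes> l)) + length L * (\<delta> / 4)"
          by (simp add: sum_list_addf sum_list_triv)
        finally have "ravg L f (v \<otimes> x0) \<le> ravg L f x0 + \<delta> / 4"
          using L(1) by (simp add: ravg_def translates_def field_simps)
        then show ?thesis using x0(2) t(2) by linarith
      qed
      \<comment> \<open>for every \<open>x\<close> some \<open>x k\<inverse>\<close> lies in \<open>V\<close>, so the translate by \<open>k\<inverse> x0\<close> lands in \<open>V x0\<close>, where the average is small\<close>
      define M where "M = map (\<lambda>k. inv k \<otimes> x0) ks"
      have M: "translates M" using F ks x0 by (auto simp: M_def translates_def)
      have lenM: "length M = n" by (simp add: M_def n_def)
      have up: "ravg M (ravg L f) x \<le> lo + (t - c)" if x: "x \<in> carrier K" for x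
      proof -
        obtain k where k: "k \<in> F" "x \<otimes> inv k \<in> V" using F(4)[OF x] by blast
        have kK: "k \<in> carrier K" using k F by auto
        have "(\<Sum>l\<leftarrow>M. ravg L f (x \<otimes> l)) \<le> length M * (lo + t) - \<delta> / 4"
        proof (rule sum_list_le_one_small)
          show "inv k \<otimes> x0 \<in> set M" using k ks by (auto simp: M_def)
          show "ravg L f (x \<otimes> (inv k \<otimes> x0)) \<le> lo + t - \<delta> / 4"
            using near[OF k(2)] x x0 kK by (simp add: m_assoc)
          show "ravg L f (x \<otimes> l) \<le> lo + t" if "l \<in> set M" for l
            using that M x L(2)[of "x \<otimes> l"] by (auto simp: translates_def)
        qed
        then show ?thesis using n unfolding ravg_def[of M] lenM c_def by (simp add: field_simps)
      qed
      have low: "lo \<le> ravg M (ravg L f) x" if x: "x \<in> carrier K" for x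
        unfolding ravg_def[of M] using M L(2) x
        by (intro average_ge) (auto simp: translates_def subset_iff)
      obtain N where "translates N" "\<And>f x. x \<in> carrier K \<Longrightarrow> ravg M (ravg L f) x = ravg N f x"
        by (rule ravg_ravg[OF L(1) M]) (rule that)
      then show ?thesis unfolding P_def using up low by metis
    qed
  qed
  obtain B where B: "B > 0" "\<And>x. x \<in> carrier K \<Longrightarrow> \<bar>f x\<bar> \<le> B"
    by (rule bounded_continuous[OF f]) (rule that)
  have "- B \<le> f x \<and> f x \<le> -B + 2 * B" if "x \<in> carrier K" for x using B(2)[OF that] by linarith
  then have P0: "P (2 * B)"
    unfolding P_def by (intro exI[of _ "[\<one>]"] exI[of _ "-B"]) (auto simp: translates_def ravg_def)
  have "P (max \<delta> (2 * B - k * c))" for k :: nat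
  proof (induction k)
    case 0
    show ?case using P_mono[OF P0] by simp
  next
    case (Suc k)
    show ?case
    proof (cases "2 * B - k * c \<le> \<delta>")
      case True
      then have "max \<delta> (2 * B - k * c) = \<delta>" by simp
      then show ?thesis using P_mono[of \<delta>] Suc by simp
    next
      case False
      then have "P (2 * B - k * c - c)" using step Suc by (simp add: max_def)
      then show ?thesis by (rule P_mono) (simp add: algebra_simps)
    qed
  qed
  moreover obtain k :: nat where "k > (2 * B) / c" using reals_Archimedean2 by blast
  moreover from this have "max \<delta> (2 * B - k * c) \<le> \<delta>" using c by (simp add: field_simps)
  ultimately have "P \<delta>" using P_mono by blast
  then show ?thesis using that unfolding P_def by blast
qed

lemma small_oscillation_left:
  assumes f: "cont f" and d: "\<delta> > 0"
  obtains L lo where "translates L"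
    "\<And>x. x \<in> carrier K \<Longrightarrow> lo \<le> lavg L f x \<and> lavg L f x \<le> lo + \<delta>"
proof -
  have "cont (\<lambda>x. f (inv x))"
    using continuous_at[OF f continuous_inv[OF continuous_map_id, unfolded id_def]] by simp
  then obtain L lo where L: "translates L"
    "\<And>x. x \<in> carrier K \<Longrightarrow> lo \<le> ravg L (\<lambda>x. f (inv x)) x \<and> ravg L (\<lambda>x. f (inv x)) x \<le> lo + \<delta>"
    by (rule small_oscillation_right[OF _ d]) (rule that)
  let ?M = "map (\<lambda>l. inv l) L"
  show ?thesis
  proof (rule that)
    show "translates ?M" using L(1) by (auto simp: translates_def)
    fix x assume x: "x \<in> carrier K"
    have "(\<Sum>l\<leftarrow>L. f (inv (inv x \<otimes> l))) = (\<Sum>l\<leftarrow>L. f (inv l \<otimes> x))"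
      using x L(1) by (intro arg_cong[of _ _ sum_list] map_cong refl) (auto simp: translates_def inv_mult_group subset_iff)
    then have "lavg ?M f x = ravg L (\<lambda>x. f (inv x)) (inv x)"
      by (simp add: lavg_def ravg_def o_def)
    then show "lo \<le> lavg ?M f x \<and> lavg ?M f x \<le> lo + \<delta>" using L(2)[of "inv x"] x by simp
  qed
qed

text \<open>
  This is the normalized Haar integral: the constant that the right averages, and also the left
  averages, of a continuous function approximate uniformly.
\<close>

definition mean :: "('k \<Rightarrow> real) \<Rightarrow> real" where
  "mean f = Sup {lo. \<exists>L. translates L \<and> (\<forall>x\<in>carrier K. lo \<le> ravg L f x)}"

lemma mean_cong:
  assumes "\<And>x. x \<in> carrier K \<Longrightarrow> f x = g x"
  shows "mean f = mean g"
proof -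
  have "ravg L f x = ravg L g x" if "translates L" "x \<in> carrier K" for L x
    unfolding ravg_def using that assms
    by (intro arg_cong2[of _ _ _ _ "(/)"] arg_cong[of _ _ sum_list] map_cong refl) (auto simp: translates_def)
  then show ?thesis unfolding mean_def by (metis (no_types, lifting))
qed

text \<open>
  A lower bound of a right average never exceeds an upper bound of a left average, since both bound
  the same double average. As both kinds of averages can be made almost constant, the constants
  agree.
\<close>

lemma mean_approx:
  assumes f: "cont f" and e: "\<epsilon> > 0"
  shows "\<exists>L. translates L \<and> (\<forall>x\<in>carrier K. \<bar>ravg L f x - mean f\<bar> \<le> \<epsilon>)"
    and "\<exists>L. translates L \<and> (\<forall>x\<in>carrier K. \<bar>lavg L f x - mean f\<bar> \<le> \<epsilon>)"
proof -
  have between: "lo \<le> up" if "translates L" "translates M"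
    "\<And>x. x \<in> carrier K \<Longrightarrow> lo \<le> ravg L f x" "\<And>x. x \<in> carrier K \<Longrightarrow> lavg M f x \<le> up" for L M lo up
  proof -
    have "lo \<le> lavg M (ravg L f) \<one>"
      unfolding lavg_def[of M] using that by (intro average_ge) (auto simp: translates_def subset_iff)
    also have "\<dots> = ravg L (lavg M f) \<one>" using lavg_ravg that by simp
    also have "\<dots> \<le> up"
      unfolding ravg_def[of L] using that by (intro average_le) (auto simp: translates_def subset_iff)
    finally show ?thesis .
  qed
  let ?A = "{lo. \<exists>L. translates L \<and> (\<forall>x\<in>carrier K. lo \<le> ravg L f x)}"
  obtain L lo where L: "translates L"
    "\<And>x. x \<in> carrier K \<Longrightarrow> lo \<le> ravg L f x \<and> ravg L f x \<le> lo + \<epsilon> / 2"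
    by (rule small_oscillation_right[OF f, of "\<epsilon> / 2"]) (use e that in auto)
  obtain M lo' where M: "translates M"
    "\<And>x. x \<in> carrier K \<Longrightarrow> lo' \<le> lavg M f x \<and> lavg M f x \<le> lo' + \<epsilon> / 2"
    by (rule small_oscillation_left[OF f, of "\<epsilon> / 2"]) (use e that in auto)
  have ub: "a \<le> lo' + \<epsilon> / 2" if "a \<in> ?A" for a
    using that between M by blast
  have loA: "lo \<in> ?A" using L by blast
  have "lo \<le> mean f"
    unfolding mean_def by (rule cSup_upper[OF loA]) (rule bdd_aboveI, rule ub)
  moreover have "mean f \<le> lo' + \<epsilon> / 2"
    unfolding mean_def by (rule cSup_least) (use loA ub in auto)
  moreover have "lo' \<le> lo + \<epsilon> / 2"
  proof -
    have "lo' \<le> lavg M (ravg L f) \<one>"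
      unfolding lavg_ravg[OF L(1) M(1) one_closed] ravg_def[of L] using L(1) M(2)
      by (intro average_ge) (auto simp: translates_def subset_iff)
    also have "\<dots> \<le> lo + \<epsilon> / 2"
      unfolding lavg_def[of M] using M(1) L(2)
      by (intro average_le) (auto simp: translates_def subset_iff)
    finally show ?thesis .
  qed
  ultimately have mid: "lo \<le> mean f" "mean f \<le> lo + \<epsilon>" "lo' - \<epsilon> / 2 \<le> mean f" "mean f \<le> lo' + \<epsilon> / 2"
    using ub[of lo] L by auto
  show "\<exists>L. translates L \<and> (\<forall>x\<in>carrier K. \<bar>ravg L f x - mean f\<bar> \<le> \<epsilon>)"
    using L mid by (intro exI[of _ L]) (force simp: abs_le_iff)
  show "\<exists>L. translates L \<and> (\<forall>x\<in>carrier K. \<bar>lavg L f x - mean f\<bar> \<le> \<epsilon>)"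
    using M mid by (intro exI[of _ M]) (force simp: abs_le_iff)
qed

lemma ravg_lavg_near:
  assumes "translates L" "\<And>x. x \<in> carrier K \<Longrightarrow> \<bar>ravg L f x - c\<bar> \<le> \<epsilon>"
    and "translates M" "\<And>x. x \<in> carrier K \<Longrightarrow> \<bar>lavg M f x - d\<bar> \<le> \<eta>"
  shows "\<bar>c - d\<bar> \<le> \<epsilon> + \<eta>"
proof -
  have "\<bar>lavg M (ravg L f) \<one> - c\<bar> \<le> \<epsilon>" using assms by (intro lavg_near) auto
  moreover have "\<bar>ravg L (lavg M f) \<one> - d\<bar> \<le> \<eta>" using assms by (intro ravg_near) auto
  ultimately show ?thesis using lavg_ravg[OF assms(1,3) one_closed, of f] by linarith
qed

lemma mean_unique_ravg:
  assumes f: "cont f" and L: "translates L" "\<And>x. x \<in> carrier K \<Longrightarrow> \<bar>ravg L f x - c\<bar> \<le> \<epsilon>"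
  shows "\<bar>mean f - c\<bar> \<le> \<epsilon>"
proof (rule field_le_epsilon)
  fix \<eta> :: real assume "\<eta> > 0"
  then obtain M where "translates M" "\<And>x. x \<in> carrier K \<Longrightarrow> \<bar>lavg M f x - mean f\<bar> \<le> \<eta>"
    using mean_approx(2)[OF f] by blast
  from ravg_lavg_near[OF L this] show "\<bar>mean f - c\<bar> \<le> \<epsilon> + \<eta>" by linarith
qed

lemma mean_unique_lavg:
  assumes f: "cont f" and L: "translates L" "\<And>x. x \<in> carrier K \<Longrightarrow> \<bar>lavg L f x - c\<bar> \<le> \<epsilon>"
  shows "\<bar>mean f - c\<bar> \<le> \<epsilon>"
proof (rule field_le_epsilon)
  fix \<eta> :: real assume "\<eta> > 0"
  then obtain M where "translates M" "\<And>x. x \<in> carrier K \<Longrightarrow> \<bar>ravg M f x - mean f\<bar> \<le> \<eta>"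
    using mean_approx(1)[OF f] by blast
  from ravg_lavg_near[OF this L] show "\<bar>mean f - c\<bar> \<le> \<epsilon> + \<eta>" by linarith
qed

lemma mean_near:
  assumes f: "cont f" and "\<And>x. x \<in> carrier K \<Longrightarrow> \<bar>f x - c\<bar> \<le> \<epsilon>"
  shows "\<bar>mean f - c\<bar> \<le> \<epsilon>"
  by (rule mean_unique_ravg[OF f, of "[\<one>]"]) (use assms(2) in \<open>auto simp: translates_def ravg_def\<close>)

text \<open>
  Left averages of \<open>f\<close> close to a constant stay close to it under right averaging, and the two
  averagings commute; uniqueness of the constant gives the claim. Invariance of the mean is the
  special case of a single translate, and additivity follows by averaging for one summand after the
  other.
\<close>

lemma mean_ravg:
  assumes f: "cont f" and L: "translates L"
  shows "mean (ravg L f) = mean f"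
proof (rule real_eqI[where B=1])
  fix \<epsilon> :: real assume "\<epsilon> > 0"
  then obtain M where M: "translates M" "\<And>x. x \<in> carrier K \<Longrightarrow> \<bar>lavg M f x - mean f\<bar> \<le> \<epsilon>"
    using mean_approx(2)[OF f] by blast
  have "\<bar>lavg M (ravg L f) x - mean f\<bar> \<le> \<epsilon>" if "x \<in> carrier K" for x
    unfolding lavg_ravg[OF L M(1) that] using L that M(2) by (rule ravg_near)
  then show "\<bar>mean (ravg L f) - mean f\<bar> \<le> 1 * \<epsilon>"
    using mean_unique_lavg[OF cont_ravg[OF f L] M(1)] by simp
qed simp

lemma mean_right_translate:
  assumes f: "cont f" and g: "g \<in> carrier K"
  shows "mean (\<lambda>x. f (x \<otimes> g)) = mean f"
  using mean_ravg[OF f, of "[g]"] g by (simp add: translates_def ravg_def[abs_def])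

lemma mean_add:
  assumes f: "cont f" and g: "cont g"
  shows "mean (\<lambda>x. f x + g x) = mean f + mean g"
proof (rule real_eqI[where B=2])
  fix \<epsilon> :: real assume e: "\<epsilon> > 0"
  obtain L where L: "translates L" "\<And>x. x \<in> carrier K \<Longrightarrow> \<bar>ravg L f x - mean f\<bar> \<le> \<epsilon>"
    using mean_approx(1)[OF f e] by blast
  have Lg: "cont (ravg L g)" using g L(1) by (rule cont_ravg)
  obtain M where M: "translates M" "\<And>x. x \<in> carrier K \<Longrightarrow> \<bar>ravg M (ravg L g) x - mean (ravg L g)\<bar> \<le> \<epsilon>"
    using mean_approx(1)[OF Lg e] by blast
  have fg: "cont (\<lambda>x. f x + g x)" using f g by (rule continuous_map_add)
  have sum: "ravg N (\<lambda>x. a x + b x) x = ravg N a x + ravg N b x" for N a b x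
    by (simp add: ravg_def sum_list_addf add_divide_distrib)
  have "\<bar>ravg M (ravg L (\<lambda>x. f x + g x)) x - (mean f + mean g)\<bar> \<le> 2 * \<epsilon>" if x: "x \<in> carrier K" for x
  proof -
    have "\<bar>ravg M (ravg L f) x - mean f\<bar> \<le> \<epsilon>" using M(1) x L(2) by (rule ravg_near)
    moreover have "\<bar>ravg M (ravg L g) x - mean g\<bar> \<le> \<epsilon>" using M(2)[OF x] mean_ravg[OF g L(1)] by simp
    moreover have "ravg M (ravg L (\<lambda>x. f x + g x)) x = ravg M (ravg L f) x + ravg M (ravg L g) x"
      unfolding sum[abs_def] by (rule refl)
    ultimately show ?thesis by linarith
  qed
  from mean_unique_ravg[OF cont_ravg[OF fg L(1)] M(1) this]
  show "\<bar>mean (\<lambda>x. f x + g x) - (mean f + mean g)\<bar> \<le> 2 * \<epsilon>"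
    unfolding mean_ravg[OF fg L(1)] by simp
qed simp

lemma mean_scale:
  assumes f: "cont f"
  shows "mean (\<lambda>x. c * f x) = c * mean f"
proof (rule real_eqI[where B="\<bar>c\<bar>"])
  fix \<epsilon> :: real assume e: "\<epsilon> > 0"
  obtain L where L: "translates L" "\<And>x. x \<in> carrier K \<Longrightarrow> \<bar>ravg L f x - mean f\<bar> \<le> \<epsilon>"
    using mean_approx(1)[OF f e] by blast
  have "\<bar>ravg L (\<lambda>x. c * f x) x - c * mean f\<bar> \<le> \<bar>c\<bar> * \<epsilon>" if "x \<in> carrier K" for x
  proof -
    have "ravg L (\<lambda>x. c * f x) x - c * mean f = c * (ravg L f x - mean f)"
      by (simp add: ravg_def sum_list_const_mult algebra_simps)
    then show ?thesis using L(2)[OF that] by (simp add: abs_mult mult_left_mono)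
  qed
  moreover have "cont (\<lambda>x. c * f x)" using f by (intro continuous_map_real_mult) auto
  ultimately show "\<bar>mean (\<lambda>x. c * f x) - c * mean f\<bar> \<le> \<bar>c\<bar> * \<epsilon>"
    using mean_unique_ravg[OF _ L(1)] by blast
qed simp

lemma mean_diff:
  assumes f: "cont f" and g: "cont g"
  shows "mean (\<lambda>x. f x - g x) = mean f - mean g"
proof -
  have "cont (\<lambda>x. -1 * g x)" using g by (intro continuous_map_real_mult) auto
  then show ?thesis using mean_add[OF f, of "\<lambda>x. -1 * g x"] mean_scale[OF g, of "-1"] by simp
qed

lemma mean_ge:
  assumes f: "cont f" and a: "\<And>x. x \<in> carrier K \<Longrightarrow> a \<le> f x"
  shows "a \<le> mean f"
proof (rule field_le_epsilon)
  fix \<epsilon> :: real assume e: "\<epsilon> > 0"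
  obtain L where L: "translates L" "\<And>x. x \<in> carrier K \<Longrightarrow> \<bar>ravg L f x - mean f\<bar> \<le> \<epsilon>"
    using mean_approx(1)[OF f e] by blast
  have "a \<le> ravg L f \<one>"
    unfolding ravg_def using L(1) a by (intro average_ge) (auto simp: translates_def subset_iff)
  then show "a \<le> mean f + \<epsilon>" using L(2)[OF one_closed] by linarith
qed

lemma mean_mono:
  assumes "cont f" "cont g" "\<And>x. x \<in> carrier K \<Longrightarrow> f x \<le> g x"
  shows "mean f \<le> mean g"
  using mean_ge[of "\<lambda>x. g x - f x" 0] mean_diff[of g f] assms by (simp add: continuous_map_diff)

lemma mean_positive:
  assumes f: "cont f" and nonneg: "\<And>x. x \<in> carrier K \<Longrightarrow> 0 \<le> f x"
    and a: "a \<in> carrier K" "f a > 0"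
  shows "mean f > 0"
proof -
  define V where "V = {x \<in> topspace S. f (x \<otimes> a) \<in> {f a / 2<..}}"
  have "cont (\<lambda>x. f (x \<otimes> a))"
    using a by (intro continuous_at[OF f] continuous_group) (auto simp: id_def[symmetric])
  then have "openin S V" unfolding V_def by (rule openin_continuous_map_preimage) simp
  moreover have "\<one> \<in> V" using a by (simp add: V_def)
  ultimately obtain F where F: "finite F" "F \<subseteq> carrier K" "F \<noteq> {}"
    "\<And>x. x \<in> carrier K \<Longrightarrow> \<exists>k\<in>F. x \<otimes> inv k \<in> V"
    by (rule finite_translates_cover) (rule that)
  obtain ks where ks: "set ks = F" using finite_list[OF F(1)] by metis
  define L where "L = map (\<lambda>k. inv k \<otimes> a) ks"
  have L: "translates L" using F ks a by (auto simp: L_def translates_def)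
  have n: "length L > 0" using L by (simp add: translates_def)
  have "f a / 2 / length L \<le> ravg L f x" if x: "x \<in> carrier K" for x
  proof -
    obtain k where k: "k \<in> F" "x \<otimes> inv k \<in> V" using F(4)[OF x] by blast
    have "(\<Sum>l\<leftarrow>L. - f (x \<otimes> l)) \<le> length L * (0 :: real) - f a / 2"
    proof (rule sum_list_le_one_small)
      show "inv k \<otimes> a \<in> set L" using k ks by (auto simp: L_def)
      show "- f (x \<otimes> (inv k \<otimes> a)) \<le> 0 - f a / 2"
        using k x a F(2) by (auto simp: V_def m_assoc subset_iff)
      show "- f (x \<otimes> l) \<le> 0" if "l \<in> set L" for l
        using that x L nonneg by (auto simp: translates_def)
    qed
    then have "f a / 2 \<le> (\<Sum>l\<leftarrow>L. f (x \<otimes> l))"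
      by (simp add: uminus_sum_list_map[unfolded o_def, symmetric])
    then show ?thesis using n unfolding ravg_def by (simp add: field_simps)
  qed
  then have "f a / 2 / length L \<le> mean (ravg L f)"
    by (rule mean_ge[OF cont_ravg[OF f L]])
  moreover have "f a / 2 / length L > 0" using a n by simp
  ultimately show ?thesis unfolding mean_ravg[OF f L] by linarith
qed

lemma mean_sum_list:
  assumes "\<And>l. l \<in> set L \<Longrightarrow> cont (f l)"
  shows "cont (\<lambda>x. \<Sum>l\<leftarrow>L. f l x)" "mean (\<lambda>x. \<Sum>l\<leftarrow>L. f l x) = (\<Sum>l\<leftarrow>L. mean (f l))"
proof -
  have "cont (\<lambda>x. \<Sum>l\<leftarrow>L. f l x) \<and> mean (\<lambda>x. \<Sum>l\<leftarrow>L. f l x) = (\<Sum>l\<leftarrow>L. mean (f l))"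
    using assms
  proof (induction L)
    case Nil
    show ?case using mean_near[of "\<lambda>x. 0" 0 0] by simp
  next
    case (Cons a L)
    then have "cont (f a)" "cont (\<lambda>x. \<Sum>l\<leftarrow>L. f l x)" by auto
    then show ?case using Cons mean_add[of "f a" "\<lambda>x. \<Sum>l\<leftarrow>L. f l x"]
      by (simp add: continuous_map_add)
  qed
  then show "cont (\<lambda>x. \<Sum>l\<leftarrow>L. f l x)" "mean (\<lambda>x. \<Sum>l\<leftarrow>L. f l x) = (\<Sum>l\<leftarrow>L. mean (f l))" by auto
qed

end


section \<open>The interchange of means\<close>

lemma mult_product: "p \<otimes>\<^bsub>K \<times>\<times> H\<^esub> q = (fst p \<otimes>\<^bsub>K\<^esub> fst q, snd p \<otimes>\<^bsub>H\<^esub> snd q)"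
  by (simp add: DirProd_def case_prod_unfold)

lemma compact_group_product:
  assumes "compact_group K S" "compact_group H T"
  shows "compact_group (K \<times>\<times> H) (prod_topology S T)"
proof -
  interpret K: compact_group K S by fact
  interpret H: compact_group H T by fact
  interpret KH: group "K \<times>\<times> H" by (intro DirProd_group) (rule K.is_group, rule H.is_group)
  have "continuous_map (prod_topology (prod_topology S T) (prod_topology S T)) (prod_topology S T)
      (\<lambda>p. (fst (fst p) \<otimes>\<^bsub>K\<^esub> fst (snd p), snd (fst p) \<otimes>\<^bsub>H\<^esub> snd (snd p)))"
    by (intro continuous_map_pairedI K.continuous_mult H.continuous_mult
        continuous_map_compose[OF continuous_map_fst continuous_map_fst, unfolded o_def]
        continuous_map_compose[OF continuous_map_fst continuous_map_snd, unfolded o_def]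
        continuous_map_compose[OF continuous_map_snd continuous_map_fst, unfolded o_def]
        continuous_map_compose[OF continuous_map_snd continuous_map_snd, unfolded o_def])
  moreover have "continuous_map (prod_topology S T) (prod_topology S T)
      (\<lambda>p. inv\<^bsub>K \<times>\<times> H\<^esub> p)"
  proof (rule continuous_map_eq)
    show "continuous_map (prod_topology S T) (prod_topology S T) (\<lambda>p. (inv\<^bsub>K\<^esub> fst p, inv\<^bsub>H\<^esub> snd p))"
      by (intro continuous_map_pairedI K.continuous_inv H.continuous_inv continuous_map_fst continuous_map_snd)
  qed (auto simp: inv_DirProd[OF K.is_group H.is_group])
  ultimately have "group_topology (K \<times>\<times> H) (prod_topology S T)"
    by (simp add: group_topology_def KH.is_group mult_product case_prod_unfold)
  then show ?thesis
    using K.compact H.compact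
    by unfold_locales (auto simp: compact_space_prod_topology)
qed

context compact_group
begin

abbreviation cont2 :: "('k \<times> 'k \<Rightarrow> real) \<Rightarrow> bool" where
  "cont2 F \<equiv> continuous_map (prod_topology S S) euclideanreal F"

lemma cont_section:
  assumes F: "cont2 F" and x: "x \<in> carrier K"
  shows "cont (\<lambda>y. F (x, y))" "cont (\<lambda>y. F (y, x))"
proof -
  have "continuous_map S (prod_topology S S) (\<lambda>y. (x, y))" "continuous_map S (prod_topology S S) (\<lambda>y. (y, x))"
    using x by (auto intro!: continuous_map_pairedI)
  then show "cont (\<lambda>y. F (x, y))" "cont (\<lambda>y. F (y, x))"
    using F by (auto dest: continuous_map_compose simp: o_def)
qed

lemma cont_mean:
  assumes F: "cont2 F"
  shows "cont (\<lambda>x. mean (\<lambda>y. F (x, y)))"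
proof (rule continuous_map_realI)
  fix x and \<epsilon> :: real assume x: "x \<in> topspace S" and e: "\<epsilon> > 0"
  obtain V where V: "openin S V" "x \<in> V"
    "\<And>x' y. x' \<in> V \<Longrightarrow> y \<in> topspace S \<Longrightarrow> \<bar>F (x', y) - F (x, y)\<bar> < \<epsilon> / 2"
    by (rule continuous_map_tube[OF F compact x, of "\<epsilon> / 2"]) (use e that in auto)
  have "\<bar>mean (\<lambda>y. F (x', y)) - mean (\<lambda>y. F (x, y))\<bar> < \<epsilon>" if x': "x' \<in> V" for x'
  proof -
    have c: "cont (\<lambda>y. F (x', y))" "cont (\<lambda>y. F (x, y))"
      using cont_section(1)[OF F] x' x openin_subset[OF V(1)] by auto
    have "\<bar>mean (\<lambda>y. F (x', y) - F (x, y)) - 0\<bar> \<le> \<epsilon> / 2"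
      by (rule mean_near) (use c V(3)[OF x'] in \<open>auto intro: continuous_map_diff simp: less_imp_le\<close>)
    then show ?thesis using mean_diff[OF c] e by simp
  qed
  with V(1,2) show "\<exists>V. openin S V \<and> x \<in> V \<and>
      (\<forall>x'\<in>V. \<bar>mean (\<lambda>y. F (x', y)) - mean (\<lambda>y. F (x, y))\<bar> < \<epsilon>)" by blast
qed

lemma cont2_swap: "cont2 F \<Longrightarrow> cont2 (\<lambda>p. F (snd p, fst p))"
  using continuous_map_compose[of "prod_topology S S" "prod_topology S S" "\<lambda>p. (snd p, fst p)" euclideanreal F]
  by (simp add: o_def continuous_map_pairedI continuous_map_fst continuous_map_snd)

text \<open>
  Averaging over pairs does not change the iterated mean, by right invariance in each variable; so
  an almost constant average over pairs pins it down.
\<close>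

lemma iterated_mean_near:
  assumes F: "cont2 F" and L: "L \<noteq> []" "set L \<subseteq> carrier K \<times> carrier K"
    and near: "\<And>x y. x \<in> carrier K \<Longrightarrow> y \<in> carrier K \<Longrightarrow>
      \<bar>(\<Sum>l\<leftarrow>L. F (x \<otimes> fst l, y \<otimes> snd l)) / length L - c\<bar> \<le> \<epsilon>"
  shows "\<bar>mean (\<lambda>x. mean (\<lambda>y. F (x, y))) - c\<bar> \<le> \<epsilon>"
proof (rule mean_unique_ravg[OF cont_mean[OF F]])
  show "translates (map fst L)" using L by (auto simp: translates_def)
  fix x assume x: "x \<in> carrier K"
  have LK: "fst l \<in> carrier K" "snd l \<in> carrier K" if "l \<in> set L" for l using that L by auto
  have c: "cont (\<lambda>y. F (x \<otimes> fst l, y))" if "l \<in> set L" for l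
    using cont_section(1)[OF F] LK[OF that] x by simp
  have c': "cont (\<lambda>y. F (x \<otimes> fst l, y \<otimes> snd l))" if "l \<in> set L" for l
    using LK[OF that] by (intro continuous_at[OF c[OF that]] continuous_mult) auto
  have "ravg (map fst L) (\<lambda>x. mean (\<lambda>y. F (x, y))) x
      = (\<Sum>l\<leftarrow>L. mean (\<lambda>y. F (x \<otimes> fst l, y))) / length L"
    by (simp add: ravg_def o_def)
  also have "(\<Sum>l\<leftarrow>L. mean (\<lambda>y. F (x \<otimes> fst l, y))) = (\<Sum>l\<leftarrow>L. mean (\<lambda>y. F (x \<otimes> fst l, y \<otimes> snd l)))"
    using mean_right_translate[OF c] LK by (intro arg_cong[of _ _ sum_list] map_cong refl) simp
  also have "\<dots> = mean (\<lambda>y. \<Sum>l\<leftarrow>L. F (x \<otimes> fst l, y \<otimes> snd l))"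
    using mean_sum_list(2)[of L "\<lambda>l y. F (x \<otimes> fst l, y \<otimes> snd l)"] c' by simp
  also have "\<dots> / length L = mean (\<lambda>y. (1 / length L) * (\<Sum>l\<leftarrow>L. F (x \<otimes> fst l, y \<otimes> snd l)))"
    by (subst mean_scale) (use mean_sum_list(1)[of L "\<lambda>l y. F (x \<otimes> fst l, y \<otimes> snd l)"] c' in auto)
  finally have eq: "ravg (map fst L) (\<lambda>x. mean (\<lambda>y. F (x, y))) x
      = mean (\<lambda>y. (1 / length L) * (\<Sum>l\<leftarrow>L. F (x \<otimes> fst l, y \<otimes> snd l)))" .
  show "\<bar>ravg (map fst L) (\<lambda>x. mean (\<lambda>y. F (x, y))) x - c\<bar> \<le> \<epsilon>"
    unfolding eq
  proof (rule mean_near)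
    show "cont (\<lambda>y. (1 / length L) * (\<Sum>l\<leftarrow>L. F (x \<otimes> fst l, y \<otimes> snd l)))"
      using mean_sum_list(1)[of L "\<lambda>l y. F (x \<otimes> fst l, y \<otimes> snd l)"] c'
      by (intro continuous_map_real_mult_left) auto
  qed (use near[OF x] in simp)
qed

text \<open>
  Fubini's theorem by uniqueness: averages over the compact group \<open>K \<times> K\<close> bring \<open>F\<close> close to one
  constant, and both iterated means are close to that constant.
\<close>

lemma mean_commute:
  assumes F: "cont2 F"
  shows "mean (\<lambda>x. mean (\<lambda>y. F (x, y))) = mean (\<lambda>y. mean (\<lambda>x. F (x, y)))"
proof -
  interpret P: compact_group "K \<times>\<times> K" "prod_topology S S"
    by (intro compact_group_product compact_group_axioms)
  show ?thesis
  proof (rule real_eqI[where B=2])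
    fix \<epsilon> :: real assume e: "\<epsilon> > 0"
    obtain L where L: "P.translates L"
      "\<forall>z\<in>carrier (K \<times>\<times> K). \<bar>P.ravg L F z - P.mean F\<bar> \<le> \<epsilon>"
      using P.mean_approx(1)[OF F e] by blast
    have LK: "L \<noteq> []" "set L \<subseteq> carrier K \<times> carrier K"
      using L(1) by (auto simp: P.translates_def)
    have near: "\<bar>(\<Sum>l\<leftarrow>L. F (x \<otimes> fst l, y \<otimes> snd l)) / length L - P.mean F\<bar> \<le> \<epsilon>"
      if "x \<in> carrier K" "y \<in> carrier K" for x y
      using bspec[OF L(2), of "(x, y)"] that by (simp add: P.ravg_def mult_product)
    have "\<bar>mean (\<lambda>x. mean (\<lambda>y. F (x, y))) - P.mean F\<bar> \<le> \<epsilon>"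
      by (rule iterated_mean_near[OF F LK near])
    moreover have "\<bar>mean (\<lambda>y. mean (\<lambda>x. F (snd (y, x), fst (y, x)))) - P.mean F\<bar> \<le> \<epsilon>"
      by (rule iterated_mean_near[OF cont2_swap[OF F], of "map prod.swap L"])
        (use LK near in \<open>auto simp: o_def\<close>)
    ultimately show "\<bar>mean (\<lambda>x. mean (\<lambda>y. F (x, y))) - mean (\<lambda>y. mean (\<lambda>x. F (x, y)))\<bar> \<le> 2 * \<epsilon>"
      by simp
  qed simp
qed

end


section \<open>The inner product and convolution\<close>

context compact_group
begin

lemma cancel_left:
  assumes "g \<in> carrier K" "x \<in> carrier K"
  shows "g \<otimes> (inv g \<otimes> x) = x" "inv g \<otimes> (g \<otimes> x) = x"
  using assms by (simp_all flip: m_assoc)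

text \<open>
  Continuous functions form only a pre-Hilbert space under this inner product, with functions that
  agree on the carrier identified. No completion is used below.
\<close>

definition ip :: "('k \<Rightarrow> real) \<Rightarrow> ('k \<Rightarrow> real) \<Rightarrow> real" where
  "ip f g = mean (\<lambda>x. f x * g x)"

definition nrm :: "('k \<Rightarrow> real) \<Rightarrow> real" where
  "nrm f = sqrt (ip f f)"

lemma ip_cong:
  assumes "\<And>x. x \<in> carrier K \<Longrightarrow> f x = f' x" "\<And>x. x \<in> carrier K \<Longrightarrow> g x = g' x"
  shows "ip f g = ip f' g'"
  unfolding ip_def using assms by (intro mean_cong) auto

lemma nrm_cong: "(\<And>x. x \<in> carrier K \<Longrightarrow> f x = f' x) \<Longrightarrow> nrm f = nrm f'"
  unfolding nrm_def using ip_cong by metis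

lemma ip_commute: "ip f g = ip g f"
  by (simp add: ip_def mult.commute)

lemma ip_diff_left:
  assumes "cont f" "cont g" "cont h"
  shows "ip (\<lambda>x. f x - g x) h = ip f h - ip g h"
  using mean_diff[of "\<lambda>x. f x * h x" "\<lambda>x. g x * h x"] assms
  by (simp add: ip_def left_diff_distrib continuous_map_real_mult)

lemma ip_scale_left:
  assumes "cont f" "cont h"
  shows "ip (\<lambda>x. c * f x) h = c * ip f h"
  using mean_scale[of "\<lambda>x. f x * h x" c] assms
  by (simp add: ip_def mult.assoc continuous_map_real_mult)

lemma ip_nonneg: "cont f \<Longrightarrow> 0 \<le> ip f f"
  unfolding ip_def by (rule mean_ge) (auto intro: continuous_map_real_mult)

lemma nrm_nonneg: "cont f \<Longrightarrow> 0 \<le> nrm f"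
  by (simp add: nrm_def ip_nonneg)

lemma nrm_square: "cont f \<Longrightarrow> (nrm f)\<^sup>2 = ip f f"
  by (simp add: nrm_def ip_nonneg)

lemma nrm_scale:
  assumes "cont f"
  shows "nrm (\<lambda>x. c * f x) = \<bar>c\<bar> * nrm f"
proof -
  have "ip (\<lambda>x. c * f x) (\<lambda>x. c * f x) = c\<^sup>2 * ip f f"
    using mean_scale[of "\<lambda>x. f x * f x" "c\<^sup>2"] assms
    by (simp add: ip_def continuous_map_real_mult power2_eq_square mult_ac)
  then show ?thesis by (simp add: nrm_def real_sqrt_mult)
qed

lemma ip_square_expand:
  assumes f: "cont f" and g: "cont g"
  shows "ip (\<lambda>x. f x - t * g x) (\<lambda>x. f x - t * g x) = ip f f - 2 * t * ip f g + t\<^sup>2 * ip g g"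
proof -
  have tg: "cont (\<lambda>x. t * g x)" using g by (rule continuous_map_real_mult_left)
  have d: "cont (\<lambda>x. f x - t * g x)" using f tg by (rule continuous_map_diff)
  have "ip (\<lambda>x. f x - t * g x) (\<lambda>x. f x - t * g x) = ip (\<lambda>x. f x - t * g x) f - t * ip (\<lambda>x. f x - t * g x) g"
    unfolding ip_diff_left[OF f tg d] ip_scale_left[OF g d] by (simp add: ip_commute)
  also have "\<dots> = ip f f - t * ip g f - t * (ip f g - t * ip g g)"
    unfolding ip_diff_left[OF f tg f] ip_scale_left[OF g f] ip_diff_left[OF f tg g] ip_scale_left[OF g g] ..
  finally show ?thesis by (simp add: ip_commute[of g f] power2_eq_square algebra_simps)
qed

lemma Cauchy_Schwarz:
  assumes f: "cont f" and g: "cont g"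
  shows "\<bar>ip f g\<bar> \<le> nrm f * nrm g"
proof -
  have quad: "0 \<le> ip f f - 2 * t * ip f g + t\<^sup>2 * ip g g" for t
    unfolding ip_square_expand[OF f g, symmetric]
    using f g by (intro ip_nonneg continuous_map_diff continuous_map_real_mult_left)
  have "(ip f g)\<^sup>2 \<le> ip f f * ip g g"
  proof (cases "ip g g = 0")
    case True
    have "ip f g = 0"
    proof (rule ccontr)
      assume n: "ip f g \<noteq> 0"
      have "2 * ((ip f f + 1) / (2 * ip f g)) * ip f g = ip f f + 1" using n by simp
      with quad[of "(ip f f + 1) / (2 * ip f g)"] True show False by simp
    qed
    then show ?thesis using True by simp
  next
    case False
    then have pos: "ip g g > 0" using ip_nonneg[OF g] by linarith
    have "ip f f - 2 * (ip f g / ip g g) * ip f g + (ip f g / ip g g)\<^sup>2 * ip g g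
        = ip f f - (ip f g)\<^sup>2 / ip g g"
      using pos by (simp add: field_simps power2_eq_square)
    with quad[of "ip f g / ip g g"] have "(ip f g)\<^sup>2 / ip g g \<le> ip f f" by simp
    then show ?thesis using pos by (simp add: field_simps)
  qed
  from real_sqrt_le_mono[OF this] show ?thesis by (simp add: nrm_def real_sqrt_mult)
qed

lemma nrm_diff_le:
  assumes f: "cont f" and g: "cont g"
  shows "nrm (\<lambda>x. f x - g x) \<le> nrm f + nrm g"
proof (rule power2_le_imp_le)
  have "(nrm (\<lambda>x. f x - g x))\<^sup>2 = ip f f - 2 * ip f g + ip g g"
    using ip_square_expand[OF f g, of 1] f g by (simp add: nrm_square continuous_map_diff)
  also have "\<dots> \<le> ip f f + 2 * (nrm f * nrm g) + ip g g"
    using Cauchy_Schwarz[OF f g] by linarith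
  also have "\<dots> = (nrm f + nrm g)\<^sup>2"
    using f g by (simp add: power2_sum nrm_square)
  finally show "(nrm (\<lambda>x. f x - g x))\<^sup>2 \<le> (nrm f + nrm g)\<^sup>2" .
qed (use f g nrm_nonneg in simp)

lemma nrm_add_le:
  assumes f: "cont f" and g: "cont g"
  shows "nrm (\<lambda>x. f x + g x) \<le> nrm f + nrm g"
  using nrm_diff_le[OF f, of "\<lambda>x. -1 * g x"] nrm_scale[OF g, of "-1"] continuous_map_real_mult_left[OF g, of "-1"]
  by simp

lemma nrm_le_sup:
  assumes f: "cont f" and c: "0 \<le> c" "\<And>x. x \<in> carrier K \<Longrightarrow> \<bar>f x\<bar> \<le> c"
  shows "nrm f \<le> c"
proof -
  have "ip f f \<le> mean (\<lambda>x. c\<^sup>2)"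
    unfolding ip_def using f c
    by (intro mean_mono continuous_map_real_mult)
      (auto simp: power2_eq_square intro: abs_le_square_iff[THEN iffD1, unfolded power2_eq_square])
  also have "\<dots> = c\<^sup>2" using mean_near[of "\<lambda>x. c\<^sup>2" "c\<^sup>2" 0] by simp
  finally have "sqrt (ip f f) \<le> sqrt (c\<^sup>2)" by (rule real_sqrt_le_mono)
  then show ?thesis using c(1) by (simp add: nrm_def)
qed

definition rtrans :: "'k \<Rightarrow> ('k \<Rightarrow> real) \<Rightarrow> 'k \<Rightarrow> real" where
  "rtrans g f x = f (x \<otimes> g)"

text \<open>
  This is \<open>g - 1\<close> in the right regular representation.
\<close>

definition dif :: "'k \<Rightarrow> ('k \<Rightarrow> real) \<Rightarrow> 'k \<Rightarrow> real" where
  "dif g f x = f (x \<otimes> g) - f x"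

lemma cont_rtrans: "cont f \<Longrightarrow> g \<in> carrier K \<Longrightarrow> cont (rtrans g f)"
  unfolding rtrans_def[abs_def] by (rule continuous_at) (auto intro!: continuous_mult)

lemma cont_dif: "cont f \<Longrightarrow> g \<in> carrier K \<Longrightarrow> cont (dif g f)"
  using cont_rtrans[of f g] unfolding dif_def[abs_def] rtrans_def[abs_def]
  by (intro continuous_map_diff)

lemma ip_rtrans:
  assumes "cont f" "cont h" "g \<in> carrier K"
  shows "ip (rtrans g f) (rtrans g h) = ip f h"
  unfolding ip_def rtrans_def using assms
  by (intro mean_right_translate[of "\<lambda>x. f x * h x"] continuous_map_real_mult)

lemma nrm_rtrans: "cont f \<Longrightarrow> g \<in> carrier K \<Longrightarrow> nrm (rtrans g f) = nrm f"
  by (simp add: nrm_def ip_rtrans)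

lemma ip_rtrans_left:
  assumes "cont f" "cont h" "g \<in> carrier K"
  shows "ip (rtrans g f) h = ip f (rtrans (inv g) h)"
proof -
  have "ip (rtrans g f) h = ip (rtrans (inv g) (rtrans g f)) (rtrans (inv g) h)"
    using assms by (intro ip_rtrans[symmetric] cont_rtrans) auto
  also have "\<dots> = ip f (rtrans (inv g) h)"
    using assms by (intro ip_cong) (auto simp: rtrans_def m_assoc)
  finally show ?thesis .
qed

lemma nrm_dif_le: "cont f \<Longrightarrow> g \<in> carrier K \<Longrightarrow> nrm (dif g f) \<le> 2 * nrm f"
  using nrm_diff_le[of "rtrans g f" f] cont_rtrans[of f g] nrm_rtrans[of f g]
  by (simp add: dif_def[abs_def] rtrans_def)

lemma nrm_dif_mult:
  assumes f: "cont f" and g: "g \<in> carrier K" and h: "h \<in> carrier K"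
  shows "nrm (dif (g \<otimes> h) f) \<le> nrm (dif g f) + nrm (dif h f)"
proof -
  have "nrm (dif (g \<otimes> h) f) = nrm (\<lambda>x. dif g f x + rtrans g (dif h f) x)"
    using g h by (intro nrm_cong) (simp add: dif_def rtrans_def m_assoc cancel_left)
  also have "\<dots> \<le> nrm (dif g f) + nrm (rtrans g (dif h f))"
    using f g h by (intro nrm_add_le cont_rtrans cont_dif)
  finally show ?thesis using f g h by (simp add: nrm_rtrans cont_dif)
qed

lemma nrm_dif_inv:
  assumes f: "cont f" and g: "g \<in> carrier K"
  shows "nrm (dif (inv g) f) = nrm (dif g f)"
proof -
  have "nrm (dif g f) = nrm (rtrans (inv g) (dif g f))"
    using f g by (simp add: nrm_rtrans cont_dif)
  also have "\<dots> = nrm (\<lambda>x. -1 * dif (inv g) f x)"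
    using g by (intro nrm_cong) (simp add: dif_def rtrans_def m_assoc cancel_left)
  also have "\<dots> = nrm (dif (inv g) f)" using nrm_scale[OF cont_dif[OF f], of "inv g" "-1"] g by simp
  finally show ?thesis by simp
qed

lemma nrm_dif_conj:
  assumes f: "cont f" and g: "g \<in> carrier K" and k: "k \<in> carrier K"
  shows "nrm (dif (k \<otimes> g \<otimes> inv k) f) = nrm (dif g (rtrans (inv k) f))"
proof -
  have "nrm (dif (k \<otimes> g \<otimes> inv k) f) = nrm (rtrans k (dif g (rtrans (inv k) f)))"
    using g k by (intro nrm_cong) (simp add: dif_def rtrans_def m_assoc cancel_left)
  then show ?thesis using f g k by (simp add: nrm_rtrans cont_dif cont_rtrans)
qed

text \<open>
  The operator identity behind it is \<open>[g, h] - 1 = ((g - 1)(h - 1) - (h - 1)(g - 1)) g\<inverse>h\<inverse>\<close>. It is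
  the source of the contraction of commutators.
\<close>

lemma nrm_dif_commutator:
  assumes f: "cont f" and g: "g \<in> carrier K" and h: "h \<in> carrier K"
  defines "f' \<equiv> rtrans (inv g \<otimes> inv h) f"
  shows "nrm (dif (g \<otimes> h \<otimes> inv g \<otimes> inv h) f) \<le> nrm (dif g (dif h f')) + nrm (dif h (dif g f'))"
proof -
  have eq: "x \<otimes> h \<otimes> g \<otimes> (inv g \<otimes> inv h) = x" if x: "x \<in> carrier K" for x
    using x g h by (simp add: m_assoc cancel_left)
  have "nrm (dif (g \<otimes> h \<otimes> inv g \<otimes> inv h) f) = nrm (\<lambda>x. dif g (dif h f') x - dif h (dif g f') x)"
    using g h eq by (intro nrm_cong) (simp add: dif_def rtrans_def f'_def m_assoc cancel_left)
  also have "\<dots> \<le> nrm (dif g (dif h f')) + nrm (dif h (dif g f'))"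
    using f g h unfolding f'_def by (intro nrm_diff_le cont_dif cont_rtrans) auto
  finally show ?thesis .
qed

end

locale convolution = compact_group +
  fixes \<phi> :: "'a \<Rightarrow> real"
  assumes cont_kernel: "continuous_map S euclideanreal \<phi>"
    and kernel_inv: "\<And>x. x \<in> carrier K \<Longrightarrow> \<phi> (inv x) = \<phi> x"
begin

text \<open>
  The argument \<open>x y\<inverse>\<close> of the kernel is unchanged when \<open>x\<close> and \<open>y\<close> are multiplied on the right by the
  same element, so convolution commutes with right translations; \<open>\<phi>(x\<inverse>) = \<phi>(x)\<close> makes it
  self-adjoint.
\<close>

definition conv :: "('a \<Rightarrow> real) \<Rightarrow> 'a \<Rightarrow> real" where
  "conv f x = mean (\<lambda>y. \<phi> (x \<otimes> inv y) * f y)"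

lemma cont2_conv:
  assumes f: "cont f"
  shows "cont2 (\<lambda>p. \<phi> (fst p \<otimes> inv (snd p)) * f (snd p))"
proof (rule continuous_map_real_mult)
  show "cont2 (\<lambda>p. \<phi> (fst p \<otimes> inv (snd p)))"
    by (rule continuous_at[OF cont_kernel])
      (rule continuous_mult[OF continuous_map_fst continuous_inv[OF continuous_map_snd]])
  show "cont2 (\<lambda>p. f (snd p))" by (rule continuous_at[OF f continuous_map_snd])
qed

lemma cont_conv: "cont f \<Longrightarrow> cont (conv f)"
  using cont_mean[OF cont2_conv] by (simp add: conv_def[abs_def])

lemma cont_integrand: "cont f \<Longrightarrow> x \<in> carrier K \<Longrightarrow> cont (\<lambda>y. \<phi> (x \<otimes> inv y) * f y)"
  using cont_section(1)[OF cont2_conv] by simp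

lemma conv_cong: "(\<And>x. x \<in> carrier K \<Longrightarrow> f x = g x) \<Longrightarrow> conv f x = conv g x"
  unfolding conv_def by (intro mean_cong) simp

lemma conv_diff:
  assumes "cont f" "cont g" "x \<in> carrier K"
  shows "conv (\<lambda>y. f y - g y) x = conv f x - conv g x"
  using mean_diff[OF cont_integrand[OF assms(1,3)] cont_integrand[OF assms(2,3)]]
  by (simp add: conv_def right_diff_distrib)

lemma conv_scale:
  assumes "cont f" "x \<in> carrier K"
  shows "conv (\<lambda>y. c * f y) x = c * conv f x"
  using mean_scale[OF cont_integrand[OF assms], of c]
  by (simp add: conv_def mult_ac)

lemma conv_rtrans:
  assumes f: "cont f" and g: "g \<in> carrier K" and x: "x \<in> carrier K"
  shows "conv (rtrans g f) x = rtrans g (conv f) x"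
proof -
  have "conv (rtrans g f) x = mean (\<lambda>y. \<phi> (x \<otimes> g \<otimes> inv (y \<otimes> g)) * f (y \<otimes> g))"
    unfolding conv_def rtrans_def using g x
    by (intro mean_cong) (simp add: inv_mult_group m_assoc cancel_left)
  also have "\<dots> = mean (\<lambda>y. \<phi> (x \<otimes> g \<otimes> inv y) * f y)"
    using cont_integrand[OF f, of "x \<otimes> g"] g x
    by (intro mean_right_translate[of "\<lambda>y. \<phi> (x \<otimes> g \<otimes> inv y) * f y"]) auto
  finally show ?thesis by (simp add: conv_def rtrans_def)
qed

lemma conv_dif:
  assumes f: "cont f" and g: "g \<in> carrier K" and x: "x \<in> carrier K"
  shows "conv (dif g f) x = dif g (conv f) x"
  using conv_diff[OF cont_rtrans[OF f g] f x] conv_rtrans[OF f g x]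
  by (simp add: dif_def[abs_def] rtrans_def)

lemma conv_selfadjoint:
  assumes f: "cont f" and g: "cont g"
  shows "ip (conv f) g = ip f (conv g)"
proof -
  define F where "F p = \<phi> (fst p \<otimes> inv (snd p)) * f (snd p) * g (fst p)" for p
  have F: "cont2 F" unfolding F_def
    by (rule continuous_map_real_mult[OF cont2_conv[OF f] continuous_at[OF g continuous_map_fst]])
  have "ip (conv f) g = mean (\<lambda>x. mean (\<lambda>y. F (x, y)))"
    unfolding ip_def conv_def
  proof (rule mean_cong)
    fix x assume x: "x \<in> carrier K"
    show "mean (\<lambda>y. \<phi> (x \<otimes> inv y) * f y) * g x = mean (\<lambda>y. F (x, y))"
      using mean_scale[OF cont_integrand[OF f x], of "g x"] by (simp add: F_def mult_ac)
  qed
  also have "\<dots> = mean (\<lambda>y. mean (\<lambda>x. F (x, y)))" by (rule mean_commute[OF F])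
  also have "\<dots> = ip f (conv g)"
    unfolding ip_def conv_def
  proof (rule mean_cong)
    fix y assume y: "y \<in> carrier K"
    have "mean (\<lambda>x. F (x, y)) = mean (\<lambda>x. f y * (\<phi> (y \<otimes> inv x) * g x))"
    proof (rule mean_cong)
      fix x assume x: "x \<in> carrier K"
      have "\<phi> (x \<otimes> inv y) = \<phi> (y \<otimes> inv x)"
        using kernel_inv[of "x \<otimes> inv y"] x y by (simp add: inv_mult_group)
      then show "F (x, y) = f y * (\<phi> (y \<otimes> inv x) * g x)" by (simp add: F_def)
    qed
    then show "mean (\<lambda>x. F (x, y)) = f y * mean (\<lambda>x. \<phi> (y \<otimes> inv x) * g x)"
      using mean_scale[OF cont_integrand[OF g y], of "f y"] by simp
  qed
  finally show ?thesis .
qed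

lemma conv_difference_bound:
  assumes f: "cont f" and x: "x \<in> carrier K" "x' \<in> carrier K" and c: "0 \<le> c"
    and le: "\<And>y. y \<in> carrier K \<Longrightarrow> \<bar>\<phi> (x \<otimes> y) - \<phi> (x' \<otimes> y)\<bar> \<le> c"
  shows "\<bar>conv f x - conv f x'\<bar> \<le> c * nrm f"
proof -
  define d where "d y = \<phi> (x \<otimes> inv y) - \<phi> (x' \<otimes> inv y)" for y
  have d: "cont d" unfolding d_def
    using x by (intro continuous_map_diff continuous_at[OF cont_kernel] continuous_mult continuous_inv) auto
  have "conv f x - conv f x' = ip d f"
    using mean_diff[OF cont_integrand[OF f x(1)] cont_integrand[OF f x(2)]]
    by (simp add: conv_def ip_def d_def left_diff_distrib)
  also have "\<bar>ip d f\<bar> \<le> nrm d * nrm f" by (rule Cauchy_Schwarz[OF d f])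
  also have "\<dots> \<le> c * nrm f"
    using nrm_le_sup[OF d c] le nrm_nonneg[OF f] by (intro mult_right_mono) (auto simp: d_def)
  finally show ?thesis by simp
qed

lemma conv_bounded:
  obtains B where "B > 0" "\<And>f. cont f \<Longrightarrow> nrm (conv f) \<le> B * nrm f"
proof -
  obtain B where B: "B > 0" "\<And>x. x \<in> carrier K \<Longrightarrow> \<bar>\<phi> x\<bar> \<le> B"
    by (rule bounded_continuous[OF cont_kernel]) (rule that)
  have "nrm (conv f) \<le> B * nrm f" if f: "cont f" for f
  proof (rule nrm_le_sup[OF cont_conv[OF f]])
    show "0 \<le> B * nrm f" using B nrm_nonneg[OF f] by simp
    fix x assume x: "x \<in> carrier K"
    define k where "k y = \<phi> (x \<otimes> inv y)" for y
    have k: "cont k" unfolding k_def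
      using x by (intro continuous_at[OF cont_kernel] continuous_mult continuous_inv) auto
    have "\<bar>conv f x\<bar> \<le> nrm k * nrm f"
      using Cauchy_Schwarz[OF k f] by (simp add: conv_def ip_def k_def)
    also have "\<dots> \<le> B * nrm f"
      using nrm_le_sup[OF k, of B] B x nrm_nonneg[OF f] by (intro mult_right_mono) (auto simp: k_def)
    finally show "\<bar>conv f x\<bar> \<le> B * nrm f" .
  qed
  with B(1) show ?thesis by (rule that)
qed

text \<open>
  This plays the role of compactness of the operator: in the operator norm after convolution,
  small group elements act almost trivially.
\<close>

lemma conv_equicontinuous:
  assumes e: "\<epsilon> > 0"
  obtains V where "openin S V" "\<one> \<in> V"
    "\<And>g f. g \<in> V \<Longrightarrow> cont f \<Longrightarrow> nrm (dif g (conv f)) \<le> \<epsilon> * nrm f"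
proof -
  obtain V where V: "openin S V" "\<one> \<in> V"
    "\<And>g u v. g \<in> V \<Longrightarrow> u \<in> carrier K \<Longrightarrow> v \<in> carrier K \<Longrightarrow> \<bar>\<phi> (u \<otimes> g \<otimes> v) - \<phi> (u \<otimes> v)\<bar> < \<epsilon>"
    by (rule uniformly_continuous[OF cont_kernel e]) (rule that)
  have "nrm (dif g (conv f)) \<le> \<epsilon> * nrm f" if g: "g \<in> V" and f: "cont f" for g f
  proof (rule nrm_le_sup)
    have gK: "g \<in> carrier K" using g openin_subset[OF V(1)] by auto
    show "cont (dif g (conv f))" using gK f by (intro cont_dif cont_conv)
    show "0 \<le> \<epsilon> * nrm f" using e nrm_nonneg[OF f] by simp
    show "\<bar>dif g (conv f) x\<bar> \<le> \<epsilon> * nrm f" if x: "x \<in> carrier K" for x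
      unfolding dif_def using V(3)[OF g x] gK e
      by (intro conv_difference_bound[OF f]) (auto simp: x less_imp_le)
  qed
  with V(1,2) show ?thesis by (rule that)
qed

end


section \<open>Convolution on the functions orthogonal to fixed vectors\<close>

locale separating_convolution = convolution +
  fixes z
  assumes z: "z \<in> carrier K" and kernel_one: "\<phi> \<one> \<noteq> 0"
    and kernel_disjoint: "\<And>y. y \<in> carrier K \<Longrightarrow> \<phi> y * \<phi> (y \<otimes> z) = 0"
begin

text \<open>
  The space \<open>W\<close> below stands for the orthogonal complement of the vectors fixed by
  the normal closure of \<open>z\<close>. Bounded sequences of almost fixed vectors replace fixed vectors, because
  limits of such sequences need not be continuous functions.
\<close>

definition almost_fixed :: "(nat \<Rightarrow> 'a \<Rightarrow> real) \<Rightarrow> bool" where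
  "almost_fixed v \<longleftrightarrow> (\<exists>B. \<forall>i. cont (v i) \<and> nrm (v i) \<le> B) \<and>
     (\<forall>g\<in>carrier K. (\<lambda>i. nrm (dif (g \<otimes> z \<otimes> inv g) (v i))) \<longlonglongrightarrow> 0)"

definition W :: "('a \<Rightarrow> real) set" where
  "W = {f. cont f \<and> (\<forall>v. almost_fixed v \<longrightarrow> (\<lambda>i. ip f (v i)) \<longlonglongrightarrow> 0)}"

lemma W_cont: "f \<in> W \<Longrightarrow> cont f"
  by (simp add: W_def)

lemma almost_fixed_cont: "almost_fixed v \<Longrightarrow> cont (v i)"
  by (auto simp: almost_fixed_def)

lemma W_diff:
  assumes "f \<in> W" "h \<in> W"
  shows "(\<lambda>x. f x - h x) \<in> W"
proof -
  have "(\<lambda>i. ip (\<lambda>x. f x - h x) (v i)) \<longlonglongrightarrow> 0" if v: "almost_fixed v" for v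
  proof -
    have "(\<lambda>i. ip f (v i) - ip h (v i)) \<longlonglongrightarrow> 0 - 0"
      using assms v by (intro tendsto_diff) (auto simp: W_def)
    then show ?thesis using ip_diff_left[OF W_cont W_cont almost_fixed_cont] assms v by simp
  qed
  then show ?thesis using assms by (simp add: W_def continuous_map_diff)
qed

lemma W_scale:
  assumes f: "f \<in> W"
  shows "(\<lambda>x. c * f x) \<in> W"
proof -
  have "(\<lambda>i. ip (\<lambda>x. c * f x) (v i)) \<longlonglongrightarrow> 0" if v: "almost_fixed v" for v
  proof -
    have "(\<lambda>i. c * ip f (v i)) \<longlonglongrightarrow> c * 0"
      using f v by (intro tendsto_mult) (auto simp: W_def)
    then show ?thesis using ip_scale_left[OF W_cont almost_fixed_cont] f v by simp
  qed
  then show ?thesis using f by (simp add: W_def continuous_map_real_mult_left)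
qed

lemma almost_fixed_rtrans:
  assumes v: "almost_fixed v" and g: "g \<in> carrier K"
  shows "almost_fixed (\<lambda>i. rtrans g (v i))"
  unfolding almost_fixed_def
proof (intro conjI ballI)
  obtain B where "\<And>i. cont (v i) \<and> nrm (v i) \<le> B" using v unfolding almost_fixed_def by blast
  then show "\<exists>B. \<forall>i. cont (rtrans g (v i)) \<and> nrm (rtrans g (v i)) \<le> B"
    using g by (intro exI[of _ B]) (auto simp: cont_rtrans nrm_rtrans)
  fix c assume c: "c \<in> carrier K"
  define d where "d = inv g \<otimes> c"
  have d: "d \<in> carrier K" using g c by (simp add: d_def)
  have "nrm (dif (c \<otimes> z \<otimes> inv c) (rtrans g (v i))) = nrm (dif (d \<otimes> z \<otimes> inv d) (v i))" for i
  proof -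
    have "nrm (dif (c \<otimes> z \<otimes> inv c) (rtrans g (v i))) = nrm (rtrans g (dif (d \<otimes> z \<otimes> inv d) (v i)))"
      using g c z by (intro nrm_cong) (simp add: dif_def rtrans_def d_def m_assoc cancel_left inv_mult_group)
    then show ?thesis using almost_fixed_cont[OF v] g d z by (simp add: nrm_rtrans cont_dif)
  qed
  then show "(\<lambda>i. nrm (dif (c \<otimes> z \<otimes> inv c) (rtrans g (v i)))) \<longlonglongrightarrow> 0"
    using v d by (simp add: almost_fixed_def)
qed

lemma W_rtrans:
  assumes f: "f \<in> W" and g: "g \<in> carrier K"
  shows "rtrans g f \<in> W"
proof -
  have "(\<lambda>i. ip (rtrans g f) (v i)) \<longlonglongrightarrow> 0" if v: "almost_fixed v" for v
  proof -
    have "(\<lambda>i. ip f (rtrans (inv g) (v i))) \<longlonglongrightarrow> 0"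
      using f g almost_fixed_rtrans[OF v, of "inv g"] by (simp add: W_def)
    then show ?thesis using ip_rtrans_left[OF W_cont[OF f] almost_fixed_cont[OF v] g] by simp
  qed
  then show ?thesis using f g by (simp add: W_def cont_rtrans)
qed

lemma W_dif: "f \<in> W \<Longrightarrow> g \<in> carrier K \<Longrightarrow> dif g f \<in> W"
  using W_diff[OF W_rtrans[of f g], of f] by (simp add: dif_def[abs_def] rtrans_def)

lemma nrm_dif_conv:
  assumes "cont f" "g \<in> carrier K"
  shows "nrm (dif g (conv f)) = nrm (conv (dif g f))"
  by (rule nrm_cong) (simp add: conv_dif[OF assms])

lemma almost_fixed_conv:
  assumes v: "almost_fixed v"
  shows "almost_fixed (\<lambda>i. conv (v i))"
proof -
  obtain C where C: "C > 0" "\<And>f. cont f \<Longrightarrow> nrm (conv f) \<le> C * nrm f"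
    by (rule conv_bounded) (rule that)
  obtain B where B: "\<And>i. cont (v i) \<and> nrm (v i) \<le> B" using v unfolding almost_fixed_def by blast
  have "nrm (conv (v i)) \<le> C * B" for i
    by (rule order_trans[OF C(2) mult_left_mono]) (use B C(1) in auto)
  moreover have "(\<lambda>i. nrm (dif (g \<otimes> z \<otimes> inv g) (conv (v i)))) \<longlonglongrightarrow> 0" if g: "g \<in> carrier K" for g
  proof (rule real_tendsto_sandwich[where f="\<lambda>i. 0" and h="\<lambda>i. C * nrm (dif (g \<otimes> z \<otimes> inv g) (v i))"])
    have gz: "g \<otimes> z \<otimes> inv g \<in> carrier K" using g z by simp
    have "(\<lambda>i. C * nrm (dif (g \<otimes> z \<otimes> inv g) (v i))) \<longlonglongrightarrow> C * 0"
      using v g by (intro tendsto_mult) (auto simp: almost_fixed_def)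
    then show "(\<lambda>i. C * nrm (dif (g \<otimes> z \<otimes> inv g) (v i))) \<longlonglongrightarrow> 0" by simp
    show "\<forall>\<^sub>F i in sequentially. nrm (dif (g \<otimes> z \<otimes> inv g) (conv (v i)))
        \<le> C * nrm (dif (g \<otimes> z \<otimes> inv g) (v i))"
      using B gz by (intro always_eventually allI) (simp add: nrm_dif_conv C(2) cont_dif)
    show "\<forall>\<^sub>F i in sequentially. 0 \<le> nrm (dif (g \<otimes> z \<otimes> inv g) (conv (v i)))"
      using B gz by (intro always_eventually allI) (simp add: nrm_nonneg cont_dif cont_conv)
  qed simp
  ultimately show ?thesis
    using B unfolding almost_fixed_def by (blast intro: cont_conv)
qed

lemma W_conv:
  assumes f: "f \<in> W"
  shows "conv f \<in> W"
proof -
  have "(\<lambda>i. ip (conv f) (v i)) \<longlonglongrightarrow> 0" if v: "almost_fixed v" for v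
    using f almost_fixed_conv[OF v] conv_selfadjoint[OF W_cont[OF f] almost_fixed_cont[OF v]]
    by (simp add: W_def)
  then show ?thesis using f by (simp add: W_def cont_conv)
qed

text \<open>
  A difference \<open>z f - f\<close> is orthogonal to whatever \<open>z\<close> fixes. Together with
  \<open>conv_dif_kernel\<close> it shows that convolution does not vanish on \<open>W\<close>.
\<close>

lemma dif_kernel_W: "dif z \<phi> \<in> W"
proof -
  have "(\<lambda>i. ip (dif z \<phi>) (v i)) \<longlonglongrightarrow> 0" if v: "almost_fixed v" for v
  proof (rule Lim_null_comparison)
    have vc: "cont (v i)" for i using v by (rule almost_fixed_cont)
    have "ip (dif z \<phi>) (v i) = ip \<phi> (dif (inv z) (v i))" for i
    proof -
      have "ip (dif z \<phi>) (v i) = ip \<phi> (rtrans (inv z) (v i)) - ip \<phi> (v i)"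
        using ip_diff_left[OF cont_rtrans[OF cont_kernel z] cont_kernel vc, of i]
          ip_rtrans_left[OF cont_kernel vc z] by (simp add: dif_def[abs_def] rtrans_def)
      also have "\<dots> = ip \<phi> (dif (inv z) (v i))"
        using ip_diff_left[OF cont_rtrans[OF vc] vc cont_kernel, of "inv z" i i] z
        by (simp add: dif_def[abs_def] rtrans_def ip_commute[of \<phi>])
      finally show ?thesis .
    qed
    then have "\<bar>ip (dif z \<phi>) (v i)\<bar> \<le> nrm \<phi> * nrm (dif z (v i))" for i
      using Cauchy_Schwarz[OF cont_kernel cont_dif[OF vc]] nrm_dif_inv[OF vc z] z by (metis inv_closed)
    then show "\<forall>\<^sub>F i in sequentially. norm (ip (dif z \<phi>) (v i)) \<le> nrm \<phi> * nrm (dif z (v i))"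
      by simp
    have "(\<lambda>i. nrm (dif z (v i))) \<longlonglongrightarrow> 0"
      using v z unfolding almost_fixed_def by (auto dest!: bspec[of _ _ \<one>])
    then show "(\<lambda>i. nrm \<phi> * nrm (dif z (v i))) \<longlonglongrightarrow> 0"
      by (rule tendsto_mult_right_zero)
  qed
  then show ?thesis by (simp add: W_def cont_dif cont_kernel z)
qed

lemma nrm_pos:
  assumes "cont f" "a \<in> carrier K" "f a \<noteq> 0"
  shows "nrm f > 0"
  unfolding nrm_def ip_def
  using mean_positive[of "\<lambda>x. f x * f x" a] assms
  by (simp add: continuous_map_real_mult) (metis not_real_square_gt_zero)

text \<open>
  At \<open>1\<close> the convolution equals \<open>\<phi>*\<phi>(z) - \<phi>*\<phi>(1)\<close>. The first term is \<open>0\<close> because the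
  kernel and its translate by \<open>z\<close> have disjoint supports, and the second is a positive mean.
\<close>

lemma conv_dif_kernel: "nrm (conv (dif z \<phi>)) > 0"
proof (rule nrm_pos)
  show "cont (conv (dif z \<phi>))" using z by (intro cont_conv cont_dif cont_kernel)
  have "conv (dif z \<phi>) \<one> = mean (\<lambda>y. -1 * (\<phi> y * \<phi> y))"
    unfolding conv_def
  proof (rule mean_cong)
    fix y assume y: "y \<in> carrier K"
    then show "\<phi> (\<one> \<otimes> inv y) * dif z \<phi> y = -1 * (\<phi> y * \<phi> y)"
      using kernel_disjoint[OF y] by (simp add: kernel_inv dif_def algebra_simps)
  qed
  also have "\<dots> = -1 * mean (\<lambda>y. \<phi> y * \<phi> y)"
    by (intro mean_scale continuous_map_real_mult cont_kernel)
  finally have "conv (dif z \<phi>) \<one> = - mean (\<lambda>y. \<phi> y * \<phi> y)" by simp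
  moreover have "mean (\<lambda>y. \<phi> y * \<phi> y) > 0"
    using kernel_one by (intro mean_positive[of _ \<one>] continuous_map_real_mult cont_kernel)
      (auto simp: zero_less_mult_iff linorder_neq_iff)
  ultimately show "conv (dif z \<phi>) \<one> \<noteq> 0" by simp
qed simp

definition rho :: real where
  "rho = Sup {nrm (conv f) | f. f \<in> W \<and> nrm f \<le> 1}"

lemma rho_bdd: "bdd_above {nrm (conv f) | f. f \<in> W \<and> nrm f \<le> 1}"
proof -
  obtain C where C: "C > 0" "\<And>f. cont f \<Longrightarrow> nrm (conv f) \<le> C * nrm f"
    by (rule conv_bounded) (rule that)
  have "nrm (conv f) \<le> C" if "f \<in> W" "nrm f \<le> 1" for f
    using order_trans[OF C(2)[OF W_cont[OF that(1)]] mult_left_mono[OF that(2), of C]] C(1) by simp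
  then show ?thesis by (intro bdd_aboveI[of _ C]) auto
qed

lemma nrm_conv_le:
  assumes f: "f \<in> W"
  shows "nrm (conv f) \<le> rho * nrm f"
proof (cases "nrm f = 0")
  case True
  obtain C where "C > 0" "\<And>f. cont f \<Longrightarrow> nrm (conv f) \<le> C * nrm f"
    by (rule conv_bounded) (rule that)
  then show ?thesis using W_cont[OF f] True by (metis mult_zero_right)
next
  case False
  define c where "c = 1 / nrm f"
  have pos: "nrm f > 0" using False nrm_nonneg[OF W_cont[OF f]] by simp
  then have c: "c > 0" "c * nrm f = 1" by (simp_all add: c_def)
  have "nrm (\<lambda>x. c * f x) = 1" using c nrm_scale[OF W_cont[OF f], of c] by simp
  then have "nrm (conv (\<lambda>x. c * f x)) \<le> rho"
    unfolding rho_def using W_scale[OF f, of c] by (intro cSup_upper rho_bdd) auto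
  moreover have "nrm (conv (\<lambda>x. c * f x)) = nrm (\<lambda>x. c * conv f x)"
    using conv_scale[OF W_cont[OF f]] by (intro nrm_cong) simp
  ultimately have "c * nrm (conv f) \<le> rho"
    using nrm_scale[OF cont_conv[OF W_cont[OF f]], of c] c by simp
  then show ?thesis using pos by (simp add: c_def field_simps)
qed

lemma rho_pos: "rho > 0"
proof (rule ccontr)
  assume "\<not> rho > 0"
  then have "rho * nrm (dif z \<phi>) \<le> 0"
    using nrm_nonneg[OF cont_dif[OF cont_kernel z]] by (simp add: mult_nonpos_nonneg)
  then show False using nrm_conv_le[OF dif_kernel_W] conv_dif_kernel by linarith
qed

definition smooth :: "('a \<Rightarrow> real) \<Rightarrow> 'a \<Rightarrow> real" where
  "smooth f x = (1 / rho) * conv f x"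

abbreviation smooths :: "nat \<Rightarrow> ('a \<Rightarrow> real) \<Rightarrow> 'a \<Rightarrow> real" where
  "smooths m \<equiv> smooth ^^ m"

lemma smooth_cong: "(\<And>x. x \<in> carrier K \<Longrightarrow> f x = g x) \<Longrightarrow> smooth f x = smooth g x"
  unfolding smooth_def using conv_cong[of f g x] by simp

lemma cont_smooth: "cont f \<Longrightarrow> cont (smooth f)"
  unfolding smooth_def[abs_def] by (intro continuous_map_real_mult_left cont_conv)

lemma cont_smooths: "cont f \<Longrightarrow> cont (smooths m f)"
  by (induction m) (auto intro: cont_smooth)

lemma nrm_smooth: "cont f \<Longrightarrow> nrm (smooth f) = nrm (conv f) / rho"
  unfolding smooth_def[abs_def] using nrm_scale[OF cont_conv, of f "1 / rho"] rho_pos by simp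

lemma W_smooths: "f \<in> W \<Longrightarrow> smooths m f \<in> W"
proof (induction m)
  case (Suc m)
  then show ?case using W_scale[OF W_conv, of "smooths m f" "1 / rho"] by (simp add: smooth_def[abs_def])
qed simp

lemma nrm_smooth_le:
  assumes f: "f \<in> W"
  shows "nrm (smooth f) \<le> nrm f"
proof -
  show ?thesis
    unfolding nrm_smooth[OF W_cont[OF f]] using nrm_conv_le[OF f] rho_pos
    by (simp add: pos_divide_le_eq mult.commute)
qed

lemma nrm_smooths_le: "f \<in> W \<Longrightarrow> nrm (smooths m f) \<le> nrm f"
proof (induction m)
  case (Suc m)
  then show ?case using nrm_smooth_le[OF W_smooths[OF Suc.prems, of m]] by simp
qed simp

lemma smooths_rtrans:
  assumes "cont f" "g \<in> carrier K" "x \<in> carrier K"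
  shows "smooths m (rtrans g f) x = rtrans g (smooths m f) x"
  using assms(3)
proof (induction m arbitrary: x)
  case (Suc m)
  have "smooth (smooths m (rtrans g f)) x = smooth (rtrans g (smooths m f)) x"
    using Suc.IH by (rule smooth_cong)
  also have "\<dots> = rtrans g (smooth (smooths m f)) x"
    using conv_rtrans[OF cont_smooths[OF assms(1)] assms(2) Suc.prems] by (simp add: smooth_def rtrans_def)
  finally show ?case by simp
qed simp

lemma smooths_dif:
  assumes "cont f" "g \<in> carrier K" "x \<in> carrier K"
  shows "smooths m (dif g f) x = dif g (smooths m f) x"
  using assms(3)
proof (induction m arbitrary: x)
  case (Suc m)
  have "smooth (smooths m (dif g f)) x = smooth (dif g (smooths m f)) x"
    using Suc.IH by (rule smooth_cong)
  also have "\<dots> = dif g (smooth (smooths m f)) x"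
    using conv_dif[OF cont_smooths[OF assms(1)] assms(2) Suc.prems]
    by (simp add: smooth_def dif_def right_diff_distrib)
  finally show ?case by simp
qed simp

lemma smooth_selfadjoint:
  assumes "cont f" "cont h"
  shows "ip (smooth f) h = ip f (smooth h)"
  using conv_selfadjoint[OF assms] ip_scale_left[OF cont_conv[OF assms(1)] assms(2), of "1 / rho"]
    ip_scale_left[OF cont_conv[OF assms(2)] assms(1), of "1 / rho"]
  by (simp add: smooth_def[abs_def] ip_commute[of f])

lemma smooths_selfadjoint:
  "cont f \<Longrightarrow> cont h \<Longrightarrow> ip (smooths m f) h = ip f (smooths m h)"
proof (induction m arbitrary: h)
  case (Suc m)
  have "cont (smooth h)" using cont_smooths[of h 1] Suc.prems by simp
  then have "ip (smooths (Suc m) f) h = ip f (smooths m (smooth h))"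
    using smooth_selfadjoint[OF cont_smooths] Suc by simp
  then show ?case by (simp add: funpow_swap1)
qed simp

lemma nrm_smooths_square:
  assumes f: "f \<in> W" "nrm f \<le> 1"
  shows "(nrm (smooths m f))\<^sup>2 \<le> nrm (smooths (2 * m) f)"
proof -
  have fc: "cont f" and c: "cont (smooths k f)" for k using f by (auto intro: W_cont cont_smooths)
  have "(nrm (smooths m f))\<^sup>2 = ip f (smooths (2 * m) f)"
    using nrm_square[OF c[of m]] smooths_selfadjoint[OF fc c, of m m] by (simp add: mult_2 funpow_add)
  also have "\<dots> \<le> nrm f * nrm (smooths (2 * m) f)" using Cauchy_Schwarz[OF fc c[of "2*m"]] by linarith
  also have "\<dots> \<le> nrm (smooths (2 * m) f)" using f(2) nrm_nonneg[OF c] by (simp add: mult_left_le_one_le nrm_nonneg fc)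
  finally show ?thesis .
qed

text \<open>
  For the self-adjoint operator \<open>smooth\<close> of norm \<open>1\<close> one has \<open>\<parallel>T\<^sup>m f\<parallel>\<^sup>2 = \<langle>f, T\<^sup>2\<^sup>m f\<rangle> \<le> \<parallel>T\<^sup>2\<^sup>m f\<parallel>\<close>,
  so an almost maximal vector for \<open>T\<close> keeps norm at least \<open>1/2\<close> under any prescribed power of \<open>T\<close>.
\<close>

lemma smooths_large: "\<exists>f\<in>W. nrm f \<le> 1 \<and> nrm (smooths m f) \<ge> 1 / 2"
proof -
  \<comment> \<open>chosen so that squaring \<open>m\<close> times still leaves \<open>1/2\<close>\<close>
  define t where "t = root (2 ^ m) (1 / 2)"
  have t: "0 < t" "t < 1" "t ^ (2 ^ m) = 1 / 2" by (simp_all add: t_def)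
  let ?A = "{nrm (conv f) | f. f \<in> W \<and> nrm f \<le> 1}"
  have "t * rho < Sup ?A" using t rho_pos by (simp add: rho_def[symmetric])
  moreover have "?A \<noteq> {}"
  proof -
    have "(\<lambda>x. 0 * dif z \<phi> x) \<in> W" by (rule W_scale[OF dif_kernel_W])
    moreover have "nrm (\<lambda>x. 0 * dif z \<phi> x) \<le> 1" using nrm_scale[OF cont_dif[OF cont_kernel z], of 0] by simp
    ultimately show ?thesis by blast
  qed
  ultimately obtain f where f: "f \<in> W" "nrm f \<le> 1" "t * rho < nrm (conv f)"
    using less_cSup_iff[OF _ rho_bdd] by auto
  have c: "cont (smooths k f)" for k using W_cont[OF f(1)] by (rule cont_smooths)
  have 1: "t \<le> nrm (smooth f)"
    unfolding nrm_smooth[OF W_cont[OF f(1)]] using f(3) rho_pos by (simp add: pos_le_divide_eq)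
  have "t ^ (2 ^ k) \<le> nrm (smooths (2 ^ k) f)" for k
  proof (induction k)
    case 0
    then show ?case using 1 by simp
  next
    case (Suc k)
    have "t ^ (2 ^ Suc k) = (t ^ (2 ^ k))\<^sup>2" by (simp add: power_mult[symmetric] mult.commute)
    also have "\<dots> \<le> (nrm (smooths (2 ^ k) f))\<^sup>2" using Suc t by (intro power_mono) auto
    also have "\<dots> \<le> nrm (smooths (2 ^ Suc k) f)" using nrm_smooths_square[OF f(1,2), of "2 ^ k"] by simp
    finally show ?case .
  qed
  from this[of m] have half: "1 / 2 \<le> nrm (smooths (2 ^ m) f)" using t by simp
  have "m \<le> 2 ^ m" by (rule less_imp_le) (rule less_exp)
  then have "smooths (2 ^ m) f = smooths (2 ^ m - m) (smooths m f)"
    by (metis add.commute comp_apply funpow_add le_add_diff_inverse)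
  then have "nrm (smooths (2 ^ m) f) \<le> nrm (smooths m f)"
    using nrm_smooths_le[OF W_smooths[OF f(1)]] by simp
  then show ?thesis using half f by (intro bexI[of _ f]) auto
qed

end


section \<open>Lengths that contract commutators\<close>

context separating_convolution
begin

definition moves :: "nat \<Rightarrow> 'a \<Rightarrow> real \<Rightarrow> bool" where
  "moves m g t \<longleftrightarrow> (\<forall>f\<in>W. nrm (dif g (smooths m f)) \<le> t * nrm f)"

lemma nrm_dif_cong:
  assumes "\<And>x. x \<in> carrier K \<Longrightarrow> f x = h x" "g \<in> carrier K"
  shows "nrm (dif g f) = nrm (dif g h)"
  using assms by (intro nrm_cong) (simp add: dif_def)

lemma W_nrm_nonneg: "f \<in> W \<Longrightarrow> 0 \<le> nrm f"
  by (simp add: W_cont nrm_nonneg)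

lemma moves_mono:
  assumes m: "moves m g t" and mn: "m \<le> n" and t: "0 \<le> t"
  shows "moves n g t"
  unfolding moves_def
proof
  fix f assume f: "f \<in> W"
  have "smooths n f = smooths m (smooths (n - m) f)"
    using mn by (metis comp_apply funpow_add le_add_diff_inverse)
  then have "nrm (dif g (smooths n f)) \<le> t * nrm (smooths (n - m) f)"
    using m W_smooths[OF f] by (simp add: moves_def)
  also have "\<dots> \<le> t * nrm f" using nrm_smooths_le[OF f] t by (intro mult_left_mono)
  finally show "nrm (dif g (smooths n f)) \<le> t * nrm f" .
qed

lemma moves_two: "g \<in> carrier K \<Longrightarrow> moves 0 g 2"
  unfolding moves_def using nrm_dif_le[OF W_cont] by simp

lemma moves_mult:
  assumes "moves m g s" "moves m h t" and g: "g \<in> carrier K" and h: "h \<in> carrier K"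
  shows "moves m (g \<otimes> h) (s + t)"
  unfolding moves_def
proof
  fix f assume f: "f \<in> W"
  have "nrm (dif (g \<otimes> h) (smooths m f)) \<le> nrm (dif g (smooths m f)) + nrm (dif h (smooths m f))"
    using g h by (intro nrm_dif_mult cont_smooths W_cont f)
  then show "nrm (dif (g \<otimes> h) (smooths m f)) \<le> (s + t) * nrm f"
    using assms(1,2) f by (force simp: moves_def distrib_right)
qed

lemma moves_inv: "moves m g t \<Longrightarrow> g \<in> carrier K \<Longrightarrow> moves m (inv g) t"
  unfolding moves_def by (simp add: nrm_dif_inv cont_smooths W_cont)

lemma moves_conj:
  assumes m: "moves m g t" and g: "g \<in> carrier K" and k: "k \<in> carrier K"
  shows "moves m (k \<otimes> g \<otimes> inv k) t"
  unfolding moves_def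
proof
  fix f assume f: "f \<in> W"
  have "nrm (dif (k \<otimes> g \<otimes> inv k) (smooths m f)) = nrm (dif g (rtrans (inv k) (smooths m f)))"
    using g k by (intro nrm_dif_conj cont_smooths W_cont f)
  also have "\<dots> = nrm (dif g (smooths m (rtrans (inv k) f)))"
    using g k f by (intro nrm_dif_cong) (auto simp: smooths_rtrans W_cont)
  also have "\<dots> \<le> t * nrm (rtrans (inv k) f)"
    using m W_rtrans[OF f, of "inv k"] k by (simp add: moves_def)
  finally show "nrm (dif (k \<otimes> g \<otimes> inv k) (smooths m f)) \<le> t * nrm f"
    using k f by (simp add: nrm_rtrans W_cont)
qed

lemma nrm_dif_dif_smooths:
  assumes "moves m g s" "moves n h t" and g: "g \<in> carrier K" and h: "h \<in> carrier K"
    and f: "f \<in> W" and s: "0 \<le> s"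
  shows "nrm (dif g (dif h (smooths (m + n) f))) \<le> s * t * nrm f"
proof -
  have n: "dif h (smooths n f) \<in> W" using f h by (intro W_dif W_smooths)
  have "nrm (dif g (dif h (smooths (m + n) f))) = nrm (dif g (smooths m (dif h (smooths n f))))"
    using smooths_dif[OF cont_smooths[OF W_cont[OF f]] h, of _ m n] g
    by (intro nrm_dif_cong) (simp_all add: funpow_add)
  also have "\<dots> \<le> s * nrm (dif h (smooths n f))" using assms(1) n by (simp add: moves_def)
  also have "\<dots> \<le> s * (t * nrm f)" using assms(2) f s by (intro mult_left_mono) (simp_all add: moves_def)
  finally show ?thesis by simp
qed

text \<open>
  The \<open>m + n\<close> smoothing steps are shared out between the two differences, which is possible since
  smoothing commutes with translations. The identity of \<open>nrm_dif_commutator\<close> then multiplies the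
  two bounds.
\<close>

lemma moves_commutator:
  assumes "moves m g s" "moves n h t" and g: "g \<in> carrier K" and h: "h \<in> carrier K"
    and s: "0 \<le> s" and t: "0 \<le> t"
  shows "moves (m + n) (g \<otimes> h \<otimes> inv g \<otimes> inv h) (2 * s * t)"
  unfolding moves_def
proof
  fix f assume f: "f \<in> W"
  define k where "k = inv g \<otimes> inv h"
  have k: "k \<in> carrier K" using g h by (simp add: k_def)
  define f' where "f' = rtrans k f"
  have f': "f' \<in> W" "nrm f' = nrm f" using f k by (simp_all add: f'_def W_rtrans nrm_rtrans W_cont)
  have F: "rtrans k (smooths (m + n) f) x = smooths (m + n) f' x" if "x \<in> carrier K" for x
    using smooths_rtrans[OF W_cont[OF f] k that] by (simp add: f'_def)
  have "nrm (dif (g \<otimes> h \<otimes> inv g \<otimes> inv h) (smooths (m + n) f))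
      \<le> nrm (dif g (dif h (rtrans k (smooths (m + n) f)))) + nrm (dif h (dif g (rtrans k (smooths (m + n) f))))"
    unfolding k_def using g h by (intro nrm_dif_commutator cont_smooths W_cont f)
  also have "\<dots> = nrm (dif g (dif h (smooths (m + n) f'))) + nrm (dif h (dif g (smooths (m + n) f')))"
    using F g h by (intro arg_cong2[of _ _ _ _ "(+)"] nrm_dif_cong) (auto simp: dif_def)
  also have "\<dots> \<le> s * t * nrm f' + t * s * nrm f'"
    using nrm_dif_dif_smooths[OF assms(1,2) g h f'(1) s] nrm_dif_dif_smooths[OF assms(2,1) h g f'(1) t]
    unfolding add.commute[of n m] by (rule add_mono)
  finally show "nrm (dif (g \<otimes> h \<otimes> inv g \<otimes> inv h) (smooths (m + n) f)) \<le> 2 * s * t * nrm f"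
    by (simp add: f'(2))
qed

lemma moves_small:
  assumes e: "\<epsilon> > 0"
  obtains V where "openin S V" "\<one> \<in> V" "\<And>g. g \<in> V \<Longrightarrow> moves 1 g \<epsilon>"
proof -
  have "rho * \<epsilon> > 0" using e rho_pos by simp
  then obtain V where V: "openin S V" "\<one> \<in> V"
    "\<And>g f. g \<in> V \<Longrightarrow> cont f \<Longrightarrow> nrm (dif g (conv f)) \<le> rho * \<epsilon> * nrm f"
    by (rule conv_equicontinuous) (rule that)
  have "moves 1 g \<epsilon>" if g: "g \<in> V" for g
    unfolding moves_def
  proof
    fix f assume f: "f \<in> W"
    have gK: "g \<in> carrier K" using g openin_subset[OF V(1)] by auto
    have "dif g (smooths 1 f) = (\<lambda>x. (1 / rho) * dif g (conv f) x)"
      by (simp add: dif_def[abs_def] smooth_def[abs_def] diff_divide_distrib)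
    then have "nrm (dif g (smooths 1 f)) = (1 / rho) * nrm (dif g (conv f))"
      using nrm_scale[OF cont_dif[OF cont_conv[OF W_cont[OF f]] gK], of "1 / rho"] rho_pos by simp
    then show "nrm (dif g (smooths 1 f)) \<le> \<epsilon> * nrm f"
      using V(3)[OF g W_cont[OF f]] rho_pos by (simp add: pos_divide_le_eq mult_ac)
  qed
  with V(1,2) show ?thesis by (rule that)
qed

text \<open>
  A Dini argument: the bounds improve monotonically with \<open>m\<close> and are equicontinuous in the group
  element, so on a subset of a compact group pointwise smallness becomes uniform.
\<close>

lemma moves_uniform:
  assumes N: "N \<subseteq> carrier K" "\<And>n t. n \<in> N \<Longrightarrow> 0 < t \<Longrightarrow> \<exists>m. moves m n t" and e: "\<epsilon> > 0"
  shows "\<exists>m. \<forall>n\<in>N. moves m n \<epsilon>"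
proof -
  obtain V where V: "openin S V" "\<one> \<in> V" "\<And>g. g \<in> V \<Longrightarrow> moves 1 g (\<epsilon> / 4)"
    by (rule moves_small[of "\<epsilon> / 4"]) (use e that in auto)
  obtain F where F: "finite F" "F \<subseteq> carrier K" "\<And>x. x \<in> carrier K \<Longrightarrow> \<exists>k\<in>F. x \<otimes> inv k \<in> V"
    by (rule finite_translates_cover[OF V(1,2)]) (rule that)
  define r where "r k = (SOME n. n \<in> N \<and> n \<otimes> inv k \<in> V)" for k
  define M where "M n = (SOME m. moves m n (\<epsilon> / 2))" for n
  define m where "m = Max (insert 1 ((\<lambda>k. M (r k)) ` F))"
  have mF: "1 \<le> m" "\<And>k. k \<in> F \<Longrightarrow> M (r k) \<le> m" using F(1) by (auto simp: m_def)
  have "moves m n \<epsilon>" if n: "n \<in> N" for n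
  proof -
    have nK: "n \<in> carrier K" using n N(1) by auto
    then obtain k where k: "k \<in> F" "n \<otimes> inv k \<in> V" using F(3) by blast
    then have kK: "k \<in> carrier K" using F(2) by auto
    have "r k \<in> N \<and> r k \<otimes> inv k \<in> V" unfolding r_def by (rule someI[of _ n]) (use n k in simp)
    then have rk: "r k \<in> N" "r k \<otimes> inv k \<in> V" by auto
    then have rK: "r k \<in> carrier K" using N(1) by auto
    have "moves (M (r k)) (r k) (\<epsilon> / 2)"
      unfolding M_def by (rule someI_ex) (use N(2)[OF rk(1), of "\<epsilon> / 2"] e in simp)
    then have 1: "moves m (r k) (\<epsilon> / 2)" by (rule moves_mono) (use mF k e in auto)
    have 2: "moves m (n \<otimes> inv k) (\<epsilon> / 4)" by (rule moves_mono[OF V(3)[OF k(2)]]) (use mF e in auto)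
    have 3: "moves m (inv (r k \<otimes> inv k)) (\<epsilon> / 4)"
      by (rule moves_inv[OF moves_mono[OF V(3)[OF rk(2)]]]) (use mF e rK kK in auto)
    have "moves m ((n \<otimes> inv k) \<otimes> inv (r k \<otimes> inv k) \<otimes> r k) (\<epsilon> / 4 + \<epsilon> / 4 + \<epsilon> / 2)"
      using nK kK rK by (intro moves_mult 1 2 3) auto
    moreover have "(n \<otimes> inv k) \<otimes> inv (r k \<otimes> inv k) \<otimes> r k = n"
      using nK kK rK by (simp add: inv_mult_group m_assoc cancel_left)
    ultimately show ?thesis by simp
  qed
  then show ?thesis by blast
qed

text \<open>
  Averages of \<open>w\<close> over \<open>N\<close> whose norm approaches the infimum of all such norms are almost
  fixed by \<open>N\<close>: the midpoint of an average and its translate is again an average, so by the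
  parallelogram law an average of almost minimal norm is close to its translate.
\<close>

lemma ravg_almost_fixed:
  assumes w: "cont w"
    and N: "N \<subseteq> carrier K" "\<one> \<in> N" "\<And>a b. a \<in> N \<Longrightarrow> b \<in> N \<Longrightarrow> a \<otimes> b \<in> N"
  obtains L B where "\<And>i::nat. translates (L i)" "\<And>i. set (L i) \<subseteq> N" "\<And>i. nrm (ravg (L i) w) \<le> B"
    "\<And>n. n \<in> N \<Longrightarrow> (\<lambda>i. nrm (dif n (ravg (L i) w))) \<longlonglongrightarrow> 0"
proof -
  let ?A = "{nrm (ravg L w) | L. translates L \<and> set L \<subseteq> N}"
  define \<beta> where "\<beta> = Inf ?A"
  have bdd: "bdd_below ?A" using w by (intro bdd_belowI[of _ 0]) (auto simp: nrm_nonneg cont_ravg)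
  have "nrm (ravg [\<one>] w) \<in> ?A" using N by (auto simp: translates_def intro!: exI[of _ "[\<one>]"])
  then have ne: "?A \<noteq> {}" by blast
  have "\<beta> \<ge> 0" unfolding \<beta>_def using ne w by (intro cInf_greatest) (auto simp: nrm_nonneg cont_ravg)
  have "\<exists>L. translates L \<and> set L \<subseteq> N \<and> nrm (ravg L w) < \<beta> + 1 / Suc i" for i :: nat
  proof -
    have "Inf ?A < \<beta> + 1 / Suc i" by (simp add: \<beta>_def[symmetric])
    then show ?thesis using cInf_less_iff[OF ne bdd] by auto
  qed
  then obtain L where L: "\<And>i. translates (L i)" "\<And>i. set (L i) \<subseteq> N"
    "\<And>i::nat. nrm (ravg (L i) w) < \<beta> + 1 / Suc i" by metis
  have "nrm (ravg (L i) w) \<le> \<beta> + 1" for i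
  proof -
    have "1 / real (Suc i) \<le> 1" by simp
    then show ?thesis using L(3)[of i] by linarith
  qed
  moreover have "(\<lambda>i. nrm (dif n (ravg (L i) w))) \<longlonglongrightarrow> 0" if n: "n \<in> N" for n
  proof -
    have nK: "n \<in> carrier K" using n N(1) by auto
    define c where "c i = 4 * ((\<beta> + 1 / real (Suc i))\<^sup>2 - \<beta>\<^sup>2)" for i
    have le: "nrm (dif n (ravg (L i) w)) \<le> sqrt (c i)" for i
    proof -
      define v where "v = ravg (L i) w"
      define u where "u = rtrans n v"
      have v: "cont v" and u: "cont u" using w L nK by (simp_all add: v_def u_def cont_ravg cont_rtrans)
      have nu: "ip u u = ip v v" using v nK by (simp add: u_def ip_rtrans)
      \<comment> \<open>averaging over this list yields the midpoint of \<open>v\<close> and its translate \<open>u\<close>\<close>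
      define L' where "L' = L i @ map ((\<otimes>) n) (L i)"
      have L': "translates L'" "set L' \<subseteq> N"
        using L(1,2)[of i] n N nK by (auto simp: L'_def translates_def)
      have eq: "ravg L' w x = (1 / 2) * (v x + u x)" if x: "x \<in> carrier K" for x
      proof -
        have "(\<Sum>l\<leftarrow>L i. w (x \<otimes> (n \<otimes> l))) = (\<Sum>l\<leftarrow>L i. w (x \<otimes> n \<otimes> l))"
          using x nK L(1)[of i]
          by (intro arg_cong[of _ _ sum_list] map_cong refl) (auto simp: translates_def m_assoc subset_iff)
        moreover have "real (length (L i)) > 0" using L(1)[of i] by (simp add: translates_def)
        ultimately show ?thesis by (simp add: ravg_def L'_def v_def u_def rtrans_def o_def add_divide_distrib)
      qed
      have "\<beta> \<le> nrm (ravg L' w)" unfolding \<beta>_def using L' bdd by (intro cInf_lower) auto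
      also have "\<dots> = nrm (\<lambda>x. (1 / 2) * (v x + u x))" using eq by (rule nrm_cong)
      also have "\<dots> = (1 / 2) * nrm (\<lambda>x. v x + u x)"
        using nrm_scale[OF continuous_map_add[OF v u], of "1 / 2"] by simp
      finally have "2 * \<beta> \<le> nrm (\<lambda>x. v x + u x)" by simp
      then have "(2 * \<beta>)\<^sup>2 \<le> (nrm (\<lambda>x. v x + u x))\<^sup>2" using \<open>\<beta> \<ge> 0\<close> by (intro power_mono) auto
      also have "\<dots> = 2 * ip v v + 2 * ip u v"
        using ip_square_expand[OF u v, of "-1"] u v
        by (simp add: nrm_square continuous_map_add nu add.commute[of "v _"])
      finally have low: "4 * \<beta>\<^sup>2 \<le> 2 * ip v v + 2 * ip u v" by (simp add: power_mult_distrib)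
      have "(nrm (dif n v))\<^sup>2 = ip (\<lambda>x. u x - v x) (\<lambda>x. u x - v x)"
        using v nK by (simp add: nrm_square cont_dif) (simp add: dif_def[abs_def] u_def rtrans_def)
      also have "\<dots> = 2 * ip v v - 2 * ip u v" using ip_square_expand[OF u v, of 1] nu by simp
      also have "\<dots> \<le> 4 * ((nrm v)\<^sup>2 - \<beta>\<^sup>2)" using low nrm_square[OF v] by (simp add: algebra_simps)
      also have "\<dots> \<le> c i"
        unfolding c_def using L(3)[of i] nrm_nonneg[OF v] by (auto simp: v_def intro!: power_mono)
      finally have "sqrt ((nrm (dif n v))\<^sup>2) \<le> sqrt (c i)" by (rule real_sqrt_le_mono)
      then show ?thesis using nrm_nonneg[OF cont_dif[OF v nK]] by (simp add: v_def)
    qed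
    have "(\<lambda>i. 1 / real (Suc i)) \<longlonglongrightarrow> 0" using LIMSEQ_inverse_real_of_nat by (simp add: inverse_eq_divide)
    then have "(\<lambda>i. sqrt (c i)) \<longlonglongrightarrow> sqrt (4 * ((\<beta> + 0)\<^sup>2 - \<beta>\<^sup>2))"
      unfolding c_def by (intro tendsto_intros)
    then have lim: "(\<lambda>i. sqrt (c i)) \<longlonglongrightarrow> 0" by simp
    have nonneg: "0 \<le> nrm (dif n (ravg (L i) w))" for i
      by (rule nrm_nonneg[OF cont_dif[OF cont_ravg[OF w L(1)] nK]])
    show ?thesis
      by (rule Lim_null_comparison[OF _ lim]) (use le nonneg in simp)
  qed
  ultimately show ?thesis using L(1,2) by (intro that[of L "\<beta> + 1"])
qed

text \<open>
  Otherwise all elements of the normal subgroup \<open>N\<close> of vanishing length, which contains \<open>z\<close>,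
  uniformly move some \<open>w \<in> W\<close> of norm at least \<open>1/2\<close> by at most \<open>1/4\<close>. Then every average of \<open>w\<close>
  over \<open>N\<close> has inner product at least \<open>1/8\<close> with \<open>w\<close>. But there are almost fixed averages, and \<open>W\<close> is
  asymptotically orthogonal to them.
\<close>

lemma moves_separating: "\<exists>t>0. \<forall>m. \<not> moves m z t"
proof (rule ccontr)
  assume "\<not> ?thesis"
  then have small: "\<exists>m. moves m z t" if "t > 0" for t using that by blast
  define N where "N = {n \<in> carrier K. \<forall>t>0. \<exists>m. moves m n t}"
  have NK: "N \<subseteq> carrier K" by (auto simp: N_def)
  have N_mult: "a \<otimes> b \<in> N" if "a \<in> N" "b \<in> N" for a b
  proof -
    have ab: "a \<in> carrier K" "b \<in> carrier K" using that by (auto simp: N_def)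
    have "\<exists>m. moves m (a \<otimes> b) t" if t: "t > 0" for t
    proof -
      have "\<exists>m. moves m a (t / 2)" "\<exists>m. moves m b (t / 2)"
        using \<open>a \<in> N\<close> \<open>b \<in> N\<close> t by (auto simp: N_def)
      then obtain m n where "moves m a (t / 2)" "moves n b (t / 2)" by blast
      then have "moves (max m n) a (t / 2)" "moves (max m n) b (t / 2)"
        using t by (auto elim: moves_mono)
      from moves_mult[OF this ab] show ?thesis by auto
    qed
    then show ?thesis using ab by (simp add: N_def)
  qed
  have zc: "g \<otimes> z \<otimes> inv g \<in> N" if "g \<in> carrier K" for g
    using small moves_conj[OF _ z that] that z unfolding N_def by simp blast
  have "\<one> \<in> N"
  proof -
    have "moves 0 \<one> 0" unfolding moves_def
    proof
      fix f assume f: "f \<in> W"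
      have "nrm (dif \<one> f) = nrm (\<lambda>x. 0 * f x)" by (intro nrm_cong) (simp add: dif_def)
      then show "nrm (dif \<one> (smooths 0 f)) \<le> 0 * nrm f" using nrm_scale[OF W_cont[OF f], of 0] by simp
    qed
    then have "moves 0 \<one> t" if "t > 0" for t
      using that unfolding moves_def by (auto intro: order_trans simp: W_nrm_nonneg)
    then show ?thesis by (auto simp: N_def)
  qed
  obtain m where m: "\<forall>n\<in>N. moves m n (1 / 4)"
    using moves_uniform[OF NK, of "1 / 4"] by (auto simp: N_def)
  obtain f where f: "f \<in> W" "nrm f \<le> 1" "nrm (smooths m f) \<ge> 1 / 2" using smooths_large by blast
  define w where "w = smooths m f"
  have w: "w \<in> W" "cont w" "nrm w \<ge> 1 / 2" using f by (auto simp: w_def W_smooths W_cont)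
  have wN: "nrm (dif n w) \<le> 1 / 4" if "n \<in> N" for n
    using m that f unfolding w_def moves_def by force
  obtain L B where L: "\<And>i::nat. translates (L i)" "\<And>i. set (L i) \<subseteq> N" "\<And>i. nrm (ravg (L i) w) \<le> B"
    "\<And>n. n \<in> N \<Longrightarrow> (\<lambda>i. nrm (dif n (ravg (L i) w))) \<longlonglongrightarrow> 0"
    by (rule ravg_almost_fixed[OF w(2) NK \<open>\<one> \<in> N\<close>]) (erule N_mult, assumption, rule that)
  have "almost_fixed (\<lambda>i. ravg (L i) w)"
    unfolding almost_fixed_def
  proof (intro conjI ballI exI allI)
    show "cont (ravg (L i) w)" for i by (rule cont_ravg[OF w(2) L(1)])
  qed (use L(3,4) zc in auto)
  then have "(\<lambda>i. ip w (ravg (L i) w)) \<longlonglongrightarrow> 0" using w(1) by (simp add: W_def)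
  moreover have "1 / 8 \<le> ip w (ravg (L i) w)" for i
  proof -
    have lK: "l \<in> carrier K" if "l \<in> set (L i)" for l using that L(2) NK by blast
    have each: "1 / 8 \<le> mean (\<lambda>x. w x * w (x \<otimes> l))" if l: "l \<in> set (L i)" for l
    proof -
      have "mean (\<lambda>x. w x * w (x \<otimes> l)) = ip (rtrans l w) w"
        by (simp add: ip_def rtrans_def mult.commute)
      also have "\<dots> = ip w w + ip (dif l w) w"
        using ip_diff_left[OF cont_rtrans[OF w(2) lK[OF l]] w(2) w(2)]
        by (simp add: dif_def[abs_def] rtrans_def)
      also have "\<dots> \<ge> nrm w * nrm w - nrm (dif l w) * nrm w"
        using Cauchy_Schwarz[OF cont_dif[OF w(2) lK[OF l]] w(2)] nrm_square[OF w(2)]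
        by (simp add: power2_eq_square)
      moreover have "nrm (dif l w) * nrm w \<le> 1 / 4 * nrm w"
        using wN l L(2)[of i] w(3) by (intro mult_right_mono) auto
      moreover have "1 / 2 * (1 / 4) \<le> nrm w * (nrm w - 1 / 4)"
        using w(3) by (intro mult_mono) auto
      ultimately show ?thesis by (simp add: algebra_simps)
    qed
    have c: "cont (\<lambda>x. w x * w (x \<otimes> l))" if "l \<in> set (L i)" for l
      using cont_rtrans[OF w(2) lK[OF that]] w(2) by (simp add: rtrans_def[abs_def] continuous_map_real_mult)
    have "ip w (ravg (L i) w) = mean (\<lambda>x. (1 / length (L i)) * (\<Sum>l\<leftarrow>L i. w x * w (x \<otimes> l)))"
      by (simp add: ip_def ravg_def sum_list_const_mult)
    also have "\<dots> = (\<Sum>l\<leftarrow>L i. mean (\<lambda>x. w x * w (x \<otimes> l))) / length (L i)"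
      using mean_scale[OF mean_sum_list(1)[OF c], of "L i" "\<lambda>l. l" "1 / length (L i)"]
        mean_sum_list(2)[of "L i" "\<lambda>l x. w x * w (x \<otimes> l)", OF c] by simp
    finally show ?thesis using average_ge[of "L i" "1 / 8", OF _ each] L(1)[of i] by (simp add: translates_def)
  qed
  ultimately have "1 / 8 \<le> (0::real)" by (intro tendsto_lowerbound[OF _ always_eventually]) auto
  then show False by simp
qed

text \<open>
  The bound in \<open>moves\<close> is inherited by larger \<open>m\<close>, so this infimum is the limit of the operator norms
  of \<open>(g - 1) T\<^sup>m\<close> on \<open>W\<close>.
\<close>

definition len :: "'a \<Rightarrow> real" where
  "len g = Inf {t. 0 \<le> t \<and> (\<exists>m. moves m g t)}"

lemma len_le: "moves m g t \<Longrightarrow> 0 \<le> t \<Longrightarrow> len g \<le> t"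
  unfolding len_def by (intro cInf_lower bdd_belowI[of _ 0]) auto

lemma len_nonneg: "g \<in> carrier K \<Longrightarrow> 0 \<le> len g"
  unfolding len_def using moves_two[of g] by (intro cInf_greatest) (auto intro!: exI[of _ "2::real"])

lemma len_moves:
  assumes "g \<in> carrier K" "len g < t"
  obtains m where "moves m g t"
proof -
  have "{t. 0 \<le> t \<and> (\<exists>m. moves m g t)} \<noteq> {}" using moves_two[OF assms(1)] by force
  from cInf_lessD[OF this] assms(2)
  have "\<exists>s\<in>{t. 0 \<le> t \<and> (\<exists>m. moves m g t)}. s < t" unfolding len_def by simp
  then obtain s m where s: "0 \<le> s" "moves m g s" "s < t" by blast
  have "moves m g t" unfolding moves_def
  proof
    fix f assume f: "f \<in> W"
    have "s * nrm f \<le> t * nrm f" using s W_nrm_nonneg[OF f] by (intro mult_right_mono) auto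
    then show "nrm (dif g (smooths m f)) \<le> t * nrm f" using s f by (force simp: moves_def)
  qed
  then show ?thesis by (rule that)
qed

lemma len_mult:
  assumes g: "g \<in> carrier K" and h: "h \<in> carrier K"
  shows "len (g \<otimes> h) \<le> len g + len h"
proof (rule field_le_epsilon)
  fix e :: real assume e: "e > 0"
  obtain m where m: "moves m g (len g + e / 2)" by (rule len_moves[OF g, of "len g + e / 2"]) (use e that in auto)
  obtain n where n: "moves n h (len h + e / 2)" by (rule len_moves[OF h, of "len h + e / 2"]) (use e that in auto)
  have "moves (max m n) g (len g + e / 2)" "moves (max m n) h (len h + e / 2)"
    using moves_mono[OF m, of "max m n"] moves_mono[OF n, of "max m n"] e len_nonneg g h by auto
  from len_le[OF moves_mult[OF this g h]] show "len (g \<otimes> h) \<le> len g + len h + e"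
    using e len_nonneg[OF g] len_nonneg[OF h] by simp
qed

lemma len_inv:
  assumes g: "g \<in> carrier K"
  shows "len (inv g) \<le> len g"
proof (rule field_le_epsilon)
  fix e :: real assume e: "e > 0"
  obtain m where m: "moves m g (len g + e)" by (rule len_moves[OF g, of "len g + e"]) (use e that in auto)
  show "len (inv g) \<le> len g + e" using e len_nonneg[OF g] by (intro len_le[OF moves_inv[OF m g]]) simp
qed

lemma len_conj:
  assumes g: "g \<in> carrier K" and k: "k \<in> carrier K"
  shows "len (k \<otimes> g \<otimes> inv k) \<le> len g"
proof (rule field_le_epsilon)
  fix e :: real assume e: "e > 0"
  obtain m where m: "moves m g (len g + e)" by (rule len_moves[OF g, of "len g + e"]) (use e that in auto)
  show "len (k \<otimes> g \<otimes> inv k) \<le> len g + e"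
    using e len_nonneg[OF g] by (intro len_le[OF moves_conj[OF m g k]]) simp
qed

lemma len_commutator:
  assumes g: "g \<in> carrier K" and h: "h \<in> carrier K"
  shows "len (g \<otimes> h \<otimes> inv g \<otimes> inv h) \<le> 2 * len g * len h"
proof (rule tendsto_lowerbound)
  show "((\<lambda>e. 2 * (len g + e) * (len h + e)) \<longlongrightarrow> 2 * len g * len h) (at_right 0)"
    by (auto intro!: tendsto_eq_intros)
  show "\<forall>\<^sub>F e in at_right 0. len (g \<otimes> h \<otimes> inv g \<otimes> inv h) \<le> 2 * (len g + e) * (len h + e)"
    unfolding eventually_at_right_field
  proof (intro exI[of _ 1] conjI allI impI)
    fix e :: real assume e: "0 < e"
    obtain m where m: "moves m g (len g + e)" by (rule len_moves[OF g, of "len g + e"]) (use e that in auto)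
    obtain n where n: "moves n h (len h + e)" by (rule len_moves[OF h, of "len h + e"]) (use e that in auto)
    show "len (g \<otimes> h \<otimes> inv g \<otimes> inv h) \<le> 2 * (len g + e) * (len h + e)"
      using e len_nonneg[OF g] len_nonneg[OF h] by (intro len_le[OF moves_commutator[OF m n g h]]) auto
  qed simp
qed simp

lemma len_separating: "len z > 0"
proof -
  obtain t where t: "t > 0" "\<forall>m. \<not> moves m z t" using moves_separating by blast
  then have "\<not> len z < t" using len_moves[OF z] by metis
  then show ?thesis using t(1) by linarith
qed

end

text \<open>
  The model is the operator norm distance from the identity in a unitary representation. Continuity
  at \<open>1\<close> together with subadditivity gives continuity everywhere.
\<close>

definition commutator_length :: "('k, 'n) monoid_scheme \<Rightarrow> 'k topology \<Rightarrow> ('k \<Rightarrow> real) \<Rightarrow> bool" where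
  "commutator_length K S \<nu> \<longleftrightarrow>
     (\<forall>g\<in>carrier K. 0 \<le> \<nu> g \<and> \<nu> g \<le> 2 \<and> \<nu> (inv\<^bsub>K\<^esub> g) \<le> \<nu> g) \<and>
     (\<forall>g\<in>carrier K. \<forall>h\<in>carrier K. \<nu> (g \<otimes>\<^bsub>K\<^esub> h) \<le> \<nu> g + \<nu> h \<and>
        \<nu> (h \<otimes>\<^bsub>K\<^esub> g \<otimes>\<^bsub>K\<^esub> inv\<^bsub>K\<^esub> h) \<le> \<nu> g \<and>
        \<nu> (g \<otimes>\<^bsub>K\<^esub> h \<otimes>\<^bsub>K\<^esub> inv\<^bsub>K\<^esub> g \<otimes>\<^bsub>K\<^esub> inv\<^bsub>K\<^esub> h) \<le> 2 * \<nu> g * \<nu> h) \<and>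
     (\<forall>\<epsilon>>0. \<exists>V. openin S V \<and> \<one>\<^bsub>K\<^esub> \<in> V \<and> (\<forall>g\<in>V. \<nu> g \<le> \<epsilon>))"

text \<open>
  This replaces the Peter-Weyl theorem. By compactness, each neighbourhood of \<open>1\<close> contains all
  elements on which finitely many such lengths are sufficiently small.
\<close>

theorem (in compact_group) separating_commutator_length:
  assumes U: "openin S U" "\<one> \<in> U" and z: "z \<in> carrier K" "z \<notin> U"
  obtains \<nu> where "commutator_length K S \<nu>" "\<nu> z > 0"
proof -
  obtain \<phi> :: "'k \<Rightarrow> real" where "continuous_map S euclideanreal \<phi>"
    "\<And>x. x \<in> carrier K \<Longrightarrow> \<phi> (inv x) = \<phi> x" "\<phi> \<one> \<noteq> 0"
    "\<And>y. y \<in> carrier K \<Longrightarrow> \<phi> y * \<phi> (y \<otimes> z) = 0"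
    by (rule symmetric_bump[OF U z]) (rule that)
  then interpret separating_convolution K S \<phi> z
    using z by unfold_locales
  have "\<exists>V. openin S V \<and> \<one> \<in> V \<and> (\<forall>g\<in>V. len g \<le> \<epsilon>)" if e: "\<epsilon> > 0" for \<epsilon>
  proof -
    obtain V where V: "openin S V" "\<one> \<in> V" "\<And>g. g \<in> V \<Longrightarrow> moves 1 g \<epsilon>"
      by (rule moves_small[OF e]) (rule that)
    have "\<forall>g\<in>V. len g \<le> \<epsilon>" using len_le[OF V(3)] e by simp
    with V(1,2) show ?thesis by blast
  qed
  then have "commutator_length K S len"
    unfolding commutator_length_def
    using len_nonneg len_le[OF moves_two] len_mult len_inv len_conj len_commutator by auto
  then show ?thesis using len_separating by (rule that)
qed


section \<open>Words that converge to 1 in every compact group\<close>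

definition flip :: "bool \<times> 'a \<Rightarrow> bool \<times> 'a" where
  "flip l = (\<not> fst l, snd l)"

definition word_inv :: "(bool \<times> 'a) list \<Rightarrow> (bool \<times> 'a) list" where
  "word_inv w = map flip (rev w)"

lemma flip_flip [simp]: "flip (flip l) = l"
  by (simp add: flip_def)

lemma flip_eq_iff: "flip x = flip y \<longleftrightarrow> x = y"
  by (metis flip_flip)

abbreviation reduced :: "(bool \<times> 'a) list \<Rightarrow> bool" where
  "reduced \<equiv> successively (\<lambda>x y. y \<noteq> flip x)"

lemma reduced_words_altdef: "reduced_words S = {w. set w \<subseteq> UNIV \<times> S \<and> reduced w}"
  by (auto simp: reduced_words_def successively_conv_nth flip_def)

lemma reduced_word_inv: "reduced w \<Longrightarrow> reduced (word_inv w)"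
  by (simp add: word_inv_def successively_map flip_eq_iff) (metis (mono_tags, lifting) flip_flip successively_mono)

context group
begin

lemma letter_value_closed: "snd l \<in> carrier G \<Longrightarrow> letter_value G l \<in> carrier G"
  by (cases l) auto

lemma letter_value_flip: "snd l \<in> carrier G \<Longrightarrow> letter_value G (flip l) = inv (letter_value G l)"
  by (cases l) (auto simp: flip_def)

lemma word_value_Nil [simp]: "word_value G [] = \<one>"
  by (simp add: word_value_def)

lemma word_value_Cons [simp]: "word_value G (l # w) = letter_value G l \<otimes> word_value G w"
  by (simp add: word_value_def)

lemma word_value_closed: "set w \<subseteq> UNIV \<times> carrier G \<Longrightarrow> word_value G w \<in> carrier G"
  by (induction w) (auto intro!: letter_value_closed)

lemma word_value_append:
  "set u \<subseteq> UNIV \<times> carrier G \<Longrightarrow> set v \<subseteq> UNIV \<times> carrier G \<Longrightarrow>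
    word_value G (u @ v) = word_value G u \<otimes> word_value G v"
  by (induction u) (auto simp: m_assoc letter_value_closed word_value_closed)

lemma set_word_inv: "set w \<subseteq> UNIV \<times> A \<Longrightarrow> set (word_inv w) \<subseteq> UNIV \<times> A"
  by (auto simp: word_inv_def flip_def)

lemma word_value_inv:
  assumes "set w \<subseteq> UNIV \<times> carrier G"
  shows "word_value G (word_inv w) = inv (word_value G w)"
  using assms
proof (induction w)
  case (Cons l w)
  have l: "snd l \<in> carrier G" using Cons.prems by (cases l) auto
  have w: "set w \<subseteq> UNIV \<times> carrier G" using Cons.prems by auto
  have fl: "set [flip l] \<subseteq> UNIV \<times> carrier G" using l by (auto simp: flip_def)
  have "word_value G (word_inv (l # w)) = word_value G (word_inv w @ [flip l])"
    by (simp add: word_inv_def)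
  also have "\<dots> = inv (word_value G w) \<otimes> inv (letter_value G l)"
    using Cons.IH[OF w] l by (simp add: word_value_append[OF set_word_inv[OF w] fl] letter_value_flip letter_value_closed)
  also have "\<dots> = inv (word_value G (l # w))"
    using l w by (simp add: inv_mult_group letter_value_closed word_value_closed)
  finally show ?case .
qed (simp add: word_inv_def)

end

text \<open>
  The word of \<open>b [g, a h a\<inverse>] b\<inverse>\<close>. The letters \<open>a\<close> separate \<open>g\<close> from \<open>h\<close>, and the outer
  \<open>b\<close> restores the shape of \<open>bracketed\<close> words, so that the operation can be iterated
  without cancellation.
\<close>

definition comm_word :: "'a \<Rightarrow> 'a \<Rightarrow> (bool \<times> 'a) list \<Rightarrow> (bool \<times> 'a) list \<Rightarrow> (bool \<times> 'a) list" where
  "comm_word a b g h = [(True, b)] @ g @ [(True, a)] @ h @ [(False, a)] @ word_inv g @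
     [(True, a)] @ word_inv h @ [(False, a), (False, b)]"

definition power_word :: "'a \<Rightarrow> 'a \<Rightarrow> nat \<Rightarrow> (bool \<times> 'a) list" where
  "power_word a b k = (True, b) # replicate k (True, a) @ [(False, b)]"

text \<open>
  The entry made from \<open>a\<^sup>k\<close> undergoes \<open>N\<close> self-commutators before it enters the nested commutator.
  The word of interest is the one with \<open>k = N\<close>.
\<close>

primrec Thom_word :: "'a \<Rightarrow> 'a \<Rightarrow> nat \<Rightarrow> nat \<Rightarrow> (bool \<times> 'a) list" where
  "Thom_word a b N 0 = power_word a b 1"
| "Thom_word a b N (Suc k) =
     comm_word a b (((\<lambda>g. comm_word a b g g) ^^ N) (power_word a b (Suc k))) (Thom_word a b N k)"

text \<open>
  Such words and their inverses begin with \<open>b\<close> and end with \<open>b\<inverse>\<close>, so no cancellation occurs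
  when they are joined by powers of \<open>a\<close>.
\<close>

definition bracketed :: "'a \<Rightarrow> 'a \<Rightarrow> (bool \<times> 'a) list set" where
  "bracketed a b = {w. w \<noteq> [] \<and> hd w = (True, b) \<and> last w = (False, b) \<and> reduced w \<and> set w \<subseteq> UNIV \<times> {a, b}}"

lemma bracketed_word_inv: "w \<in> bracketed a b \<Longrightarrow> word_inv w \<in> bracketed a b"
  using reduced_word_inv[of w]
  by (auto simp: bracketed_def word_inv_def hd_map last_map hd_rev last_rev flip_def)

lemma bracketed_power_word:
  assumes "a \<noteq> b" "k > 0"
  shows "power_word a b k \<in> bracketed a b"
proof -
  have "reduced (replicate k (True, a))"
    by (simp add: successively_conv_nth flip_def)
  then show ?thesis
    using assms by (auto simp: bracketed_def power_word_def successively_Cons successively_append_iff flip_def)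
qed

lemma bracketed_comm_word:
  assumes "a \<noteq> b" and g: "g \<in> bracketed a b" and h: "h \<in> bracketed a b"
  shows "comm_word a b g h \<in> bracketed a b"
proof -
  have g': "word_inv g \<in> bracketed a b" and h': "word_inv h \<in> bracketed a b"
    using g h by (auto intro: bracketed_word_inv)
  show ?thesis
    using assms(1) g h g' h'
    unfolding bracketed_def comm_word_def
    by (auto simp: successively_Cons successively_append_iff flip_def hd_append)
qed

lemma bracketed_funpow:
  "a \<noteq> b \<Longrightarrow> g \<in> bracketed a b \<Longrightarrow> ((\<lambda>g. comm_word a b g g) ^^ n) g \<in> bracketed a b"
  by (induction n) (auto intro: bracketed_comm_word)

lemma bracketed_Thom_word: "a \<noteq> b \<Longrightarrow> Thom_word a b N k \<in> bracketed a b"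
  by (induction k) (auto intro!: bracketed_comm_word bracketed_funpow bracketed_power_word)

lemma length_Thom_word: "k < length (Thom_word a b N k)"
  by (induction k) (auto simp: comm_word_def power_word_def)

text \<open>
  With \<open>2\<mu>\<close> in place of \<open>\<mu>\<close> the commutator estimate is submultiplicative and the trivial bound is \<open>4\<close>.
  The entry made from the good power is at most \<open>(1/4)\<^bsup>2^N\<^esup>\<close>, and the other entries
  multiply this by at most \<open>4\<^sup>N\<close>.
\<close>

lemma Thom_word_bound:
  fixes \<mu> :: "(bool \<times> 'a) list \<Rightarrow> real"
  assumes ab: "a \<noteq> b"
    and range: "\<And>g. g \<in> bracketed a b \<Longrightarrow> 0 \<le> \<mu> g \<and> \<mu> g \<le> 2"
    and comm: "\<And>g h. g \<in> bracketed a b \<Longrightarrow> h \<in> bracketed a b \<Longrightarrow> \<mu> (comm_word a b g h) \<le> 2 * \<mu> g * \<mu> h"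
    and k: "0 < k" "k \<le> N" "\<mu> (power_word a b k) \<le> 1 / 8"
  shows "\<mu> (Thom_word a b N N) \<le> (1 / 4) ^ N"
proof -
  let ?q = "(1 / 4 :: real) ^ (2 ^ N)"
  let ?c = "\<lambda>j g. ((\<lambda>g. comm_word a b g g) ^^ j) g"
  have comm2: "2 * \<mu> (comm_word a b g h) \<le> (2 * \<mu> g) * (2 * \<mu> h)"
    if "g \<in> bracketed a b" "h \<in> bracketed a b" for g h
    using comm[OF that] by simp
  have c: "?c j (power_word a b i) \<in> bracketed a b" if "0 < i" for i j
    using ab that by (intro bracketed_funpow bracketed_power_word)
  have T: "Thom_word a b N i \<in> bracketed a b" for i using ab by (rule bracketed_Thom_word)
  have deep: "2 * \<mu> (?c j (power_word a b k)) \<le> (1 / 4) ^ (2 ^ j)" for j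
  proof (induction j)
    case 0
    then show ?case using k(3) by simp
  next
    case (Suc j)
    have "2 * \<mu> (?c (Suc j) (power_word a b k)) \<le> (2 * \<mu> (?c j (power_word a b k))) * (2 * \<mu> (?c j (power_word a b k)))"
      using comm2[OF c[OF k(1)] c[OF k(1)]] by simp
    also have "\<dots> \<le> (1 / 4) ^ (2 ^ j) * (1 / 4) ^ (2 ^ j)"
      using Suc.IH range[OF c[OF k(1)], of j] by (intro mult_mono) auto
    also have "\<dots> = (1 / 4) ^ (2 ^ Suc j)" by (simp add: power_add[symmetric] mult_2)
    finally show ?case .
  qed
  \<comment> \<open>the factor \<open>4\<close> in the base case comes from the inner word and is absorbed since \<open>k > 0\<close>\<close>
  have "2 * \<mu> (Thom_word a b N i) \<le> 4 ^ i * ?q" if "k \<le> i" for i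
    using that
  proof (induction i rule: dec_induct)
    case base
    obtain k' where k': "k = Suc k'" using k(1) by (cases k) auto
    have "2 * \<mu> (Thom_word a b N k) \<le> (2 * \<mu> (?c N (power_word a b k))) * (2 * \<mu> (Thom_word a b N k'))"
      using comm2[OF c[OF k(1)] T] by (simp add: k')
    also have "\<dots> \<le> ?q * 4"
      using deep[of N] range[OF c[OF k(1)], of N] range[OF T[of k']] by (intro mult_mono) auto
    also have "\<dots> \<le> 4 ^ k * ?q" using power_increasing[of 1 k "4::real"] k(1) by simp
    finally show ?case .
  next
    case (step i)
    have "2 * \<mu> (Thom_word a b N (Suc i)) \<le> (2 * \<mu> (?c N (power_word a b (Suc i)))) * (2 * \<mu> (Thom_word a b N i))"
      using comm2[OF c T, of "Suc i"] by simp
    also have "\<dots> \<le> 4 * (4 ^ i * ?q)"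
      by (rule mult_mono) (use step.IH range[OF c, of "Suc i" N] range[OF T[of i]] in auto)
    finally show ?case by simp
  qed
  from this[OF k(2)] have "2 * \<mu> (Thom_word a b N N) \<le> 4 ^ N * ?q" .
  also have "\<dots> \<le> 4 ^ N * (1 / 4) ^ (2 * N)"
  proof -
    have "2 * N \<le> 2 ^ N"
    proof (cases N)
      case (Suc n)
      then show ?thesis using Suc_leI[OF less_exp[of n]] by (simp add: algebra_simps)
    qed simp
    then show ?thesis by (intro mult_left_mono power_decreasing) auto
  qed
  also have "\<dots> = (1 / 4) ^ N" by (simp add: mult_2 power_add power_divide)
  finally show ?thesis using range[OF T[of N]] by linarith
qed

text \<open>
  Two powers of \<open>x\<close> lie in the same of the finitely many translates of a small neighbourhood that
  cover \<open>K\<close>; their quotient is the required power.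
\<close>

lemma (in compact_group) power_return:
  assumes \<nu>: "commutator_length K S \<nu>" and x: "x \<in> carrier K" and e: "\<epsilon> > 0"
  shows "\<exists>k>0. \<nu> (x [^] (k::nat)) \<le> \<epsilon>"
proof -
  obtain V where V: "openin S V" "\<one> \<in> V" "\<forall>g\<in>V. \<nu> g \<le> \<epsilon> / 2"
    using \<nu> e unfolding commutator_length_def by (meson half_gt_zero)
  obtain F where F: "finite F" "F \<subseteq> carrier K" "\<And>x. x \<in> carrier K \<Longrightarrow> \<exists>k\<in>F. x \<otimes> inv k \<in> V"
    by (rule finite_translates_cover[OF V(1,2)]) (rule that)
  have "\<exists>k\<in>F. x [^] i \<otimes> inv k \<in> V" for i :: nat using F(3) x by simp
  then obtain f where f: "\<And>i::nat. f i \<in> F \<and> x [^] i \<otimes> inv (f i) \<in> V" by metis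
  have "\<not> inj f"
    using f F(1) finite_imageD[of f UNIV] finite_subset[of "range f" F] by blast
  then obtain i j where "i < j" "f i = f j" unfolding inj_def by (metis linorder_neqE_nat)
  define k where "k = f i"
  have k: "k \<in> carrier K" using f F(2) by (auto simp: k_def)
  have u: "x [^] i \<otimes> inv k \<in> V" "x [^] j \<otimes> inv k \<in> V"
    using f[of i] f[of j] \<open>f i = f j\<close> by (auto simp: k_def)
  have eq: "(x [^] j \<otimes> inv k) \<otimes> inv (x [^] i \<otimes> inv k) = x [^] (j - i)"
  proof -
    have "x [^] j = x [^] (j - i) \<otimes> x [^] i" using x \<open>i < j\<close> by (simp add: nat_pow_mult)
    then show ?thesis using x k by (simp add: inv_mult_group m_assoc cancel_left)
  qed
  have "\<nu> (x [^] (j - i)) \<le> \<nu> (x [^] j \<otimes> inv k) + \<nu> (inv (x [^] i \<otimes> inv k))"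
    unfolding eq[symmetric] using \<nu> x k unfolding commutator_length_def by simp
  also have "\<nu> (inv (x [^] i \<otimes> inv k)) \<le> \<nu> (x [^] i \<otimes> inv k)"
    using \<nu> x k unfolding commutator_length_def by simp
  finally have "\<nu> (x [^] (j - i)) \<le> \<epsilon>" using bspec[OF V(3) u(1)] bspec[OF V(3) u(2)] by simp
  then show ?thesis using \<open>i < j\<close> by (intro exI[of _ "j - i"]) simp
qed

lemma Thom_word_length_tendsto:
  assumes KS: "compact_group K S" and G: "group G" and h: "h \<in> hom G K"
    and a: "a \<in> carrier G" and b: "b \<in> carrier G" and ab: "a \<noteq> b"
    and \<nu>: "commutator_length K S \<nu>"
  shows "(\<lambda>N. \<nu> (h (word_value G (Thom_word a b N N)))) \<longlonglongrightarrow> 0"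
proof -
  interpret K: compact_group K S by fact
  interpret G: group G by fact
  interpret gh: group_hom G K h using h by unfold_locales
  define \<mu> where "\<mu> w = \<nu> (h (word_value G w))" for w
  have W: "set w \<subseteq> UNIV \<times> carrier G" if "w \<in> bracketed a b" for w
    using that a b by (auto simp: bracketed_def)
  have val: "word_value G w \<in> carrier G" if "w \<in> bracketed a b" for w
    using W[OF that] by (rule G.word_value_closed)
  have range: "0 \<le> \<mu> w \<and> \<mu> w \<le> 2" if "w \<in> bracketed a b" for w
    using \<nu> val[OF that] unfolding commutator_length_def \<mu>_def by simp
  have comm: "\<mu> (comm_word a b g k) \<le> 2 * \<mu> g * \<mu> k" if g: "g \<in> bracketed a b" and k: "k \<in> bracketed a b" for g k
  proof -
    define x where "x = h (word_value G g)"
    define y where "y = h a \<otimes>\<^bsub>K\<^esub> h (word_value G k) \<otimes>\<^bsub>K\<^esub> inv\<^bsub>K\<^esub> h a"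
    have closed: "x \<in> carrier K" "y \<in> carrier K" "h a \<in> carrier K" "h b \<in> carrier K"
      "h (word_value G k) \<in> carrier K"
      using val[OF g] val[OF k] a b by (auto simp: x_def y_def)
    have "h (word_value G (comm_word a b g k)) = h b \<otimes>\<^bsub>K\<^esub> (x \<otimes>\<^bsub>K\<^esub> y \<otimes>\<^bsub>K\<^esub> inv\<^bsub>K\<^esub> x \<otimes>\<^bsub>K\<^esub> inv\<^bsub>K\<^esub> y) \<otimes>\<^bsub>K\<^esub> inv\<^bsub>K\<^esub> h b"
      using W[OF g] W[OF k] G.set_word_inv[OF W[OF g]] G.set_word_inv[OF W[OF k]] val[OF g] val[OF k] a b
      by (simp add: comm_word_def G.word_value_append G.word_value_closed G.word_value_inv x_def y_def
          K.m_assoc K.inv_mult_group)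
    then have "\<mu> (comm_word a b g k) \<le> \<nu> (x \<otimes>\<^bsub>K\<^esub> y \<otimes>\<^bsub>K\<^esub> inv\<^bsub>K\<^esub> x \<otimes>\<^bsub>K\<^esub> inv\<^bsub>K\<^esub> y)"
      using \<nu> closed unfolding commutator_length_def \<mu>_def by simp
    also have "\<dots> \<le> 2 * \<nu> x * \<nu> y"
      using \<nu> closed unfolding commutator_length_def by simp
    also have "\<dots> \<le> 2 * \<nu> x * \<nu> (h (word_value G k))"
    proof (rule mult_left_mono)
      show "\<nu> y \<le> \<nu> (h (word_value G k))"
        unfolding y_def using \<nu> closed unfolding commutator_length_def by simp
      show "0 \<le> 2 * \<nu> x" using \<nu> closed unfolding commutator_length_def by simp
    qed
    finally show ?thesis by (simp add: \<mu>_def x_def)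
  qed
  obtain k :: nat where k: "k > 0" "\<nu> (h a [^]\<^bsub>K\<^esub> k) \<le> 1 / 8"
    using K.power_return[OF \<nu>, of "h a" "1 / 8"] a by auto
  have "a \<otimes>\<^bsub>G\<^esub> a [^]\<^bsub>G\<^esub> n = a [^]\<^bsub>G\<^esub> n \<otimes>\<^bsub>G\<^esub> a" for n :: nat
    using G.nat_pow_Suc2[OF a, of n] by simp
  then have "word_value G (replicate n (True, a)) = a [^]\<^bsub>G\<^esub> n" for n
    by (induction n) simp_all
  then have "word_value G (power_word a b n) = b \<otimes>\<^bsub>G\<^esub> a [^]\<^bsub>G\<^esub> n \<otimes>\<^bsub>G\<^esub> inv\<^bsub>G\<^esub> b" for n
    using a b G.word_value_append[of "replicate n (True, a)" "[(False, b)]"]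
    by (simp add: power_word_def G.m_assoc subset_iff)
  then have "\<mu> (power_word a b k) = \<nu> (h b \<otimes>\<^bsub>K\<^esub> (h a [^]\<^bsub>K\<^esub> k) \<otimes>\<^bsub>K\<^esub> inv\<^bsub>K\<^esub> h b)"
    using a b by (simp add: \<mu>_def gh.hom_nat_pow)
  also have "\<dots> \<le> \<nu> (h a [^]\<^bsub>K\<^esub> k)"
    using \<nu> a b unfolding commutator_length_def by simp
  finally have small: "\<mu> (power_word a b k) \<le> 1 / 8" using k(2) by linarith
  have "\<mu> (Thom_word a b N N) \<le> (1 / 4) ^ N" if "k \<le> N" for N
    by (rule Thom_word_bound[OF ab range comm k(1) that small])
  moreover have "0 \<le> \<mu> (Thom_word a b N N)" for N
    using range[OF bracketed_Thom_word[OF ab]] by blast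
  ultimately have "\<forall>\<^sub>F N in sequentially. norm (\<mu> (Thom_word a b N N)) \<le> (1 / 4) ^ N"
    unfolding eventually_sequentially by auto
  moreover have "(\<lambda>N. (1 / 4 :: real) ^ N) \<longlonglongrightarrow> 0" by (rule LIMSEQ_power_zero) simp
  ultimately show ?thesis unfolding \<mu>_def by (rule Lim_null_comparison)
qed

text \<open>
  Each point of the compact group outside a given neighbourhood of \<open>1\<close> has a length that is bounded
  below near that point but tends to \<open>0\<close> along the words, so the words eventually leave a
  neighbourhood of the point. Finitely many such neighbourhoods cover the outside.
\<close>

theorem Thom_word_eventually_in:
  assumes T: "precompact_group G T" and a: "a \<in> carrier G" and b: "b \<in> carrier G" and ab: "a \<noteq> b"
    and U: "openin T U" "\<one>\<^bsub>G\<^esub> \<in> U"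
  shows "\<forall>\<^sub>F N in sequentially. word_value G (Thom_word a b N N) \<in> U"
proof -
  obtain K :: "'a set set monoid" and S h where KS: "group_topology K S" "compact_space S"
    and h: "h \<in> hom G K" "embedding_map T S h"
    using T unfolding precompact_group_def embeds_topologically_in_def by blast
  have gT: "group_topology G T" using T by (simp add: precompact_group_def)
  interpret G: group G using gT by (simp add: group_topology_def)
  have tT: "topspace T = carrier G" using gT by (simp add: group_topology_def)
  have cK: "compact_group K S"
    using KS by (auto simp: compact_group_def compact_group_axioms_def group_topology_def)
  interpret K: compact_group K S by fact
  interpret gh: group_hom G K h using h by unfold_locales
  have "openin (subtopology S (h ` carrier G)) (h ` U)"
    using h(2) U(1) homeomorphic_imp_open_map unfolding embedding_map_def open_map_def tT by blast
  then obtain W where W: "openin S W" "h ` U = W \<inter> h ` carrier G"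
    by (auto simp: openin_subtopology)
  have "inj_on h (topspace T)"
    using h(2) homeomorphic_imp_injective_map unfolding embedding_map_def by blast
  then have inj: "inj_on h (carrier G)" by (simp add: tT)
  have UG: "U \<subseteq> carrier G" using openin_subset[OF U(1)] tT by simp
  have oneW: "\<one>\<^bsub>K\<^esub> \<in> W" using W(2) U(2) gh.hom_one by (metis IntD1 imageI)
  define w where "w N = word_value G (Thom_word a b N N)" for N
  have w: "w N \<in> carrier G" for N
    unfolding w_def using bracketed_Thom_word[OF ab, of N N] a b
    by (intro G.word_value_closed) (auto simp: bracketed_def)
  have away: "\<exists>O'. openin S O' \<and> z \<in> O' \<and> (\<forall>\<^sub>F N in sequentially. h (w N) \<notin> O')"
    if z: "z \<in> carrier K - W" for z
  proof -
    have zK: "z \<in> carrier K" using z by simp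
    obtain \<nu> where \<nu>: "commutator_length K S \<nu>" "\<nu> z > 0"
      by (rule K.separating_commutator_length[OF W(1) oneW, of z]) (use z that in auto)
    obtain V where V: "openin S V" "\<one>\<^bsub>K\<^esub> \<in> V" "\<forall>g\<in>V. \<nu> g \<le> \<nu> z / 2"
      using \<nu> unfolding commutator_length_def by (meson half_gt_zero)
    define O' where "O' = {g \<in> carrier K. inv\<^bsub>K\<^esub> g \<otimes>\<^bsub>K\<^esub> z \<in> V}"
    have "openin S O'" unfolding O'_def
      using zK by (intro K.openin_preimage[OF V(1)] K.continuous_mult K.continuous_inv) auto
    moreover have "z \<in> O'" using zK V(2) by (simp add: O'_def)
    moreover have big: "\<nu> z / 2 \<le> \<nu> g" if g: "g \<in> O'" for g
    proof -
      have gK: "g \<in> carrier K" and gV: "inv\<^bsub>K\<^esub> g \<otimes>\<^bsub>K\<^esub> z \<in> V" using g by (auto simp: O'_def)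
      have "\<nu> (g \<otimes>\<^bsub>K\<^esub> (inv\<^bsub>K\<^esub> g \<otimes>\<^bsub>K\<^esub> z)) \<le> \<nu> g + \<nu> (inv\<^bsub>K\<^esub> g \<otimes>\<^bsub>K\<^esub> z)"
        using \<nu>(1) gK zK unfolding commutator_length_def by simp
      then show ?thesis using bspec[OF V(3) gV] gK zK by (simp add: K.cancel_left)
    qed
    moreover have "\<forall>\<^sub>F N in sequentially. \<nu> (h (w N)) < \<nu> z / 2"
      using order_tendstoD(2)[OF Thom_word_length_tendsto[OF cK G.is_group h(1) a b ab \<nu>(1)], of "\<nu> z / 2"] \<nu>(2)
      by (simp add: w_def)
    then have "\<forall>\<^sub>F N in sequentially. h (w N) \<notin> O'"
      by eventually_elim (use big in force)
    ultimately show ?thesis by blast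
  qed
  then obtain O' where O': "\<And>z. z \<in> carrier K - W \<Longrightarrow>
      openin S (O' z) \<and> z \<in> O' z \<and> (\<forall>\<^sub>F N in sequentially. h (w N) \<notin> O' z)" by metis
  have "compactin S (carrier K - W)"
    using closedin_compact_space[OF KS(2) closedin_diff[OF closedin_topspace W(1)]] by simp
  then have "(\<forall>U\<in>O' ` (carrier K - W). openin S U) \<and> carrier K - W \<subseteq> \<Union> (O' ` (carrier K - W)) \<longrightarrow>
      (\<exists>\<F>. finite \<F> \<and> \<F> \<subseteq> O' ` (carrier K - W) \<and> carrier K - W \<subseteq> \<Union> \<F>)"
    unfolding compactin_def by (elim conjE) (rule spec)
  moreover have "\<forall>U\<in>O' ` (carrier K - W). openin S U" "carrier K - W \<subseteq> \<Union> (O' ` (carrier K - W))"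
    using O' by auto
  ultimately have "\<exists>\<F>. finite \<F> \<and> \<F> \<subseteq> O' ` (carrier K - W) \<and> carrier K - W \<subseteq> \<Union> \<F>"
    by blast
  then obtain F where F: "finite F" "F \<subseteq> carrier K - W" "carrier K - W \<subseteq> \<Union> (O' ` F)"
    by (metis finite_subset_image)
  have "\<forall>\<^sub>F N in sequentially. \<forall>z\<in>F. h (w N) \<notin> O' z"
    using F O' by (intro eventually_ball_finite) auto
  then show ?thesis
  proof eventually_elim
    case (elim N)
    have "h (w N) \<in> carrier K" using w by simp
    then have "h (w N) \<in> W" using elim F(3) by auto
    then have "h (w N) \<in> h ` U" using W(2) w by blast
    then have "w N \<in> U" using inj UG w by (auto dest: inj_onD)
    then show ?case by (simp add: w_def)
  qed
qed


section \<open>Free groups are residually finite\<close>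

abbreviation map_word :: "('a \<Rightarrow> 'b) \<Rightarrow> (bool \<times> 'a) list \<Rightarrow> (bool \<times> 'b) list" where
  "map_word f \<equiv> map (apsnd f)"

lemma (in group) word_value_cancel:
  assumes "set u \<subseteq> UNIV \<times> carrier G" "set v \<subseteq> UNIV \<times> carrier G" "snd l \<in> carrier G"
  shows "word_value G (u @ l # flip l # v) = word_value G (u @ v)"
proof -
  have "set (l # flip l # v) \<subseteq> UNIV \<times> carrier G" using assms by (cases l) (auto simp: flip_def)
  then have "word_value G (u @ l # flip l # v) = word_value G u \<otimes> word_value G (l # flip l # v)"
    using assms(1) by (intro word_value_append)
  also have "word_value G (l # flip l # v) = word_value G v"
    using assms by (simp add: letter_value_flip letter_value_closed word_value_closed flip: m_assoc)
  finally show ?thesis using assms word_value_append by simp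
qed

text \<open>
  The same cancellations are carried out in \<open>G\<close> and, for the substituted letters, in \<open>H\<close>. This is
  what makes the evaluation of reduced words in \<open>H\<close> multiplicative.
\<close>

lemma word_reduces:
  assumes G: "group G" "S \<subseteq> carrier G" and H: "group H" "f ` S \<subseteq> carrier H" and w: "set w \<subseteq> UNIV \<times> S"
  shows "\<exists>w'\<in>reduced_words S. word_value G w' = word_value G w \<and>
    word_value H (map_word f w') = word_value H (map_word f w)"
  using w
proof (induction "length w" arbitrary: w rule: less_induct)
  case less
  show ?case
  proof (cases "reduced w")
    case True
    then show ?thesis using less.prems by (intro bexI[of _ w]) (auto simp: reduced_words_altdef)
  next
    case False
    then obtain i where i: "Suc i < length w" "w ! Suc i = flip (w ! i)"
      by (auto simp: successively_conv_nth)
    define u v l where "u = take i w" and "v = drop (Suc (Suc i)) w" and "l = w ! i"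
    have "w = u @ l # drop (Suc i) w" using i by (simp add: u_def l_def id_take_nth_drop[symmetric])
    also have "drop (Suc i) w = flip l # v" using i by (simp add: v_def l_def Cons_nth_drop_Suc[symmetric])
    finally have w: "w = u @ l # flip l # v" .
    have sub: "set u \<subseteq> UNIV \<times> S" "set v \<subseteq> UNIV \<times> S" "snd l \<in> S" using less.prems by (auto simp: w)
    have fl: "apsnd f (flip l) = flip (apsnd f l)" by (cases l) (simp add: flip_def)
    have "word_value G w = word_value G (u @ v)"
      unfolding w by (rule group.word_value_cancel[OF G(1)]) (use sub G(2) in auto)
    moreover have "word_value H (map_word f w) = word_value H (map_word f (u @ v))"
      unfolding w map_append list.map fl
      by (rule group.word_value_cancel[OF H(1)]) (use sub H(2) in \<open>auto simp: apsnd_def\<close>)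
    moreover have "length (u @ v) < length w" by (simp add: w)
    ultimately show ?thesis using less.hyps[of "u @ v"] sub by auto
  qed
qed

lemma free_group_universal:
  assumes free: "free_group_on G S" and H: "group H" "f ` S \<subseteq> carrier H"
  obtains \<psi> where "\<psi> \<in> hom G H"
    "\<And>w. w \<in> reduced_words S \<Longrightarrow> \<psi> (word_value G w) = word_value H (map_word f w)"
proof -
  have G: "group G" "S \<subseteq> carrier G" and bij: "bij_betw (word_value G) (reduced_words S) (carrier G)"
    using free by (auto simp: free_group_on_def)
  interpret G: group G by fact
  interpret H: group H by fact
  define \<psi> where "\<psi> g = word_value H (map_word f (the_inv_into (reduced_words S) (word_value G) g))" for g
  have \<psi>: "\<psi> (word_value G w) = word_value H (map_word f w)" if "w \<in> reduced_words S" for w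
    using the_inv_into_f_f[OF bij_betw_imp_inj_on[OF bij] that] by (simp add: \<psi>_def)
  have setH: "set (map_word f w) \<subseteq> UNIV \<times> carrier H" if "w \<in> reduced_words S" for w
    using that H(2) by (fastforce simp: reduced_words_def)
  have setG: "set w \<subseteq> UNIV \<times> carrier G" if "w \<in> reduced_words S" for w
    using that G(2) by (auto simp: reduced_words_def)
  have "\<psi> \<in> hom G H"
  proof (rule homI)
    fix x assume "x \<in> carrier G"
    then obtain u where u: "u \<in> reduced_words S" "x = word_value G u" using bij by (auto simp: bij_betw_def)
    then show "\<psi> x \<in> carrier H" using \<psi> H.word_value_closed[OF setH] by simp
    fix y assume "y \<in> carrier G"
    then obtain v where v: "v \<in> reduced_words S" "y = word_value G v" using bij by (auto simp: bij_betw_def)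
    have "set (u @ v) \<subseteq> UNIV \<times> S" using u v by (auto simp: reduced_words_def)
    then obtain w where w: "w \<in> reduced_words S" "word_value G w = word_value G (u @ v)"
        "word_value H (map_word f w) = word_value H (map_word f (u @ v))"
      using word_reduces[OF G H] by blast
    have "\<psi> (x \<otimes>\<^bsub>G\<^esub> y) = \<psi> (word_value G w)"
      using G.word_value_append[OF setG setG] u v w by simp
    also have "\<dots> = word_value H (map_word f u @ map_word f v)" using \<psi>[OF w(1)] w(3) by simp
    also have "\<dots> = \<psi> x \<otimes>\<^bsub>H\<^esub> \<psi> y"
      using H.word_value_append[OF setH setH] u v \<psi> by simp
    finally show "\<psi> (x \<otimes>\<^bsub>G\<^esub> y) = \<psi> x \<otimes>\<^bsub>H\<^esub> \<psi> y" .
  qed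
  then show ?thesis using \<psi> by (rule that)
qed

lemma partial_injection_extends:
  assumes B: "finite B" "A \<subseteq> B" "f ` A \<subseteq> B" "inj_on f A"
  obtains p where "p permutes B" "\<And>x. x \<in> A \<Longrightarrow> p x = f x"
proof -
  have fin: "finite A" using B finite_subset by blast
  have "card (B - A) = card (B - f ` A)"
    using B fin by (simp add: card_Diff_subset card_image)
  then obtain q where q: "bij_betw q (B - A) (B - f ` A)"
    using B(1) finite_same_card_bij[of "B - A" "B - f ` A"] by auto
  define p where "p x = (if x \<in> A then f x else if x \<in> B then q x else x)" for x
  have "bij_betw p A (f ` A)"
    using B(4) by (auto simp: bij_betw_def inj_on_def p_def)
  moreover have "bij_betw p (B - A) (B - f ` A)"
    using q by (rule bij_betw_cong[THEN iffD1, rotated]) (auto simp: p_def)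
  ultimately have "bij_betw p (A \<union> (B - A)) (f ` A \<union> (B - f ` A))"
    by (rule bij_betw_combine) auto
  then have "bij_betw p B B" using B(2,3) by (simp add: Un_absorb1)
  then have "p permutes B" by (rule bij_imp_permutes) (use B(2) in \<open>auto simp: p_def\<close>)
  then show ?thesis by (rule that) (simp add: p_def)
qed

text \<open>
  Let the letters of the reduced word of \<open>g\<close> move \<open>n + 1\<close> points step by step down to \<open>1\<close>. Each
  generator is thereby prescribed on some of the points; since the word is reduced, these
  prescriptions are consistent and injective, so they extend to permutations. The resulting action
  moves the point \<open>n + 1\<close> to \<open>1\<close> under \<open>g\<close>.
\<close>

lemma free_group_residually_finite:
  assumes free: "free_group_on G S" and g: "g \<in> carrier G" "g \<noteq> \<one>\<^bsub>G\<^esub>"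
  shows "\<exists>n \<psi>. \<psi> \<in> hom G (sym_group n) \<and> \<psi> g \<noteq> \<one>\<^bsub>sym_group n\<^esub>"
proof -
  have bij: "bij_betw (word_value G) (reduced_words S) (carrier G)"
    using free by (auto simp: free_group_on_def)
  interpret G: group G using free by (simp add: free_group_on_def)
  obtain w where w: "w \<in> reduced_words S" "g = word_value G w" using g(1) bij by (auto simp: bij_betw_def)
  define n where "n = length w"
  have n: "n > 0" using g(2) w(2) by (auto simp: n_def)
  have wS: "set w \<subseteq> UNIV \<times> S" and red: "\<And>i. Suc i < n \<Longrightarrow> w ! Suc i \<noteq> flip (w ! i)"
    using w(1) by (auto simp: reduced_words_altdef successively_conv_nth n_def)
  let ?B = "{1..Suc n}"
  \<comment> \<open>positions are shifted by one because symmetric groups act on \<open>{1..n}\<close>: letter \<open>i\<close> is to move \<open>i + 2\<close> to \<open>i + 1\<close>\<close>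
  define A where "A s = {x \<in> ?B. (2 \<le> x \<and> w ! (x - 2) = (True, s)) \<or> (x \<le> n \<and> w ! (x - 1) = (False, s))}" for s
  define f where "f s x = (if 2 \<le> x \<and> w ! (x - 2) = (True, s) then x - 1 else x + 1)" for s x
  have "\<exists>p. p permutes ?B \<and> (\<forall>x\<in>A s. p x = f s x)" for s
  proof -
    have "inj_on (f s) (A s)"
    proof (rule inj_onI, rule ccontr)
      have *: False if xy: "x \<in> A s" "y \<in> A s" "f s x = f s y" "x < y" for x y
      proof -
        have x: "\<not> (2 \<le> x \<and> w ! (x - 2) = (True, s))" and y: "2 \<le> y \<and> w ! (y - 2) = (True, s)"
          and eq: "y = x + 2"
          using xy by (auto simp: f_def split: if_splits)
        then have "x \<le> n \<and> w ! (x - 1) = (False, s) \<and> 1 \<le> x" using xy(1) by (auto simp: A_def)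
        then obtain i where i: "x = Suc i" "w ! i = (False, s)" by (cases x) auto
        have "w ! Suc i = (True, s)" "Suc i < n" using y xy(2) by (auto simp: eq i A_def)
        then show False using red[of i] i by (simp add: flip_def)
      qed
      fix x y assume "x \<in> A s" "y \<in> A s" "f s x = f s y" "x \<noteq> y"
      then show False using *[of x y] *[of y x] by (cases "x < y") auto
    qed
    moreover have "f s ` A s \<subseteq> ?B" by (auto simp: A_def f_def)
    moreover have "A s \<subseteq> ?B" by (auto simp: A_def)
    ultimately obtain p where "p permutes ?B" "\<And>x. x \<in> A s \<Longrightarrow> p x = f s x"
      by (rule_tac partial_injection_extends[of ?B "A s" "f s"]) auto
    then show ?thesis by blast
  qed
  then obtain p where p: "\<And>s. p s permutes ?B" "\<And>s x. x \<in> A s \<Longrightarrow> p s x = f s x" by metis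
  interpret H: group "sym_group (Suc n)" by (rule sym_group_is_group)
  have pH: "p s \<in> carrier (sym_group (Suc n))" for s using p(1) by (simp add: sym_group_carrier)
  obtain \<psi> where \<psi>: "\<psi> \<in> hom G (sym_group (Suc n))"
    "\<And>w. w \<in> reduced_words S \<Longrightarrow> \<psi> (word_value G w) = word_value (sym_group (Suc n)) (map_word p w)"
    by (rule free_group_universal[OF free H.is_group, of p]) (use pH that in auto)
  have letter: "letter_value (sym_group (Suc n)) (apsnd p (w ! i)) (Suc (Suc i)) = Suc i" if i: "i < n" for i
  proof -
    obtain c s where l: "w ! i = (c, s)" by force
    show ?thesis
    proof (cases c)
      case True
      then have "Suc (Suc i) \<in> A s" using i l by (simp add: A_def)
      then show ?thesis using True l by (simp add: p(2) f_def)
    next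
      case False
      then have A: "Suc i \<in> A s" using i l by (simp add: A_def)
      have "\<not> (2 \<le> Suc i \<and> w ! (Suc i - 2) = (True, s))"
      proof
        assume "2 \<le> Suc i \<and> w ! (Suc i - 2) = (True, s)"
        then obtain j where "i = Suc j" "w ! j = (True, s)" by (cases i) auto
        then show False using red[of j] i l False by (simp add: flip_def)
      qed
      then have "p s (Suc i) = Suc (Suc i)" using p(2)[OF A] by (simp add: f_def)
      then have "inv' (p s) (Suc (Suc i)) = Suc i"
        using permutes_inv_eq[OF p(1)] by simp
      then show ?thesis using False l pH by simp
    qed
  qed
  have "word_value (sym_group (Suc n)) (map_word p (drop i w)) (Suc n) = Suc i" if "i \<le> n" for i
    using that
  proof (induction i rule: inc_induct)
    case base
    then show ?case by (simp add: n_def word_value_def sym_group_one)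
  next
    case (step i)
    have "drop i w = w ! i # drop (Suc i) w" using step.hyps by (simp add: n_def Cons_nth_drop_Suc)
    then show ?case using step letter[of i] by (simp add: sym_group_mult)
  qed
  from this[of 0] have "\<psi> g (Suc n) = 1" using \<psi>(2)[OF w(1)] w(2) by simp
  then have "\<psi> g \<noteq> \<one>\<^bsub>sym_group (Suc n)\<^esub>" using n by (auto simp: sym_group_one)
  then show ?thesis using \<psi>(1) by blast
qed

lemma group_topology_discrete:
  assumes "group H"
  shows "group_topology H (discrete_topology (carrier H))"
proof -
  interpret group H by fact
  show ?thesis
    using is_group by (auto simp: group_topology_def simp flip: prod_topology_discrete_topology)
qed

lemma group_topology_product:
  assumes "\<And>i. i \<in> I \<Longrightarrow> group_topology (H i) (X i)"
  shows "group_topology (product_group I H) (product_topology X I)"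
proof -
  have g: "group (H i)" and t: "topspace (X i) = carrier (H i)"
    and m: "continuous_map (prod_topology (X i) (X i)) (X i) (\<lambda>(x, y). x \<otimes>\<^bsub>H i\<^esub> y)"
    and v: "continuous_map (X i) (X i) (\<lambda>x. inv\<^bsub>H i\<^esub> x)" if "i \<in> I" for i
    using assms[OF that] by (auto simp: group_topology_def)
  have P: "group (product_group I H)" using g by simp
  let ?X = "product_topology X I"
  have top: "topspace ?X = carrier (product_group I H)" using t by (auto simp: PiE_def Pi_def)
  have proj: "continuous_map ?X (X i) (\<lambda>x. x i)" if "i \<in> I" for i
    using that by (rule continuous_map_product_projection)
  have "continuous_map (prod_topology ?X ?X) ?X (\<lambda>(x, y). x \<otimes>\<^bsub>product_group I H\<^esub> y)"
    unfolding continuous_map_componentwise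
  proof (intro conjI ballI)
    fix i assume i: "i \<in> I"
    have "continuous_map (prod_topology ?X ?X) (prod_topology (X i) (X i)) (\<lambda>p. (fst p i, snd p i))"
      using continuous_map_compose[OF continuous_map_fst proj[OF i]] continuous_map_compose[OF continuous_map_snd proj[OF i]]
      by (intro continuous_map_pairedI) (simp_all add: o_def)
    from continuous_map_compose[OF this m[OF i]]
    show "continuous_map (prod_topology ?X ?X) (X i) (\<lambda>x. (case x of (x, y) \<Rightarrow> x \<otimes>\<^bsub>product_group I H\<^esub> y) i)"
      using i by (simp add: o_def case_prod_unfold)
  qed auto
  moreover have "continuous_map ?X ?X (\<lambda>x. inv\<^bsub>product_group I H\<^esub> x)"
  proof (rule continuous_map_eq)
    show "continuous_map ?X ?X (\<lambda>x. \<lambda>i\<in>I. inv\<^bsub>H i\<^esub> x i)"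
      unfolding continuous_map_componentwise
    proof (intro conjI ballI)
      fix i assume i: "i \<in> I"
      from continuous_map_compose[OF proj[OF i] v[OF i]] i
      show "continuous_map ?X (X i) (\<lambda>x. (\<lambda>i\<in>I. inv\<^bsub>H i\<^esub> x i) i)" by (simp add: o_def)
    qed auto
    show "(\<lambda>i\<in>I. inv\<^bsub>H i\<^esub> x i) = inv\<^bsub>product_group I H\<^esub> x" if "x \<in> topspace ?X" for x
      using that g by (simp add: top[simplified])
  qed
  ultimately show ?thesis using P top by (simp add: group_topology_def)
qed

lemma continuous_map_into_pullback:
  assumes "continuous_map X S (\<lambda>x. h (f x))" "f ` topspace X \<subseteq> A"
  shows "continuous_map X (pullback_topology A h S) f"
  using assms by (intro continuous_map_pullback') (auto simp: o_def)

lemma group_topology_pullback: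
  assumes G: "group G" and K: "group_topology K S" and h: "h \<in> hom G K" "inj_on h (carrier G)"
  defines "T \<equiv> pullback_topology (carrier G) h S"
  shows "group_topology G T" "embeds_topologically_in G T K S" "Hausdorff_space S \<Longrightarrow> Hausdorff_space T"
proof -
  interpret G: group G by fact
  interpret K: group K using K by (simp add: group_topology_def)
  interpret gh: group_hom G K h using h by unfold_locales
  have tS: "topspace S = carrier K"
    and m: "continuous_map (prod_topology S S) S (\<lambda>(x, y). x \<otimes>\<^bsub>K\<^esub> y)"
    and v: "continuous_map S S (\<lambda>x. inv\<^bsub>K\<^esub> x)"
    using K by (auto simp: group_topology_def)
  have tT: "topspace T = carrier G"
    using gh.hom_closed by (auto simp: T_def topspace_pullback_topology tS)
  have ch: "continuous_map T S h"
    using continuous_map_pullback[OF continuous_map_id, of "carrier G" h S] by (simp add: T_def)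
  note into = continuous_map_into_pullback[where A="carrier G" and h=h and S=S, folded T_def]
  show "group_topology G T"
    unfolding group_topology_def
  proof (intro conjI G.is_group tT)
    have "continuous_map (prod_topology T T) (prod_topology S S) (\<lambda>p. (h (fst p), h (snd p)))"
      using continuous_map_compose[OF continuous_map_fst ch] continuous_map_compose[OF continuous_map_snd ch]
      by (intro continuous_map_pairedI) (simp_all add: o_def)
    from continuous_map_compose[OF this m]
    have "continuous_map (prod_topology T T) S (\<lambda>p. h (fst p) \<otimes>\<^bsub>K\<^esub> h (snd p))" by (simp add: o_def)
    then have "continuous_map (prod_topology T T) S (\<lambda>p. h (case p of (x, y) \<Rightarrow> x \<otimes>\<^bsub>G\<^esub> y))"
      by (rule continuous_map_eq) (auto simp: tT)
    then show "continuous_map (prod_topology T T) T (\<lambda>(x, y). x \<otimes>\<^bsub>G\<^esub> y)"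
      by (rule into) (auto simp: tT)
    have "continuous_map T S (\<lambda>x. inv\<^bsub>K\<^esub> h x)" using continuous_map_compose[OF ch v] by (simp add: o_def)
    then have "continuous_map T S (\<lambda>x. h (inv\<^bsub>G\<^esub> x))"
      by (rule continuous_map_eq) (simp add: tT)
    then show "continuous_map T T (\<lambda>x. inv\<^bsub>G\<^esub> x)"
      by (rule into) (auto simp: tT)
  qed
  have "embedding_map T S h"
    unfolding embedding_map_def tT
  proof (rule bijective_open_imp_homeomorphic_map)
    show "continuous_map T (subtopology S (h ` carrier G)) h"
      using ch by (auto simp: continuous_map_in_subtopology tT)
    show "open_map T (subtopology S (h ` carrier G)) h"
      unfolding open_map_def
    proof (intro allI impI)
      fix U assume "openin T U"
      then obtain O' where O': "openin S O'" "U = h -` O' \<inter> carrier G"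
        by (auto simp: T_def openin_pullback_topology)
      then have "h ` U = O' \<inter> h ` carrier G" by auto
      then show "openin (subtopology S (h ` carrier G)) (h ` U)"
        using O'(1) by (auto simp: openin_subtopology)
    qed
    show "h ` topspace T = topspace (subtopology S (h ` carrier G))"
      using gh.hom_closed by (auto simp: tT tS)
    show "inj_on h (topspace T)" using h(2) by (simp add: tT)
  qed
  then show emb: "embeds_topologically_in G T K S"
    using h(1) unfolding embeds_topologically_in_def by blast
  assume "Hausdorff_space S"
  then show "Hausdorff_space T"
    using \<open>embedding_map T S h\<close> unfolding embedding_map_def
    by (metis Hausdorff_space_subtopology homeomorphic_Hausdorff_space homeomorphic_map_imp_homeomorphic_space)
qed

text \<open>
  \<open>G\<close> embeds in the product of the finite symmetric groups that detect its nontrivial elements.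
\<close>

theorem free_group_precompact_topology:
  assumes "free_group G"
  shows "\<exists>T. precompact_Hausdorff_topology G T"
proof -
  obtain S where free: "free_group_on G S" using assms by (auto simp: free_group_def)
  interpret G: group G using free by (simp add: free_group_on_def)
  let ?I = "carrier G - {\<one>\<^bsub>G\<^esub>}"
  obtain n \<psi> where \<psi>: "\<And>g. g \<in> ?I \<Longrightarrow> \<psi> g \<in> hom G (sym_group (n g)) \<and> \<psi> g g \<noteq> \<one>\<^bsub>sym_group (n g)\<^esub>"
    using free_group_residually_finite[OF free] by (metis Diff_iff insert_iff)
  let ?H = "\<lambda>g. sym_group (n g)"
  let ?X = "\<lambda>g. discrete_topology (carrier (?H g))"
  let ?K = "product_group ?I ?H" and ?S = "product_topology ?X ?I"
  define h where "h x = (\<lambda>g\<in>?I. \<psi> g x)" for x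
  have K: "group_topology ?K ?S"
    by (intro group_topology_product group_topology_discrete sym_group_is_group)
  then interpret K: group ?K by (simp add: group_topology_def)
  have fin: "finite (carrier (?H g))" for g
    using finite_permutations[of "{1..n g}"] by (simp add: sym_group_def)
  have cS: "compact_space ?S"
    using fin by (auto simp: compact_space_product_topology compact_space_discrete_topology)
  have HS: "Hausdorff_space ?S" by (simp add: Hausdorff_space_product_topology)
  have h: "h \<in> hom G ?K"
  proof (rule homI)
    fix x y assume "x \<in> carrier G" "y \<in> carrier G"
    then show "h x \<in> carrier ?K" "h (x \<otimes>\<^bsub>G\<^esub> y) = h x \<otimes>\<^bsub>?K\<^esub> h y"
      using \<psi> by (auto simp: h_def hom_def intro!: restrict_ext)
  qed
  interpret gh: group_hom G ?K h using h by unfold_locales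
  have "inj_on h (carrier G)"
  proof (subst gh.inj_iff_trivial_ker, unfold kernel_def, intro equalityI subsetI)
    fix x assume "x \<in> {x \<in> carrier G. h x = \<one>\<^bsub>?K\<^esub>}"
    then have x: "x \<in> carrier G" "h x = \<one>\<^bsub>?K\<^esub>" by auto
    have "x \<notin> ?I"
    proof
      assume xI: "x \<in> ?I"
      then have "\<psi> x x = \<one>\<^bsub>?H x\<^esub>" using fun_cong[OF x(2), of x] by (simp add: h_def)
      then show False using \<psi>[OF xI] by simp
    qed
    then show "x \<in> {\<one>\<^bsub>G\<^esub>}" using x(1) by simp
  qed auto
  note T = group_topology_pullback[OF G.is_group K h this]
  have "precompact_group G (pullback_topology (carrier G) h ?S)"
    by (rule precompact_groupI[OF T(1) T(3)[OF HS] K cS T(2)])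
  then show ?thesis using T(3)[OF HS] unfolding precompact_Hausdorff_topology_def by blast
qed


section \<open>The convergent sequence\<close>

lemma (in group) word_value_commute:
  assumes "set w \<subseteq> UNIV \<times> carrier G" "x \<in> carrier G"
    and "\<And>l. l \<in> set w \<Longrightarrow> letter_value G l \<otimes> x = x \<otimes> letter_value G l"
  shows "word_value G w \<otimes> x = x \<otimes> word_value G w"
  using assms(1,3)
proof (induction w)
  case Nil
  then show ?case using assms(2) by simp
next
  case (Cons l w)
  have closed: "letter_value G l \<in> carrier G" "word_value G w \<in> carrier G"
    using Cons.prems(1) by (cases l, auto simp: letter_value_closed word_value_closed)+
  have "word_value G (l # w) \<otimes> x = letter_value G l \<otimes> (x \<otimes> word_value G w)"
    using Cons closed assms(2) by (simp add: m_assoc)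
  also have "\<dots> = x \<otimes> word_value G (l # w)"
    using Cons.prems(2)[of l] closed assms(2) by (simp flip: m_assoc)
  finally show ?case .
qed

text \<open>
  With at most one generator all letters commute, and therefore all words.
\<close>

lemma noncommutative_free_group_generators:
  assumes free: "free_group_on G S" and nc: "\<not> comm_group G"
  shows "\<exists>a\<in>S. \<exists>b\<in>S. a \<noteq> b"
proof (rule ccontr)
  assume "\<not> ?thesis"
  then have eq: "s = t" if "s \<in> S" "t \<in> S" for s t using that by blast
  have SG: "S \<subseteq> carrier G" and bij: "bij_betw (word_value G) (reduced_words S) (carrier G)"
    using free by (auto simp: free_group_on_def)
  interpret G: group G using free by (simp add: free_group_on_def)
  have letters: "letter_value G l \<otimes>\<^bsub>G\<^esub> letter_value G m = letter_value G m \<otimes>\<^bsub>G\<^esub> letter_value G l"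
    if "snd l \<in> S" "snd m \<in> S" for l m
    using eq[OF that] that SG by (cases l; cases m) (auto simp: subset_iff)
  have "comm_group G"
  proof (rule G.group_comm_groupI)
    fix x y assume "x \<in> carrier G" "y \<in> carrier G"
    then obtain u v where u: "u \<in> reduced_words S" "x = word_value G u"
      and v: "v \<in> reduced_words S" "y = word_value G v"
      using bij unfolding bij_betw_def by (metis (no_types, lifting) imageE)
    have set: "set u \<subseteq> UNIV \<times> carrier G" "set v \<subseteq> UNIV \<times> carrier G" using u v SG by (auto simp: reduced_words_def)
    have S: "snd l \<in> S" if "l \<in> set u \<or> l \<in> set v" for l using that u v by (auto simp: reduced_words_def)
    have "letter_value G l \<otimes>\<^bsub>G\<^esub> y = y \<otimes>\<^bsub>G\<^esub> letter_value G l" if l: "l \<in> set u" for l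
      unfolding v(2)
    proof (rule G.word_value_commute[symmetric, OF set(2)])
      show "letter_value G l \<in> carrier G" using S[of l] l SG by (auto intro: G.letter_value_closed)
    qed (use letters S l in blast)
    then show "x \<otimes>\<^bsub>G\<^esub> y = y \<otimes>\<^bsub>G\<^esub> x"
      unfolding u(2) using \<open>y \<in> carrier G\<close> by (intro G.word_value_commute[OF set(1)])
  qed
  with nc show False by contradiction
qed

text \<open>
  A neighbourhood of a point outside \<open>Y\<close> that is disjoint from a neighbourhood of the limit meets \<open>Y\<close>
  in finitely many points.
\<close>

lemma closedin_null_sequence_range:
  assumes T2: "Hausdorff_space T" and e: "e \<in> topspace T" and w: "\<And>N. w N \<in> topspace T"
    and lim: "\<And>U. openin T U \<Longrightarrow> e \<in> U \<Longrightarrow> \<forall>\<^sub>F N in sequentially. w N \<in> U"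
    and Y: "Y \<subseteq> insert e (range w)" "e \<in> Y"
  shows "closedin T Y"
  unfolding closedin_def
proof (intro conjI)
  show "Y \<subseteq> topspace T" using Y e w by auto
  show "openin T (topspace T - Y)"
  proof (subst openin_subopen, intro ballI)
    fix x assume x: "x \<in> topspace T - Y"
    then have "x \<noteq> e" using Y(2) by auto
    then obtain U V where UV: "openin T U" "openin T V" "e \<in> U" "x \<in> V" "disjnt U V"
      using T2 e x unfolding Hausdorff_space_def by (metis DiffD1)
    obtain M where M: "\<And>N. N \<ge> M \<Longrightarrow> w N \<in> U"
      using lim[OF UV(1,3)] by (auto simp: eventually_sequentially)
    have "Y \<inter> V \<subseteq> w ` {..<M}"
    proof
      fix y assume y: "y \<in> Y \<inter> V"
      then have "y \<notin> U" using UV(5) by (auto simp: disjnt_iff)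
      then obtain N where "y = w N" using y Y(1) UV(3) by auto
      then show "y \<in> w ` {..<M}" using M[of N] \<open>y \<notin> U\<close> by (cases "N < M") auto
    qed
    then have "finite (Y \<inter> V)" by (rule finite_subset) simp
    moreover have "Y \<inter> V \<subseteq> topspace T" using openin_subset[OF UV(2)] by auto
    ultimately have "closedin T (Y \<inter> V)" using T2 closedin_Hausdorff_finite by blast
    then have "openin T (V - Y \<inter> V)" using UV(2) by (rule openin_diff[rotated])
    then show "\<exists>O'. openin T O' \<and> x \<in> O' \<and> O' \<subseteq> topspace T - Y"
      using x UV(2,4) openin_subset[OF UV(2)] by (intro exI[of _ "V - Y \<inter> V"]) auto
  qed
qed

lemma compactin_null_sequence_range:
  assumes e: "e \<in> topspace T" and w: "\<And>N. w N \<in> topspace T"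
    and lim: "\<And>U. openin T U \<Longrightarrow> e \<in> U \<Longrightarrow> \<forall>\<^sub>F N in sequentially. w N \<in> U"
  shows "compactin T (insert e (range w))"
  unfolding compactin_def
proof (intro conjI allI impI)
  show "insert e (range w) \<subseteq> topspace T" using e w by auto
  fix \<U> assume "(\<forall>U\<in>\<U>. openin T U) \<and> insert e (range w) \<subseteq> \<Union> \<U>"
  then have \<U>: "\<And>U. U \<in> \<U> \<Longrightarrow> openin T U" "insert e (range w) \<subseteq> \<Union> \<U>" by auto
  then obtain U where U: "U \<in> \<U>" "e \<in> U" by auto
  obtain M where M: "\<And>N. N \<ge> M \<Longrightarrow> w N \<in> U"
    using lim[OF \<U>(1)[OF U(1)] U(2)] by (auto simp: eventually_sequentially)
  have "finite (w ` {..<M})" by simp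
  moreover have "w ` {..<M} \<subseteq> \<Union> \<U>" using \<U>(2) by auto
  ultimately obtain \<F> where F: "finite \<F>" "\<F> \<subseteq> \<U>" "w ` {..<M} \<subseteq> \<Union> \<F>"
    by (rule finite_subset_Union) (rule that)
  have "w N \<in> \<Union> (insert U \<F>)" for N
    using M[of N] F(3) by (cases "N < M") auto
  then have "insert e (range w) \<subseteq> \<Union> (insert U \<F>)" using U(2) by auto
  then show "\<exists>\<F>. finite \<F> \<and> \<F> \<subseteq> \<U> \<and> insert e (range w) \<subseteq> \<Union> \<F>"
    using F(1,2) U(1) by (intro exI[of _ "insert U \<F>"]) auto
qed

theorem corollary6p9:
  fixes G :: "('a, 'm) monoid_scheme"
  assumes "free_group G"
    and "\<not> comm_group G"
  shows "\<exists>X \<subseteq> carrier G.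
           infinite X \<and> countable X \<and>
           compact_space (subtopology (precompact_Markov_topology G) X) \<and>
           Hausdorff_space (subtopology (precompact_Markov_topology G) X) \<and>
           (\<exists>!x. x \<in> X \<and> \<not> openin (subtopology (precompact_Markov_topology G) X) {x})"
proof -
  let ?P = "precompact_Markov_topology G"
  obtain S where free: "free_group_on G S" using assms(1) by (auto simp: free_group_def)
  interpret G: group G using free by (simp add: free_group_on_def)
  have SG: "S \<subseteq> carrier G" and bij: "bij_betw (word_value G) (reduced_words S) (carrier G)"
    using free by (auto simp: free_group_on_def)
  obtain a b where ab: "a \<in> S" "b \<in> S" "a \<noteq> b"
    using noncommutative_free_group_generators[OF free assms(2)] by blast
  define v where "v N = Thom_word a b N N" for N
  define w where "w N = word_value G (v N)" for N
  have v: "v N \<in> reduced_words S" "v N \<noteq> []" "N < length (v N)" for N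
    using bracketed_Thom_word[OF ab(3), of N N] ab(1,2) length_Thom_word
    by (auto simp: v_def bracketed_def reduced_words_altdef)
  have wG: "w N \<in> carrier G" for N
    using v(1)[of N] bij by (auto simp: w_def bij_betw_def)
  have w1: "w N \<noteq> \<one>\<^bsub>G\<^esub>" for N
  proof
    assume "w N = \<one>\<^bsub>G\<^esub>"
    then have "word_value G (v N) = word_value G []" by (simp add: w_def)
    moreover have "[] \<in> reduced_words S" by (simp add: reduced_words_def)
    ultimately show False
      using inj_onD[OF bij_betw_imp_inj_on[OF bij]] v(1,2) by blast
  qed
  have "infinite (range v)"
  proof
    assume "finite (range v)"
    then have "finite (length ` range v)" by simp
    then obtain M where "\<And>N. length (v N) \<le> M" unfolding finite_nat_set_iff_bounded_le by auto
    then show False using v(3)[of M] by (meson not_less)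
  qed
  moreover have "inj_on (word_value G) (range v)"
    by (rule inj_on_subset[OF bij_betw_imp_inj_on[OF bij]]) (use v(1) in auto)
  ultimately have "infinite (word_value G ` range v)" by (simp add: finite_image_iff)
  then have inf: "infinite (range w)" by (simp add: w_def[abs_def] image_image)
  define X where "X = insert \<one>\<^bsub>G\<^esub> (range w)"
  have XG: "X \<subseteq> carrier G" using wG by (auto simp: X_def)
  have lim: "\<forall>\<^sub>F N in sequentially. w N \<in> U"
    if "precompact_Hausdorff_topology G T" "openin T U" "\<one>\<^bsub>G\<^esub> \<in> U" for T U
    unfolding w_def v_def
    using that ab SG by (intro Thom_word_eventually_in) (auto simp: precompact_Hausdorff_topology_def)
  have top: "topspace T = carrier G" if "precompact_Hausdorff_topology G T" for T
    using that by (simp add: precompact_Hausdorff_topology_def precompact_group_def group_topology_def)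
  have closed: "closedin ?P Y" if Y: "Y \<subseteq> X" "\<one>\<^bsub>G\<^esub> \<in> Y \<or> finite Y" for Y
    unfolding closedin_precompact_Markov_topology
  proof (intro conjI allI impI)
    show YG: "Y \<subseteq> carrier G" using Y(1) XG by auto
    fix T assume T: "precompact_Hausdorff_topology G T"
    then have T2: "Hausdorff_space T" by (simp add: precompact_Hausdorff_topology_def)
    show "closedin T Y"
    proof (cases "finite Y")
      case True
      then show ?thesis using T2 YG top[OF T] closedin_Hausdorff_finite by metis
    next
      case False
      then show ?thesis
        using closedin_null_sequence_range[OF T2, of "\<one>\<^bsub>G\<^esub>" w Y] lim[OF T] top[OF T] wG Y
        by (auto simp: X_def)
    qed
  qed
  obtain T0 where T0: "precompact_Hausdorff_topology G T0"
    using free_group_precompact_topology[OF assms(1)] by blast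
  have limP: "\<forall>\<^sub>F N in sequentially. w N \<in> U" if U: "openin ?P U" "\<one>\<^bsub>G\<^esub> \<in> U" for U
  proof -
    have "U \<subseteq> carrier G" "closedin T0 (carrier G - U)"
      using U(1) T0 by (auto simp: openin_precompact_Markov_topology)
    then have "openin T0 U" using top[OF T0] by (simp add: openin_closedin_eq)
    then show ?thesis using lim[OF T0] U(2) by blast
  qed
  let ?X = "subtopology ?P X"
  have tX: "topspace ?X = X" using XG by auto
  have opn: "openin ?X (X - Y)" if "Y \<subseteq> X" "\<one>\<^bsub>G\<^esub> \<in> Y \<or> finite Y" for Y
  proof -
    have "closedin ?X Y"
      using closed[OF that] that(1) by (simp add: closedin_subset_topspace)
    then show ?thesis using tX by (metis closedin_def)
  qed
  have isolated: "openin ?X {x}" if "x \<in> X" "x \<noteq> \<one>\<^bsub>G\<^esub>" for x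
  proof -
    have "openin ?X (X - (X - {x}))" using that by (intro opn) (auto simp: X_def)
    moreover have "X - (X - {x}) = {x}" using that by auto
    ultimately show ?thesis by simp
  qed
  have "\<not> openin ?X {\<one>\<^bsub>G\<^esub>}"
  proof
    assume "openin ?X {\<one>\<^bsub>G\<^esub>}"
    then obtain U where U: "openin ?P U" "{\<one>\<^bsub>G\<^esub>} = U \<inter> X" by (auto simp: openin_subtopology)
    then obtain N where "w N \<in> U" using limP[of U] eventually_sequentially by auto
    then show False using U(2) w1[of N] by (auto simp: X_def)
  qed
  then have "\<exists>!x. x \<in> X \<and> \<not> openin ?X {x}"
    using isolated by (intro ex1I[of _ "\<one>\<^bsub>G\<^esub>"]) (auto simp: X_def)
  moreover have "Hausdorff_space ?X"
    unfolding Hausdorff_space_def tX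
  proof (intro allI impI, elim conjE)
    have *: "\<exists>U V. openin ?X U \<and> openin ?X V \<and> x \<in> U \<and> y \<in> V \<and> disjnt U V"
      if "x \<in> X" "y \<in> X" "x \<noteq> y" "x \<noteq> \<one>\<^bsub>G\<^esub>" for x y
      using that isolated[of x] opn[of "{x}"]
      by (intro exI[of _ "{x}"] exI[of _ "X - {x}"]) (auto simp: disjnt_iff)
    fix x y assume "x \<in> X" "y \<in> X" "x \<noteq> y"
    then show "\<exists>U V. openin ?X U \<and> openin ?X V \<and> x \<in> U \<and> y \<in> V \<and> disjnt U V"
      using *[of x y] *[of y x] by (metis disjnt_sym)
  qed
  moreover have "compact_space ?X"
  proof -
    have "compactin ?P X"
      unfolding X_def using wG by (intro compactin_null_sequence_range limP) auto
    then show ?thesis by (simp add: compactin_subspace)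
  qed
  moreover have "infinite X" "countable X" using inf by (simp_all add: X_def)
  ultimately show ?thesis using XG by blast
qed

end
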